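(* Let $(X,d)$ be a complete metric space and let $\gamma:[0,a]\to X$ be a Lipschitz curve parametrised by arc-length. Suppose that $\gamma$ is either injective or an injective loop. Let $T\in\mathscr I_1(X)\setminus\{0\}$ be an integral metric $1$-current with $\mathrm{spt}(T)\subseteq\gamma([0,a])$. (i) If $\partial T=0$, then $\gamma$ is an injective Lipschitz loop and $T=k[\![\gamma]\!]$ for some $k\in\mathbb Z$. (ii) If $\gamma$ is injective and $\partial T=\partial[\![\gamma]\!]=\delta_{\gamma(a)}-\delta_{\gamma(0)}$, then $T=[\![\gamma]\!]$.
   Context: Standing assumption: the cardinality of every set is an Ulam number (consistent with ZFC); this guarantees that every finite Borel measure on a complete metric space has separable support and is concentrated on a $\sigma$-compact set. Metric currents (Ambrosio--Kirchheim), $k\ge0$. $\mathrm{LIP}(X)$ is the space of real-valued Lipschitz functions on $X$, $\mathrm{LIP}_b(X)$ the bounded ones, $\mathrm{Lip}(f)$ the Lipschitz constant; $\mathcal D^k(X)=\mathrm{LIP}_b(X)\times \mathrm{LIP}(X)^k$. A metric $k$-current is a multilinear functional $T:\mathcal D^k(X)\to\mathbb R$ such that: (i) $T(f,\pi_1,\dots,\pi_k)=\lim_n T(f,\pi_1^n,\dots,\pi_k^n)$ whenever $\pi_i^n\to\pi_i$ pointwise with $\sup_n \mathrm{Lip}(\pi_i^n)<\infty$ for every $i$; (ii) $T(f,\pi_1,\dots,\pi_k)=0$ whenever some $\pi_i$ is constant on a neighbourhood of $\{f\ne0\}$; (iii) there is a finite Borel measure $\mu$ on $X$ with $|T(f,\pi_1,\dots,\pi_k)|\le\prod_i\mathrm{Lip}(\pi_i)\int|f|\,d\mu$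 for all $(f,\pi_1,\dots,\pi_k)\in\mathcal D^k(X)$. The minimal such $\mu$ is the mass measure $\|T\|$; the support $\mathrm{spt}(T)$ is the support of $\|T\|$. Every metric $k$-current $T$ extends uniquely to $L^1(X,\|T\|)\times\mathrm{LIP}(X)^k$ with the same inequality, and for $E\subseteq X$ Borel, $T\llcorner E(f,\pi_1,\dots,\pi_k)=T(\mathbf 1_Ef,\pi_1,\dots,\pi_k)$. The boundary of a $1$-current $T$ is $\partial T(f)=T(1,f)$. $T$ is normal if $\partial T$ is a metric $0$-current. Pushforward under a Lipschitz map $\varphi$: $\varphi_\#T(f,\pi)=T(f\circ\varphi,\pi\circ\varphi)$. A $1$-current $T$ is rectifiable if $\|T\|$ is concentrated on a countably $\mathcal H^1$-rectifiable set and vanishes on $\mathcal H^1$-negligible Borel sets. A rectifiable $T$ is integer-rectifiable if for every Lipschitz $\varphi:X\to\mathbb R$ and every open $\Omega\subseteq X$ there is $\theta\in L^1(\mathbb R,\mathbb Z)$ with $\varphi_\#(T\llcorner\Omega)(f,\pi)=\int\theta f\pi'\,d\mathcal L^1$ for all $(f,\pi)\in\mathcal D^1(\mathbb R)$. $T$ is integral if it is integer-rectifiable and normal; $\mathscr I_1(X)$ is the set of integral $1$-currents. For a Lipschitz curve $\gamma:[a,b]\to X$, $[\![\gamma]\!]\in\mathscr I_1(X)$ is defined by $[\![\gamma]\!](f,\pi)=\int_a^b f(\gamma(t))(\pi\circ\gamma)'(t)\,dt$; its boundary is $\delta_{\gamma(b)}-\delta_{\gamma(a)}$, where $\delta_x$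 is the Dirac measure at $x$, viewed as the $0$-current $f\mapsto f(x)$. A loop is a curve with $\gamma(a)=\gamma(b)$; an injective loop is a loop such that $\gamma|_{[a,b)}$ is injective. Parametrised by arc-length means metric speed $|\dot\gamma|=1$ a.e. *)

theory Defs
  imports "HOL-Analysis.Analysis"
begin

text \<open>
  The standing set-theoretic assumption, for the cardinality of one set: every finite measure
  defined on all subsets of \<open>A\<close> and vanishing on singletons is zero.
\<close>

definition has_ulam_cardinality :: "'a set \<Rightarrow> bool" where
  "has_ulam_cardinality A \<longleftrightarrow>
     (\<forall>M. sets M = Pow A \<and> finite_measure M \<and> (\<forall>x\<in>A. emeasure M {x} = 0)
        \<longrightarrow> emeasure M A = 0)"


section \<open>Lipschitz functions and metric currents\<close>

definition LIP :: "('a::metric_space \<Rightarrow> real) set" where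
  "LIP = {f. \<exists>C. lipschitz_on C UNIV f}"

definition LIPb :: "('a::metric_space \<Rightarrow> real) set" where
  "LIPb = {f \<in> LIP. bounded (range f)}"

definition Lip :: "('a::metric_space \<Rightarrow> real) \<Rightarrow> real" where
  "Lip f = Inf {C. lipschitz_on C UNIV f}"

text \<open>
  A \<open>k\<close>-tuple \<open>(\<pi>\<^sub>1, \<dots>, \<pi>\<^sub>k)\<close> is a list of length \<open>k\<close>.  A functional on
  \<open>LIPb \<times> LIP\<^sup>k\<close> is represented by a total function; its values outside that domain carry no
  meaning, and equality of functionals is equality on the domain.
\<close>

definition LIPs :: "nat \<Rightarrow> ('a::metric_space \<Rightarrow> real) list set" where
  "LIPs k = {ps. length ps = k \<and> set ps \<subseteq> LIP}"

type_synonym 'a functional = "('a \<Rightarrow> real) \<Rightarrow> ('a \<Rightarrow> real) list \<Rightarrow> real"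

definition functional_eq ::
    "nat \<Rightarrow> 'a::metric_space functional \<Rightarrow> 'a functional \<Rightarrow> bool" where
  "functional_eq k T S \<longleftrightarrow> (\<forall>f\<in>LIPb. \<forall>ps\<in>LIPs k. T f ps = S f ps)"

definition multilinear_on ::
    "('a::metric_space \<Rightarrow> real) set \<Rightarrow> nat \<Rightarrow> 'a functional \<Rightarrow> bool" where
  "multilinear_on F k T \<longleftrightarrow>
     (\<forall>f\<in>F. \<forall>g\<in>F. \<forall>ps\<in>LIPs k. \<forall>a b.
        T (\<lambda>x. a * f x + b * g x) ps = a * T f ps + b * T g ps) \<and>
     (\<forall>f\<in>F. \<forall>ps\<in>LIPs k. \<forall>i<k. \<forall>p\<in>LIP. \<forall>q\<in>LIP. \<forall>a b.
        T f (ps[i := \<lambda>x. a * p x + b * q x]) = a * T f (ps[i := p]) + b * T f (ps[i := q]))"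

definition finite_borel_measure :: "'a::topological_space measure \<Rightarrow> bool" where
  "finite_borel_measure \<mu> \<longleftrightarrow> finite_measure \<mu> \<and> sets \<mu> = sets borel"

definition mass_bound :: "nat \<Rightarrow> 'a::metric_space functional \<Rightarrow> 'a measure \<Rightarrow> bool" where
  "mass_bound k T \<mu> \<longleftrightarrow> finite_borel_measure \<mu> \<and>
     (\<forall>f\<in>LIPb. \<forall>ps\<in>LIPs k. \<bar>T f ps\<bar> \<le> prod_list (map Lip ps) * (\<integral>x. \<bar>f x\<bar> \<partial>\<mu>))"

definition metric_current :: "nat \<Rightarrow> 'a::metric_space functional \<Rightarrow> bool" where
  "metric_current k T \<longleftrightarrow>
     multilinear_on LIPb k T \<and>
     (\<forall>f\<in>LIPb. \<forall>ps\<in>LIPs k. \<forall>pn.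
        (\<forall>n. pn n \<in> LIPs k) \<and>
        (\<forall>i<k. \<forall>x. (\<lambda>n. (pn n ! i) x) \<longlonglongrightarrow> (ps ! i) x) \<and>
        (\<forall>i<k. bdd_above (range (\<lambda>n. Lip (pn n ! i))))
        \<longrightarrow> (\<lambda>n. T f (pn n)) \<longlonglongrightarrow> T f ps) \<and>
     (\<forall>f\<in>LIPb. \<forall>ps\<in>LIPs k.
        (\<exists>i<k. \<exists>U c. open U \<and> {x. f x \<noteq> 0} \<subseteq> U \<and> (\<forall>x\<in>U. (ps ! i) x = c))
        \<longrightarrow> T f ps = 0) \<and>
     (\<exists>\<mu>. mass_bound k T \<mu>)"


section \<open>Mass measure, support, restriction\<close>

definition mass_measure :: "nat \<Rightarrow> 'a::metric_space functional \<Rightarrow> 'a measure" where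
  "mass_measure k T = (THE \<mu>. mass_bound k T \<mu> \<and>
     (\<forall>\<nu>. mass_bound k T \<nu> \<longrightarrow> (\<forall>A\<in>sets borel. emeasure \<mu> A \<le> emeasure \<nu> A)))"

definition measure_support :: "'a::metric_space measure \<Rightarrow> 'a set" where
  "measure_support \<mu> = {x. \<forall>r>0. emeasure \<mu> (ball x r) > 0}"

definition spt :: "nat \<Rightarrow> 'a::metric_space functional \<Rightarrow> 'a set" where
  "spt k T = measure_support (mass_measure k T)"

definition is_L1_extension ::
    "nat \<Rightarrow> 'a::metric_space functional \<Rightarrow> 'a functional \<Rightarrow> bool" where
  "is_L1_extension k T S \<longleftrightarrow>
     functional_eq k S T \<and>
     multilinear_on {f. integrable (mass_measure k T) f} k S \<and>
     (\<forall>f ps. integrable (mass_measure k T) f \<and> ps \<in> LIPs k \<longrightarrow>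
        \<bar>S f ps\<bar> \<le> prod_list (map Lip ps) * (\<integral>x. \<bar>f x\<bar> \<partial>mass_measure k T))"

text \<open>
  The extension is unique only on \<open>L\<^sup>1 \<times> LIP\<^sup>k\<close>; the value \<open>0\<close> is prescribed elsewhere so that
  the definite description is determined.
\<close>

definition L1_extension :: "nat \<Rightarrow> 'a::metric_space functional \<Rightarrow> 'a functional" where
  "L1_extension k T = (THE S. is_L1_extension k T S \<and>
     (\<forall>f ps. \<not> (integrable (mass_measure k T) f \<and> ps \<in> LIPs k) \<longrightarrow> S f ps = 0))"

definition current_restrict ::
    "nat \<Rightarrow> 'a::metric_space functional \<Rightarrow> 'a set \<Rightarrow> 'a functional" where
  "current_restrict k T E = (\<lambda>f ps. L1_extension k T (\<lambda>x. indicator E x * f x) ps)"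


section \<open>Boundary, push-forward, Dirac currents\<close>

definition current_boundary :: "'a functional \<Rightarrow> 'a functional" where
  "current_boundary T = (\<lambda>f ps. T (\<lambda>_. 1) (f # ps))"

definition normal_1current :: "'a::metric_space functional \<Rightarrow> bool" where
  "normal_1current T \<longleftrightarrow> metric_current 1 T \<and> metric_current 0 (current_boundary T)"

definition push_forward :: "('a \<Rightarrow> 'b) \<Rightarrow> 'a functional \<Rightarrow> 'b functional" where
  "push_forward \<phi> T = (\<lambda>f ps. T (f \<circ> \<phi>) (map (\<lambda>p. p \<circ> \<phi>) ps))"

definition dirac_current :: "'a \<Rightarrow> 'a functional" where
  "dirac_current x = (\<lambda>f ps. f x)"


section \<open>Rectifiability and integral currents\<close>

text \<open>
  One-dimensional Hausdorff (outer) measure.  Boundedness of the covering sets is required because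
  \<^const>\<open>diameter\<close> is only meaningful for bounded sets.
\<close>

definition hausdorff1_delta :: "real \<Rightarrow> 'a::metric_space set \<Rightarrow> ennreal" where
  "hausdorff1_delta \<delta> A =
     (INF C \<in> {C :: nat \<Rightarrow> 'a set. A \<subseteq> (\<Union>i. C i) \<and> (\<forall>i. bounded (C i) \<and> diameter (C i) \<le> \<delta>)}.
        \<Sum>i. ennreal (diameter (C i)))"

definition hausdorff1 :: "'a::metric_space set \<Rightarrow> ennreal" where
  "hausdorff1 A = (SUP \<delta> \<in> {0<..}. hausdorff1_delta \<delta> A)"

text \<open>
  The first conjunct is Caratheodory measurability with respect to the Hausdorff outer measure.
\<close>

definition countably_rectifiable1 :: "'a::metric_space set \<Rightarrow> bool" where
  "countably_rectifiable1 S \<longleftrightarrow>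
     S \<in> lambda_system UNIV UNIV hausdorff1 \<and>
     (\<exists>(A :: nat \<Rightarrow> real set) (g :: nat \<Rightarrow> real \<Rightarrow> 'a).
        (\<forall>i. \<exists>C. lipschitz_on C (A i) (g i)) \<and> hausdorff1 (S - (\<Union>i. g i ` A i)) = 0)"

text \<open>
  The set \<open>S\<close> need not be Borel, so concentration is expressed by a Borel null set covering its
  complement.
\<close>

definition concentrated_on :: "'a::topological_space measure \<Rightarrow> 'a set \<Rightarrow> bool" where
  "concentrated_on \<mu> S \<longleftrightarrow> (\<exists>N\<in>null_sets \<mu>. - S \<subseteq> N)"

definition rectifiable_1current :: "'a::metric_space functional \<Rightarrow> bool" where
  "rectifiable_1current T \<longleftrightarrow> metric_current 1 T \<and>
     (\<exists>S. countably_rectifiable1 S \<and> concentrated_on (mass_measure 1 T) S) \<and>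
     (\<forall>N\<in>sets borel. hausdorff1 N = 0 \<longrightarrow> emeasure (mass_measure 1 T) N = 0)"

definition integer_rectifiable_1current :: "'a::metric_space functional \<Rightarrow> bool" where
  "integer_rectifiable_1current T \<longleftrightarrow> rectifiable_1current T \<and>
     (\<forall>\<phi>\<in>LIP. \<forall>\<Omega>. open \<Omega> \<longrightarrow>
        (\<exists>\<theta> :: real \<Rightarrow> int. integrable lebesgue (\<lambda>x. real_of_int (\<theta> x)) \<and>
           (\<forall>f\<in>LIPb. \<forall>p\<in>LIP. push_forward \<phi> (current_restrict 1 T \<Omega>) f [p] =
              (\<integral>x. real_of_int (\<theta> x) * f x * deriv p x \<partial>lebesgue))))"

definition integral_1current :: "'a::metric_space functional \<Rightarrow> bool" where
  "integral_1current T \<longleftrightarrow> integer_rectifiable_1current T \<and> normal_1current T"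


section \<open>Curves\<close>

definition lipschitz_curve :: "real \<Rightarrow> real \<Rightarrow> (real \<Rightarrow> 'a::metric_space) \<Rightarrow> bool" where
  "lipschitz_curve a b \<gamma> \<longleftrightarrow> (\<exists>C. lipschitz_on C {a..b} \<gamma>)"

definition arc_length_parametrised ::
    "real \<Rightarrow> real \<Rightarrow> (real \<Rightarrow> 'a::metric_space) \<Rightarrow> bool" where
  "arc_length_parametrised a b \<gamma> \<longleftrightarrow>
     (AE t in lebesgue. t \<in> {a..b} \<longrightarrow>
        ((\<lambda>s. dist (\<gamma> s) (\<gamma> t) / \<bar>s - t\<bar>) \<longlongrightarrow> 1) (at t within {a..b}))"

definition injective_loop :: "real \<Rightarrow> real \<Rightarrow> (real \<Rightarrow> 'a) \<Rightarrow> bool" where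
  "injective_loop a b \<gamma> \<longleftrightarrow> \<gamma> a = \<gamma> b \<and> inj_on \<gamma> {a..<b}"

text \<open>
  Only the values of \<open>\<gamma>\<close> on \<open>{a..b}\<close> matter: the derivative at an interior point is local, and the
  two endpoints form a null set.
\<close>

definition curve_current ::
    "real \<Rightarrow> real \<Rightarrow> (real \<Rightarrow> 'a::metric_space) \<Rightarrow> 'a functional" where
  "curve_current a b \<gamma> = (\<lambda>f ps.
     set_lebesgue_integral lebesgue {a..b} (\<lambda>t. f (\<gamma> t) * deriv (\<lambda>s. (ps ! 0) (\<gamma> s)) t))"

end

theory Submission
  imports Defs
begin

text \<open>
  Extend \<open>T\<close> to \<open>L\<^sup>1\<close> of its mass measure and consider \<open>T(1\<^sub>I, \<pi>)\<close> for arcs \<open>I\<close> of the curve. Pushing \<open>T\<close>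
  forward by a single function and polarising gives the Leibniz rule
  \<open>T(f, \<pi>) + T(\<pi>, f) = \<partial>T(f \<pi>)\<close>. If \<open>f\<close> is a Lipschitz approximation of \<open>1\<^sub>I\<close> for an arc \<open>I\<close> with
  endpoints \<open>\<gamma>(s), \<gamma>(t)\<close>, then \<open>\<partial>T(f \<pi>) = 0\<close> and, by locality, \<open>T(\<pi>, f)\<close> is concentrated near the two
  endpoints. Provided that some Lipschitz function on the space has a non-zero derivative along \<open>\<gamma>\<close> at
  \<open>s\<close> and at \<open>t\<close>, which holds for a dense set of parameters by Rademacher's theorem on the line,
  \<open>f\<close> can be chosen such that \<open>T(\<pi>, f)\<close> tends to \<open>k (\<pi>(\<gamma>(s)) - \<pi>(\<gamma>(t)))\<close>; testing with \<open>\<pi> = 1\<close> shows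
  that the weight \<open>k\<close> does not depend on the endpoint. Hence \<open>T(1\<^sub>I, \<pi>) = k (\<pi>(\<gamma>(t)) - \<pi>(\<gamma>(s)))\<close>
  for all arcs, which means \<open>T = k[\<gamma>]\<close>. Comparing boundaries determines \<open>k\<close> when \<open>\<gamma>\<close> is injective, and
  pushing \<open>T\<close> restricted to an arc forward to the line shows that \<open>k\<close> is an integer.
\<close>

section \<open>Lipschitz functions of one real variable\<close>

text \<open>The obstacle is the size of the Lipschitz constant of the functions that approximate an
  arc. On a window of length \<delta> around an endpoint a test function oscillates by O(\<delta>),
  so the error is controlled only if the approximation has Lipschitz constant O(1/\<delta>) there. A
  distance function need not provide this: the inverse of \<gamma> need not be Lipschitz, and
  \<gamma>(s - \<delta>) may be much closer to \<gamma>(s + \<delta>) than \<delta>. Hence the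
  approximations are, near an endpoint, truncated affine functions of one fixed function whose
  derivative along \<gamma> is positive there. The cut-offs that separate these ramps from the rest
  of the curve may have arbitrarily large constants: along the curve they are 0 or 1 on the windows,
  and off the windows the whole approximation is 0 or 1, so by locality their constants never enter.
  What remains is the mass of a window, which tends to 0 because points are null. Mass measure and
  extension are definite descriptions, so their existence and uniqueness have to be established
  before any of this can start.\<close>

text \<open>A Vitali covering by intervals with slope at most \<open>p\<close>, refined inside its interiors by a Vitali
  covering by intervals with slope at least \<open>q\<close>, shrinks the measure of any open neighbourhood of
  \<open>E\<close> by the factor \<open>p / q\<close>.\<close>

lemma derivate_gap_cover:
  fixes F :: "real \<Rightarrow> real"
  assumes mono: "mono F" and cont: "continuous_on UNIV F"
    and pq: "0 < p" "p < q"
    and low: "\<And>x d. x \<in> E \<Longrightarrow> 0 < d \<Longrightarrow> \<exists>u v. u \<le> x \<and> x \<le> v \<and> u < v \<and> v - u < d \<and> F v - F u \<le> p * (v - u)"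
    and high: "\<And>x d. x \<in> E \<Longrightarrow> 0 < d \<Longrightarrow> \<exists>u v. u \<le> x \<and> x \<le> v \<and> u < v \<and> v - u < d \<and> q * (v - u) \<le> F v - F u"
    and U: "open U" "E \<subseteq> U" "bounded U" and e: "0 < e"
  shows "\<exists>V. open V \<and> E \<subseteq> V \<and> V \<subseteq> U \<and> measure lebesgue V \<le> p / q * measure lebesgue U + e"
proof -
  define \<nu> where "\<nu> = interval_measure F"
  have Fm: "\<And>x y. x \<le> y \<Longrightarrow> F x \<le> F y" using mono by (simp add: monoD)
  have sets_nu[simp, measurable_cong]: "sets \<nu> = sets borel" by (simp add: \<nu>_def)
  have nu_cball: "emeasure \<nu> (cball c r) = ennreal (F (c + r) - F (c - r))" if "r > 0" for c r
    unfolding \<nu>_def cball_eq_atLeastAtMost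
    by (rule emeasure_interval_measure_Icc) (use that Fm cont in \<open>auto intro: continuous_on_subset\<close>)
  have lb_cball: "emeasure lborel (cball c r) = ennreal (2 * r)" if "r > 0" for c r :: real
    unfolding cball_eq_atLeastAtMost using that by simp
  have vitali: "\<exists>C. countable C \<and> C \<subseteq> {(c,r). 0 < r \<and> cball c r \<subseteq> G \<and> P (F (c + r) - F (c - r)) (2 * r)}
      \<and> disjoint_family_on (\<lambda>(c,r). cball c r) C
      \<and> negligible (E \<inter> G - (\<Union>(c,r)\<in>C. cball c r))"
    if G: "open G" and P: "\<And>x d. x \<in> E \<Longrightarrow> 0 < d \<Longrightarrow> \<exists>u v. u \<le> x \<and> x \<le> v \<and> u < v \<and> v - u < d \<and> P (F v - F u) (v - u)"
    for G and P :: "real \<Rightarrow> real \<Rightarrow> bool"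
  proof -
    let ?K = "{(c,r). 0 < r \<and> cball c r \<subseteq> G \<and> P (F (c + r) - F (c - r)) (2 * r)}"
    have *: "\<exists>i. i \<in> ?K \<and> x \<in> cball (fst i) (snd i) \<and> snd i < d" if x: "x \<in> E \<inter> G" and d: "0 < d" for x d
    proof -
      obtain h where h: "h > 0" "cball x h \<subseteq> G" using G x open_contains_cball by blast
      obtain u v where uv: "u \<le> x" "x \<le> v" "u < v" "v - u < min d h" "P (F v - F u) (v - u)"
        using P[of x "min d h"] x d h by auto
      have eq: "(u + v)/2 + (v - u)/2 = v" "(u + v)/2 - (v - u)/2 = u" "2 * ((v - u)/2) = v - u"
        by (simp_all add: field_simps)
      have sub: "{u..v} \<subseteq> cball x h" using uv by (auto simp: cball_eq_atLeastAtMost)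
      \<comment> \<open>The Vitali theorem asks only that \<open>x\<close> lie in the ball, not at
        its centre, so the ball is \<open>{u..v}\<close> with centre at the midpoint.\<close>
      show ?thesis
        by (rule exI[of _ "((u + v)/2, (v - u)/2)"])
          (use uv d h sub in \<open>simp add: eq cball_eq_atLeastAtMost del: times_divide_eq_right\<close>, auto)
    qed
    obtain C where C: "countable C" "C \<subseteq> ?K"
        "pairwise (\<lambda>i j. disjnt (cball (fst i) (snd i)) (cball (fst j) (snd j))) C"
        "negligible (E \<inter> G - (\<Union>i \<in> C. cball (fst i) (snd i)))"
    proof (rule Vitali_covering_theorem_cballs[of ?K snd "E \<inter> G" fst])
      show "0 < snd i" if "i \<in> ?K" for i using that by auto
    qed (rule *)
    show ?thesis
      by (rule exI[of _ C])
        (use C in \<open>auto simp: disjoint_family_on_def pairwise_def disjnt_def case_prod_unfold\<close>)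
  qed
  have UN_le: "emeasure M (\<Union>(c,r)\<in>C. cball c r) \<le> emeasure N (\<Union>(c,r)\<in>C. cball c r)"
    if "countable C" "disjoint_family_on (\<lambda>(c,r). cball c r) C" "sets M = sets borel" "sets N = sets borel"
       "\<And>c r. (c,r) \<in> C \<Longrightarrow> emeasure M (cball c r) \<le> emeasure N (cball c r)"
    for C and M N :: "real measure"
  proof -
    have "emeasure M (\<Union>(c,r)\<in>C. cball c r) = (\<integral>\<^sup>+i. emeasure M (case i of (c,r) \<Rightarrow> cball c r) \<partial>count_space C)"
      by (rule emeasure_UN_countable) (use that in auto)
    also have "\<dots> \<le> (\<integral>\<^sup>+i. emeasure N (case i of (c,r) \<Rightarrow> cball c r) \<partial>count_space C)"
      by (rule nn_integral_mono) (use that in auto)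
    also have "\<dots> = emeasure N (\<Union>(c,r)\<in>C. cball c r)"
      by (rule emeasure_UN_countable[symmetric]) (use that in auto)
    finally show ?thesis .
  qed
  obtain C where C: "countable C" "C \<subseteq> {(c,r). 0 < r \<and> cball c r \<subseteq> U \<and> F (c + r) - F (c - r) \<le> p * (2 * r)}"
      "disjoint_family_on (\<lambda>(c,r). cball c r) C" "negligible (E \<inter> U - (\<Union>(c,r)\<in>C. cball c r))"
    using vitali[of U "\<lambda>a b. a \<le> p * b"] U(1) low by auto
  \<comment> \<open>Passing to open balls loses only spheres, which are null, and provides the open
    set that confines the second covering.\<close>
  define W where "W = (\<Union>(c,r)\<in>C. ball c r)"
  have W: "open W" by (auto simp: W_def)
  have EW: "negligible (E - W)"
  proof (rule negligible_subset)
    show "negligible ((E \<inter> U - (\<Union>(c,r)\<in>C. cball c r)) \<union> (\<Union>(c,r)\<in>C. sphere c r))"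
    proof (rule negligible_Un[OF C(4)])
      show "negligible (\<Union>(c,r)\<in>C. sphere c r)"
        using C(1) by (auto intro!: negligible_countable_Union simp: negligible_sphere)
    qed
    show "E - W \<subseteq> (E \<inter> U - (\<Union>(c,r)\<in>C. cball c r)) \<union> (\<Union>(c,r)\<in>C. sphere c r)"
      using U(2) unfolding W_def by force
  qed
  have mCU: "(\<Union>(c,r)\<in>C. cball c r) \<in> sets borel"
    using C(1) by auto
  have Ub: "U \<in> sets borel" using U(1) by simp
  have "emeasure \<nu> W \<le> emeasure \<nu> (\<Union>(c,r)\<in>C. cball c r)"
    by (rule emeasure_mono) (use mCU in \<open>auto simp: W_def\<close>)
  also have "\<dots> \<le> emeasure (scale_measure (ennreal p) lborel) (\<Union>(c,r)\<in>C. cball c r)"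
  proof (rule UN_le)
    fix c r assume "(c, r) \<in> C"
    then show "emeasure \<nu> (cball c r) \<le> emeasure (scale_measure (ennreal p) lborel) (cball c r)"
      using C(2) pq by (auto simp: nu_cball lb_cball ennreal_mult[symmetric] intro!: ennreal_leI)
  qed (use C in auto)
  also have "\<dots> \<le> emeasure (scale_measure (ennreal p) lborel) U"
    by (rule emeasure_mono) (use C U Ub in auto)
  finally have nuW: "emeasure \<nu> W \<le> ennreal p * emeasure lborel U" by simp
  obtain D where D: "countable D" "D \<subseteq> {(c,r). 0 < r \<and> cball c r \<subseteq> W \<and> q * (2 * r) \<le> F (c + r) - F (c - r)}"
      "disjoint_family_on (\<lambda>(c,r). cball c r) D" "negligible (E \<inter> W - (\<Union>(c,r)\<in>D. cball c r))"
    using vitali[of W "\<lambda>a b. q * b \<le> a"] W high by auto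
  define V where "V = (\<Union>(c,r)\<in>D. cball c r)"
  have Vb: "V \<in> sets borel" unfolding V_def using D(1) by auto
  \<comment> \<open>The two slope conditions now chain up: \<open>q\<close> times the length of
    \<open>V\<close> is at most \<open>\<nu> V\<close>, which is at most \<open>\<nu> W\<close>,
    which is at most \<open>p\<close> times the length of \<open>U\<close>.\<close>
  have "emeasure (scale_measure (ennreal q) lborel) V \<le> emeasure \<nu> V"
    unfolding V_def
  proof (rule UN_le)
    fix c r assume "(c, r) \<in> D"
    then show "emeasure (scale_measure (ennreal q) lborel) (cball c r) \<le> emeasure \<nu> (cball c r)"
      using D(2) pq by (auto simp: nu_cball lb_cball ennreal_mult[symmetric] intro!: ennreal_leI)
  qed (use D in auto)
  also have "\<dots> \<le> emeasure \<nu> W"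
    by (rule emeasure_mono) (use D W in \<open>auto simp: V_def\<close>)
  finally have qV: "ennreal q * emeasure lborel V \<le> ennreal p * emeasure lborel U"
    using nuW by simp
  have VU: "V \<subseteq> U" using C(2) D(2) unfolding V_def W_def by fastforce
  have Um: "U \<in> lmeasurable" using U by (simp add: lmeasurable_open)
  have Vm: "V \<in> lmeasurable"
    by (rule fmeasurableI2[OF Um VU]) (use Vb in auto)
  have eq: "emeasure lborel A = ennreal (measure lebesgue A)" if "A \<in> lmeasurable" "A \<in> sets borel" for A :: "real set"
    using emeasure_eq_measure2[OF that(1)] that(2) by simp
  have "ennreal (q * measure lebesgue V) \<le> ennreal (p * measure lebesgue U)"
    using qV pq by (simp add: eq Um Vm Ub Vb ennreal_mult)
  then have "q * measure lebesgue V \<le> p * measure lebesgue U"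
    using pq by (simp add: ennreal_le_iff)
  then have mV: "measure lebesgue V \<le> p / q * measure lebesgue U"
    using pq by (simp add: field_simps)
  have "negligible (E - V)"
  proof (rule negligible_subset)
    show "negligible ((E - W) \<union> (E \<inter> W - V))" using EW D(4) by (simp add: V_def)
  qed auto
  \<comment> \<open>\<open>V\<close> covers \<open>E\<close> only up to a null set. Adding that set
    back changes neither measurability nor measure, and outer regularity then costs the summand
    \<open>e\<close>.\<close>
  then have Nm: "V \<union> (E - V) \<in> lmeasurable" "measure lebesgue (V \<union> (E - V)) = measure lebesgue V"
    using Vm fmeasurable.Un[OF Vm negligible_imp_measurable]
    by (auto simp: measure_Un_null_set negligible_iff_null_sets fmeasurableD simp del: Un_Diff_cancel)
  obtain G where G: "open G" "V \<union> (E - V) \<subseteq> G" "G - (V \<union> (E - V)) \<in> lmeasurable"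
      "emeasure lebesgue (G - (V \<union> (E - V))) < ennreal e"
    using sets_lebesgue_outer_open[OF fmeasurableD[OF Nm(1)] e] by metis
  then have Ge: "measure lebesgue (G - (V \<union> (E - V))) < e"
    by (simp add: emeasure_eq_measure2 ennreal_less_iff)
  have GV: "G = (V \<union> (E - V)) \<union> (G - (V \<union> (E - V)))" using G(2) by blast
  have Gm: "G \<in> lmeasurable"
    using fmeasurable.Un[OF Nm(1) G(3)] GV by simp
  have "measure lebesgue G \<le> measure lebesgue (V \<union> (E - V)) + measure lebesgue (G - (V \<union> (E - V)))"
    using measure_Un_le[OF fmeasurableD[OF Nm(1)] fmeasurableD[OF G(3)]] GV by simp
  then have mG: "measure lebesgue G \<le> p / q * measure lebesgue U + e"
    using mV Ge Nm(2) by linarith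
  show ?thesis
  proof (intro exI conjI)
    show "open (G \<inter> U)" using G U by auto
    show "E \<subseteq> G \<inter> U" using G U by auto
    show "measure lebesgue (G \<inter> U) \<le> p / q * measure lebesgue U + e"
      using mG measure_mono_fmeasurable[of "G \<inter> U" G lebesgue] Gm Um by auto
  qed auto
qed


text \<open>Let \<open>m\<close> be the outer measure of \<open>E\<close>, an infimum over open
  neighbourhoods so that \<open>E\<close> need not be known to be measurable. The covering lemma
  gives \<open>m \<le> p / q * (m + e) + e\<close> for every \<open>e\<close>, and
  \<open>p / q < 1\<close> forces \<open>m = 0\<close>.\<close>

lemma derivate_gap_negligible:
  fixes F :: "real \<Rightarrow> real"
  assumes "mono F" "continuous_on UNIV F" "0 < p" "p < q"
    and "\<And>x d. x \<in> E \<Longrightarrow> 0 < d \<Longrightarrow> \<exists>u v. u \<le> x \<and> x \<le> v \<and> u < v \<and> v - u < d \<and> F v - F u \<le> p * (v - u)"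
    and "\<And>x d. x \<in> E \<Longrightarrow> 0 < d \<Longrightarrow> \<exists>u v. u \<le> x \<and> x \<le> v \<and> u < v \<and> v - u < d \<and> q * (v - u) \<le> F v - F u"
    and E: "bounded E"
  shows "negligible E"
proof -
  define \<U> where "\<U> = {U. open U \<and> E \<subseteq> U \<and> bounded U}"
  define m where "m = Inf (measure lebesgue ` \<U>)"
  have pq: "0 < p / q" "p / q < 1" using assms(3,4) by auto
  obtain R where "E \<subseteq> ball 0 R" using E by (metis bounded_subset_ballD)
  then have ne: "\<U> \<noteq> {}" unfolding \<U>_def by (intro ex_in_conv[THEN iffD1] exI[of _ "ball 0 R"]) auto
  have bdd: "bdd_below (measure lebesgue ` \<U>)" by (rule bdd_belowI[of _ 0]) auto
  have m_le: "m \<le> measure lebesgue U" if "U \<in> \<U>" for U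
    unfolding m_def by (rule cInf_lower) (use that bdd in auto)
  have *: "m \<le> p / q * (m + e) + e" if e: "0 < e" for e
  proof -
    have "\<exists>x\<in>measure lebesgue ` \<U>. x < m + e"
      using cInf_lessD[of "measure lebesgue ` \<U>" "m + e"] ne e unfolding m_def by auto
    then obtain U where U: "U \<in> \<U>" "measure lebesgue U < m + e" by auto
    obtain V where V: "open V" "E \<subseteq> V" "V \<subseteq> U" "measure lebesgue V \<le> p / q * measure lebesgue U + e"
      using derivate_gap_cover[OF assms(1-4), of E U e] assms(5,6) U e unfolding \<U>_def by auto
    have "V \<in> \<U>" using V U unfolding \<U>_def by (auto intro: bounded_subset)
    then have "m \<le> p / q * measure lebesgue U + e" using m_le V(4) by fastforce
    also have "\<dots> \<le> p / q * (m + e) + e" using U(2) pq by (intro add_mono mult_left_mono) auto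
    finally show ?thesis .
  qed
  have "m \<le> 0"
  proof (rule ccontr)
    assume "\<not> m \<le> 0"
    define r where "r = p / q"
    \<comment> \<open>With this \<open>e\<close> the inequality gives
      \<open>(1 - r) * m \<le> 2 * e\<close>, which is half of \<open>(1 - r) * m\<close>.\<close>
    define e where "e = (1 - r) * m / 4"
    have r: "0 < r" "r < 1" using pq by (auto simp: r_def)
    have e: "0 < e" using \<open>\<not> m \<le> 0\<close> r by (simp add: e_def)
    have "(1 - r) * m \<le> r * e + e" using *[OF e] by (simp add: r_def[symmetric] algebra_simps)
    also have "\<dots> \<le> 2 * e" using r e by simp
    finally show False using e by (simp add: e_def algebra_simps)
  qed
  show ?thesis
  proof (rule negligible_outer[THEN iffD2], intro allI impI)
    fix e :: real assume "0 < e"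
    then obtain U where U: "U \<in> \<U>" "measure lebesgue U < e"
      using cInf_lessD[of "measure lebesgue ` \<U>" e] ne \<open>m \<le> 0\<close> unfolding m_def by fastforce
    then show "\<exists>T. E \<subseteq> T \<and> T \<in> lmeasurable \<and> measure lebesgue T < e"
      unfolding \<U>_def by (intro exI[of _ U]) (auto intro: lmeasurable_open)
  qed
qed

text \<open>Adding \<open>(L + 1) * x\<close> puts all difference quotients into the interval from 1
  to \<open>2 * L + 1\<close>. The function becomes increasing, and where its lower and upper
  derivates differ two positive rationals fit between them; each such pair contributes a null set by
  the gap lemma.\<close>

lemma lipschitz_real_differentiable_negligible:
  fixes u :: "real \<Rightarrow> real"
  assumes L: "L-lipschitz_on UNIV u"
  shows "negligible {x. \<not> u differentiable at x}"
proof -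
  define F where "F = (\<lambda>x. u x + (L + 1) * x)"
  define sl where "sl = (\<lambda>x y. (F y - F x) / (y - x))"
  have u_le: "\<bar>u x - u y\<bar> \<le> L * \<bar>x - y\<bar>" for x y
    using lipschitz_onD[OF L, of x y] by (simp add: dist_real_def)
  have F_low: "y - x \<le> F y - F x" and F_up: "F y - F x \<le> (2 * L + 1) * (y - x)" if "x \<le> y" for x y
    using u_le[of y x] that by (auto simp: F_def algebra_simps abs_le_iff)
  have sl_sym: "sl x y = sl y x" for x y unfolding sl_def by (simp add: divide_simps) argo
  have sl_bd: "1 \<le> sl x y \<and> sl x y \<le> 2 * L + 1" if "x \<noteq> y" for x y
  proof (cases "x < y")
    case True then show ?thesis using F_low[of x y] F_up[of x y] by (auto simp: sl_def field_simps)
  next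
    case False then show ?thesis using F_low[of y x] F_up[of y x] that by (auto simp: sl_def field_simps)
  qed
  have mono: "mono F"
  proof (rule monoI)
    fix x y :: real assume "x \<le> y" then show "F x \<le> F y" using F_low[of x y] by simp
  qed
  have cont: "continuous_on UNIV F"
    unfolding F_def using lipschitz_on_continuous_on[OF L] by (intro continuous_intros)
  define lo where "lo = (\<lambda>p x. \<forall>d>0. \<exists>y. y \<noteq> x \<and> \<bar>y - x\<bar> < d \<and> sl x y \<le> p)"
  define hi where "hi = (\<lambda>q x. \<forall>d>0. \<exists>y. y \<noteq> x \<and> \<bar>y - x\<bar> < d \<and> q \<le> sl x y)"
  have neg: "negligible {x. lo p x \<and> hi q x \<and> \<bar>x\<bar> < R}" if "0 < p" "p < q" for p q R
  proof (rule derivate_gap_negligible[OF mono cont that])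
    have interval: "\<exists>u v. u \<le> x \<and> x \<le> v \<and> u < v \<and> v - u < d \<and> F v - F u = sl x y * (v - u)"
      if "y \<noteq> x" "\<bar>y - x\<bar> < d" for x y d
    proof (cases "x < y")
      case True
      then show ?thesis using that by (intro exI[of _ x] exI[of _ y]) (auto simp: sl_def)
    next
      case False
      then show ?thesis using that by (intro exI[of _ y] exI[of _ x]) (auto simp: sl_sym[of x y], auto simp: sl_def)
    qed
    fix x d :: real assume x: "x \<in> {x. lo p x \<and> hi q x \<and> \<bar>x\<bar> < R}" and d: "0 < d"
    obtain y where y: "y \<noteq> x" "\<bar>y - x\<bar> < d" "sl x y \<le> p" using x d unfolding lo_def by auto
    show "\<exists>u v. u \<le> x \<and> x \<le> v \<and> u < v \<and> v - u < d \<and> F v - F u \<le> p * (v - u)"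
      using interval[OF y(1,2)] y(3) by (metis diff_ge_0_iff_ge less_imp_le mult_right_mono)
    obtain z where z: "z \<noteq> x" "\<bar>z - x\<bar> < d" "q \<le> sl x z" using x d unfolding hi_def by auto
    show "\<exists>u v. u \<le> x \<and> x \<le> v \<and> u < v \<and> v - u < d \<and> q * (v - u) \<le> F v - F u"
      using interval[OF z(1,2)] z(3) by (metis diff_ge_0_iff_ge less_imp_le mult_right_mono)
  next
    show "bounded {x. lo p x \<and> hi q x \<and> \<bar>x\<bar> < R}"
      by (rule bounded_subset[of "ball 0 R"]) auto
  qed
  \<comment> \<open>The index \<open>n\<close> cuts the exceptional set into bounded pieces, as the
    gap lemma requires, and rational slopes keep the union countable.\<close>
  define B where "B = (\<Union>(p,q,n)\<in>{(p,q,n). 0 < p \<and> p < q}. {x. lo (real_of_rat p) x \<and> hi (real_of_rat q) x \<and> \<bar>x\<bar> < real (n::nat)})"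
  have negB: "negligible B"
    unfolding B_def
  proof (rule negligible_countable_Union)
    show "countable ((\<lambda>(p,q,n). {x. lo (real_of_rat p) x \<and> hi (real_of_rat q) x \<and> \<bar>x\<bar> < real (n::nat)}) ` {(p,q,n). 0 < p \<and> p < q})"
      by (rule countable_image) (rule countableI_type)
  qed (auto intro!: neg simp: of_rat_less)
  show ?thesis
  proof (rule negligible_subset[OF negB], rule subsetI, rule ccontr)
    fix x assume nd: "x \<in> {x. \<not> u differentiable at x}" and xB: "x \<notin> B"
    \<comment> \<open>In the extended reals \<open>Liminf\<close> and \<open>Limsup\<close> always
      exist; the bounds on the quotients bring the common value back to a real number.\<close>
    define s where "s = (\<lambda>y. ereal (sl x y))"
    have ev1: "eventually (\<lambda>y. 1 \<le> s y \<and> s y \<le> ereal (2 * L + 1)) (at x)"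
      unfolding s_def eventually_at by (rule exI[of _ 1]) (use sl_bd[of x] in \<open>auto simp: one_ereal_def\<close>)
    have le: "Liminf (at x) s \<le> Limsup (at x) s" by (rule Liminf_le_Limsup) auto
    have "\<not> Liminf (at x) s < Limsup (at x) s"
    proof
      assume "Liminf (at x) s < Limsup (at x) s"
      then obtain q where q: "Liminf (at x) s < ereal (real_of_rat q)" "ereal (real_of_rat q) < Limsup (at x) s"
        using ereal_dense3 by blast
      then obtain p where p: "Liminf (at x) s < ereal (real_of_rat p)" "ereal (real_of_rat p) < ereal (real_of_rat q)"
        using ereal_dense3 by blast
      have lo: "lo (real_of_rat p) x"
      proof (rule ccontr)
        assume "\<not> lo (real_of_rat p) x"
        then have "eventually (\<lambda>y. ereal (real_of_rat p) \<le> s y) (at x)"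
          unfolding lo_def eventually_at s_def by (auto simp: dist_real_def not_le) (meson less_imp_le)
        then show False using Liminf_bounded[of "ereal (real_of_rat p)" s "at x"] p(1) by (simp add: not_le)
      qed
      have hi: "hi (real_of_rat q) x"
      proof (rule ccontr)
        assume "\<not> hi (real_of_rat q) x"
        then have "eventually (\<lambda>y. s y \<le> ereal (real_of_rat q)) (at x)"
          unfolding hi_def eventually_at s_def by (auto simp: dist_real_def not_le) (meson less_imp_le)
        then show False using Limsup_bounded[of s "ereal (real_of_rat q)" "at x"] q(2) by (simp add: not_le)
      qed
      have "1 \<le> real_of_rat p"
        using lo sl_bd[of x] unfolding lo_def by (metis order_trans zero_less_one)
      then have "0 < p" by (metis less_le_trans zero_less_of_rat_iff zero_less_one)
      moreover have "p < q" using p(2) by (simp add: of_rat_less)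
      moreover obtain n :: nat where "\<bar>x\<bar> < real n" using reals_Archimedean2 by blast
      ultimately have "x \<in> B" using lo hi unfolding B_def by blast
      then show False using xB by simp
    qed
    then have eq: "Liminf (at x) s = Limsup (at x) s" using le by simp
    define l where "l = Limsup (at x) s"
    have lim: "(s \<longlongrightarrow> l) (at x)"
      using eq by (simp add: tendsto_iff_Liminf_eq_Limsup l_def)
    have "1 \<le> l" "l \<le> ereal (2 * L + 1)"
      using tendsto_lowerbound[OF lim] tendsto_upperbound[OF lim] ev1 by (auto simp: eventually_conj_iff)
    then obtain r where r: "l = ereal r" by (cases l) (auto simp: one_ereal_def)
    have "(sl x \<longlongrightarrow> r) (at x)" using lim unfolding r s_def by simp
    then have "(F has_field_derivative r) (at x)"
      unfolding has_field_derivative_iff sl_def by simp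
    then have "((\<lambda>x. F x - (L + 1) * x) has_field_derivative r - (L + 1)) (at x)"
      by (auto intro!: derivative_eq_intros)
    then have "(u has_field_derivative r - (L + 1)) (at x)" by (simp add: F_def)
    then show False using nd by (auto simp: real_differentiable_def)
  qed
qed


lemma deriv_real_lipschitz_bound:
  fixes u :: "real \<Rightarrow> real"
  assumes L: "L-lipschitz_on UNIV u" and d: "u differentiable at x"
  shows "\<bar>deriv u x\<bar> \<le> L"
proof -
  have "(u has_field_derivative deriv u x) (at x)"
    using d by (metis DERIV_imp_deriv real_differentiable_def)
  then have "((\<lambda>y. (u y - u x) / (y - x)) \<longlongrightarrow> deriv u x) (at x)"
    by (simp add: has_field_derivative_iff)
  then have lim: "((\<lambda>y. \<bar>(u y - u x) / (y - x)\<bar>) \<longlongrightarrow> \<bar>deriv u x\<bar>) (at x)"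
    by (rule tendsto_rabs)
  have "\<bar>(u y - u x) / (y - x)\<bar> \<le> L" if "y \<noteq> x" for y
    using lipschitz_onD[OF L, of y x] that by (simp add: dist_real_def abs_divide field_simps)
  then have "eventually (\<lambda>y. \<bar>(u y - u x) / (y - x)\<bar> \<le> L) (at x)"
    unfolding eventually_at by (intro exI[of _ 1]) auto
  then show ?thesis using lim by (intro tendsto_upperbound[OF lim]) auto
qed

text \<open>Forward difference quotients are bounded by \<open>L\<close> and converge to the
  derivative off a null set, so their integrals converge as well. The integral of a quotient is a
  difference of two short averages of \<open>u\<close>, at \<open>d\<close> and at \<open>c\<close>,
  and these tend to the values of \<open>u\<close>.\<close>

lemma lipschitz_real_deriv_integral:
  fixes u :: "real \<Rightarrow> real"
  assumes L: "L-lipschitz_on UNIV u" and cd: "c \<le> d"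
  shows "deriv u absolutely_integrable_on {c..d}" "integral {c..d} (deriv u) = u d - u c"
proof -
  define N where "N = {x. \<not> u differentiable at x}"
  have N: "negligible N" unfolding N_def by (rule lipschitz_real_differentiable_negligible[OF L])
  define h where "h = (\<lambda>n::nat. inverse (real (Suc n)))"
  have h: "0 < h n" for n by (simp add: h_def)
  have h0: "h \<longlonglongrightarrow> 0" unfolding h_def by (rule LIMSEQ_inverse_real_of_nat)
  have hat: "filterlim h (at 0) sequentially"
    unfolding filterlim_at using h h0 by (auto simp: less_imp_neq[symmetric])
  define g where "g = (\<lambda>n x. (u (x + h n) - u x) / h n)"
  have cont: "continuous_on A u" for A
    using lipschitz_on_continuous_on[OF L] continuous_on_subset by blast
  have lim: "(\<lambda>n. g n x) \<longlonglongrightarrow> deriv u x" if "x \<notin> N" for x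
  proof -
    have "(u has_field_derivative deriv u x) (at x)"
      using that unfolding N_def by (metis (mono_tags) DERIV_imp_deriv mem_Collect_eq real_differentiable_def)
    then have "((\<lambda>t. (u (x + t) - u x) / t) \<longlongrightarrow> deriv u x) (at 0)" by (simp add: DERIV_def)
    from filterlim_compose[OF this hat] show ?thesis by (simp add: g_def)
  qed
  have gbd: "norm (g n x) \<le> L" for n x
    using lipschitz_onD[OF L, of "x + h n" x] h[of n]
    by (simp add: g_def dist_real_def abs_divide field_simps)
  have gint: "g n integrable_on {c..d}" for n
    unfolding g_def using h[of n] less_imp_neq[OF h[of n]]
    by (intro integrable_continuous_interval continuous_intros)
      (auto intro!: continuous_on_compose2[OF cont[of UNIV]] continuous_intros)
  \<comment> \<open>The dominated convergence rule used here asks for convergence at every point,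
    hence the value 0 on the exceptional null set.\<close>
  define g' where "g' = (\<lambda>n x. if x \<in> N then 0 else g n x)"
  define w where "w = (\<lambda>x. if x \<in> N then 0 else deriv u x)"
  have g'int: "g' n integrable_on {c..d}" for n
    by (rule integrable_spike[OF gint[of n] N]) (auto simp: g'_def)
  have dc: "w integrable_on {c..d}" "(\<lambda>n. integral {c..d} (g' n)) \<longlonglongrightarrow> integral {c..d} w"
    by (rule dominated_convergence[where f=g' and h="\<lambda>_. L"];
        use g'int gbd lim lipschitz_on_nonneg[OF L] in \<open>auto simp: g'_def w_def\<close>)+
  have wbd: "norm (w x) \<le> L" for x
    using deriv_real_lipschitz_bound[OF L] lipschitz_on_nonneg[OF L] by (auto simp: w_def N_def)
  have wabs: "w absolutely_integrable_on {c..d}"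
    by (rule absolutely_integrable_integrable_bound[of _ w "\<lambda>_. L"]) (use wbd dc in auto)
  show "deriv u absolutely_integrable_on {c..d}"
    by (rule absolutely_integrable_spike[OF wabs N]) (auto simp: w_def)
  \<comment> \<open>Starting at \<open>c - 1\<close> makes the antiderivative differentiable from
    both sides at \<open>c\<close> itself.\<close>
  define U where "U = (\<lambda>t. integral {c - 1..t} u)"
  have U: "(U has_field_derivative u t) (at t)" if "c \<le> t" for t
  proof -
    have "(U has_vector_derivative u t) (at t within {c - 1..t + 1})"
      unfolding U_def by (rule integral_has_vector_derivative) (use that cont in auto)
    then have "(U has_field_derivative u t) (at t within {c - 1..t + 1})"
      by (simp add: has_real_derivative_iff_has_vector_derivative)
    moreover have "at t within {c - 1..t + 1} = at t"
      by (rule at_within_interior) (use that in auto)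
    ultimately show ?thesis by simp
  qed
  have gval: "integral {c..d} (g n) = (U (d + h n) - U d) / h n - (U (c + h n) - U c) / h n" for n
  proof -
    have "((\<lambda>x. (U (x + h n) - U x) / h n) has_field_derivative g n x) (at x within {c..d})" if "x \<in> {c..d}" for x
    proof -
      have "((\<lambda>x. U (x + h n)) has_field_derivative u (x + h n)) (at x)"
        using U[of "x + h n"] that h[of n] by (simp add: DERIV_shift[symmetric] add.commute)
      then have "((\<lambda>x. (U (x + h n) - U x) / h n) has_field_derivative g n x) (at x)"
        unfolding g_def using U[of x] that h[of n] by (intro DERIV_cdivide DERIV_diff) auto
      then show ?thesis by (rule has_field_derivative_at_within)
    qed
    then have "(g n has_integral (U (d + h n) - U d) / h n - (U (c + h n) - U c) / h n) {c..d}"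
      by (intro fundamental_theorem_of_calculus[OF cd])
         (simp add: has_real_derivative_iff_has_vector_derivative[symmetric])
    then show ?thesis by (rule integral_unique)
  qed
  have Ulim: "(\<lambda>n. (U (t + h n) - U t) / h n) \<longlonglongrightarrow> u t" if "c \<le> t" for t
  proof -
    have "((\<lambda>s. (U (t + s) - U t) / s) \<longlongrightarrow> u t) (at 0)" using U[OF that] by (simp add: DERIV_def)
    from filterlim_compose[OF this hat] show ?thesis .
  qed
  have "(\<lambda>n. integral {c..d} (g n)) \<longlonglongrightarrow> u d - u c"
    unfolding gval by (intro tendsto_diff Ulim) (use cd in auto)
  moreover have "integral {c..d} (g' n) = integral {c..d} (g n)" for n
    by (rule integral_spike[OF N]) (auto simp: g'_def)
  moreover have "integral {c..d} w = integral {c..d} (deriv u)"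
    by (rule integral_spike[OF N]) (auto simp: w_def)
  ultimately show "integral {c..d} (deriv u) = u d - u c"
    using dc(2) LIMSEQ_unique by auto
qed

text \<open>Clamping the argument extends \<open>w\<close> to a Lipschitz function on the line with
  the same derivative at interior points.\<close>

lemma lipschitz_on_interval_deriv:
  fixes w :: "real \<Rightarrow> real"
  assumes L: "L-lipschitz_on {\<alpha>..\<beta>} w"
  obtains N where "negligible N" "\<And>t. t \<in> {\<alpha><..<\<beta>} - N \<Longrightarrow> w differentiable at t"
    "\<And>t. t \<in> {\<alpha>..\<beta>} - N \<Longrightarrow> \<bar>deriv w t\<bar> \<le> L"
    "\<And>c d. \<alpha> \<le> c \<Longrightarrow> c \<le> d \<Longrightarrow> d \<le> \<beta> \<Longrightarrow> deriv w absolutely_integrable_on {c..d}"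
    "\<And>c d. \<alpha> \<le> c \<Longrightarrow> c \<le> d \<Longrightarrow> d \<le> \<beta> \<Longrightarrow> integral {c..d} (deriv w) = w d - w c"
proof (cases "\<alpha> \<le> \<beta>")
  case False
  show ?thesis by (rule that[of "{}"]) (use False in auto)
next
  case True
  define u where "u = (\<lambda>t. w (max \<alpha> (min \<beta> t)))"
  have uL: "L-lipschitz_on UNIV u"
  proof (rule lipschitz_onI)
    fix x y :: real
    have "dist (u x) (u y) \<le> L * dist (max \<alpha> (min \<beta> x)) (max \<alpha> (min \<beta> y))"
      unfolding u_def by (rule lipschitz_onD[OF L]) (use True in auto)
    also have "\<dots> \<le> L * dist x y"
      by (rule mult_left_mono) (use lipschitz_on_nonneg[OF L] in \<open>auto simp: dist_real_def max_def min_def\<close>)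
    finally show "dist (u x) (u y) \<le> L * dist x y" .
  qed (rule lipschitz_on_nonneg[OF L])
  \<comment> \<open>The endpoints join the null set because \<open>deriv w\<close> there depends on
    the arbitrary values of \<open>w\<close> outside the interval.\<close>
  define N where "N = {x. \<not> u differentiable at x} \<union> {\<alpha>, \<beta>}"
  have N: "negligible N"
    unfolding N_def using lipschitz_real_differentiable_negligible[OF uL] by (simp add: negligible_Un)
  have ev: "eventually (\<lambda>s. w s = u s) (nhds t)" if "t \<in> {\<alpha><..<\<beta>}" for t
  proof -
    have "eventually (\<lambda>s. s \<in> {\<alpha><..<\<beta>}) (nhds t)"
      by (rule eventually_nhds_in_open) (use that in auto)
    then show ?thesis by (rule eventually_mono) (auto simp: u_def)
  qed
  have deq: "deriv w t = deriv u t" if "t \<in> {\<alpha><..<\<beta>}" for t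
    by (rule deriv_cong_ev[OF ev[OF that] refl])
  have dif: "w differentiable at t" if t: "t \<in> {\<alpha><..<\<beta>} - N" for t
  proof -
    have "u differentiable at t" using t by (auto simp: N_def)
    then obtain D where "(u has_field_derivative D) (at t)"
      unfolding real_differentiable_def by blast
    then have "(w has_field_derivative D) (at t)"
      using DERIV_cong_ev[OF refl ev refl, of t] t by auto
    then show ?thesis by (auto simp: real_differentiable_def)
  qed
  show ?thesis
  proof (rule that[OF N dif])
    show "\<bar>deriv w t\<bar> \<le> L" if "t \<in> {\<alpha>..\<beta>} - N" for t
    proof -
      have "t \<in> {\<alpha><..<\<beta>}" "u differentiable at t" using that by (auto simp: N_def)
      then show ?thesis using deq deriv_real_lipschitz_bound[OF uL] by simp
    qed
    fix c d assume cd: "\<alpha> \<le> c" "c \<le> d" "d \<le> \<beta>"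
    have *: "deriv w t = deriv u t" if "t \<in> {c..d} - N" for t
      by (rule deq) (use that cd in \<open>auto simp: N_def\<close>)
    show "deriv w absolutely_integrable_on {c..d}"
      by (rule absolutely_integrable_spike[OF lipschitz_real_deriv_integral(1)[OF uL cd(2)] N]) (use * in auto)
    have "integral {c..d} (deriv w) = integral {c..d} (deriv u)"
      by (rule integral_spike[OF N]) (use * in auto)
    also have "\<dots> = w d - w c"
      using lipschitz_real_deriv_integral(2)[OF uL cd(2)] cd by (simp add: u_def)
    finally show "integral {c..d} (deriv w) = w d - w c" .
  qed auto
qed

section \<open>Lipschitz functions and their density in \<open>L\<^sup>1\<close>\<close>

lemma lipschitz_on_real_iff:
  fixes f :: "'a::metric_space \<Rightarrow> real"
  shows "C-lipschitz_on UNIV f \<longleftrightarrow> 0 \<le> C \<and> (\<forall>x y. \<bar>f x - f y\<bar> \<le> C * dist x y)"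
  by (auto simp: lipschitz_on_def dist_real_def)

lemma LIP_iff: "f \<in> LIP \<longleftrightarrow> (\<exists>C\<ge>0. \<forall>x y. \<bar>f x - f y\<bar> \<le> C * dist x y)"
  by (auto simp: LIP_def lipschitz_on_real_iff)

text \<open>Every quotient of \<open>\<bar>f x - f y\<bar>\<close> by \<open>dist x y\<close> bounds
  the admissible constants from below, so their infimum is again admissible.\<close>

lemma Lip_lipschitz:
  assumes "f \<in> LIP" shows "(Lip f)-lipschitz_on UNIV f"
proof -
  let ?S = "{C. C-lipschitz_on UNIV f}"
  have ne: "?S \<noteq> {}" using assms by (auto simp: LIP_def)
  have 0: "0 \<le> Lip f" unfolding Lip_def by (rule cInf_greatest[OF ne]) (auto simp: lipschitz_on_nonneg)
  have "\<bar>f x - f y\<bar> \<le> Lip f * dist x y" for x y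
  proof (cases "x = y")
    case False
    then have "0 < dist x y" by simp
    have "\<bar>f x - f y\<bar> / dist x y \<le> Lip f"
      unfolding Lip_def by (rule cInf_greatest[OF ne])
        (use \<open>0 < dist x y\<close> in \<open>auto simp: lipschitz_on_real_iff pos_divide_le_eq\<close>)
    then show ?thesis using \<open>0 < dist x y\<close> by (simp add: pos_divide_le_eq)
  qed auto
  then show ?thesis using 0 by (auto simp: lipschitz_on_real_iff)
qed

lemma Lip_nonneg: "f \<in> LIP \<Longrightarrow> 0 \<le> Lip f"
  using Lip_lipschitz lipschitz_on_nonneg by blast

lemma Lip_bound: "f \<in> LIP \<Longrightarrow> \<bar>f x - f y\<bar> \<le> Lip f * dist x y"
  using Lip_lipschitz[of f] by (auto simp: lipschitz_on_real_iff)

lemma Lip_le: "C-lipschitz_on UNIV f \<Longrightarrow> Lip f \<le> C"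
  unfolding Lip_def by (rule cInf_lower) (auto intro!: bdd_belowI[of _ 0] simp: lipschitz_on_nonneg)

lemma Lip_leI: "0 \<le> C \<Longrightarrow> (\<And>x y. \<bar>f x - f y\<bar> \<le> C * dist x y) \<Longrightarrow> Lip f \<le> C"
  by (rule Lip_le) (auto simp: lipschitz_on_real_iff)

lemma LIP_I: "0 \<le> C \<Longrightarrow> (\<And>x y. \<bar>f x - f y\<bar> \<le> C * dist x y) \<Longrightarrow> f \<in> LIP"
  by (auto simp: LIP_iff)

lemma LIP_continuous: "f \<in> LIP \<Longrightarrow> continuous_on A f"
  using Lip_lipschitz lipschitz_on_continuous_on continuous_on_subset by blast

lemma LIP_measurable: "f \<in> LIP \<Longrightarrow> f \<in> borel_measurable borel"
  by (intro borel_measurable_continuous_onI LIP_continuous)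

lemma LIP_const: "(\<lambda>_. c) \<in> LIP"
  by (rule LIP_I[of 0]) auto

lemma LIP_id: "(\<lambda>x::real. x) \<in> LIP"
  by (rule LIP_I[of 1]) (auto simp: dist_real_def)

lemma Lip_lincomb:
  assumes "f \<in> LIP" "g \<in> LIP"
  shows "(\<lambda>x. a * f x + b * g x) \<in> LIP" "Lip (\<lambda>x. a * f x + b * g x) \<le> \<bar>a\<bar> * Lip f + \<bar>b\<bar> * Lip g"
proof -
  have *: "\<bar>(a * f x + b * g x) - (a * f y + b * g y)\<bar> \<le> (\<bar>a\<bar> * Lip f + \<bar>b\<bar> * Lip g) * dist x y" for x y
  proof -
    have "\<bar>(a * f x + b * g x) - (a * f y + b * g y)\<bar> = \<bar>a * (f x - f y) + b * (g x - g y)\<bar>"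
      by (simp add: algebra_simps)
    also have "\<dots> \<le> \<bar>a\<bar> * \<bar>f x - f y\<bar> + \<bar>b\<bar> * \<bar>g x - g y\<bar>"
      by (metis abs_mult abs_triangle_ineq)
    also have "\<dots> \<le> \<bar>a\<bar> * (Lip f * dist x y) + \<bar>b\<bar> * (Lip g * dist x y)"
      by (intro add_mono mult_left_mono Lip_bound assms) auto
    finally show ?thesis by (simp add: algebra_simps)
  qed
  have 0: "0 \<le> \<bar>a\<bar> * Lip f + \<bar>b\<bar> * Lip g" using assms by (simp add: Lip_nonneg)
  show "(\<lambda>x. a * f x + b * g x) \<in> LIP" by (rule LIP_I[OF 0 *])
  show "Lip (\<lambda>x. a * f x + b * g x) \<le> \<bar>a\<bar> * Lip f + \<bar>b\<bar> * Lip g" by (rule Lip_leI[OF 0 *])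
qed

lemma LIP_cmult: "f \<in> LIP \<Longrightarrow> (\<lambda>x. c * f x) \<in> LIP"
  using Lip_lincomb(1)[of f f c 0] by simp

lemma LIP_diff: "f \<in> LIP \<Longrightarrow> g \<in> LIP \<Longrightarrow> (\<lambda>x. f x - g x) \<in> LIP"
  using Lip_lincomb(1)[of f g 1 "-1"] by simp

lemma LIP_min: assumes "f \<in> LIP" "g \<in> LIP" shows "(\<lambda>x. min (f x) (g x)) \<in> LIP"
proof (rule LIP_I[of "Lip f + Lip g"])
  fix x y
  have "\<bar>min (f x) (g x) - min (f y) (g y)\<bar> \<le> \<bar>f x - f y\<bar> + \<bar>g x - g y\<bar>" by (auto simp: min_def)
  then show "\<bar>min (f x) (g x) - min (f y) (g y)\<bar> \<le> (Lip f + Lip g) * dist x y"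
    using Lip_bound[OF assms(1), of x y] Lip_bound[OF assms(2), of x y] by (simp add: algebra_simps)
qed (simp add: assms Lip_nonneg)

lemma LIP_max: assumes "f \<in> LIP" "g \<in> LIP" shows "(\<lambda>x. max (f x) (g x)) \<in> LIP"
proof (rule LIP_I[of "Lip f + Lip g"])
  fix x y
  have "\<bar>max (f x) (g x) - max (f y) (g y)\<bar> \<le> \<bar>f x - f y\<bar> + \<bar>g x - g y\<bar>" by (auto simp: max_def)
  then show "\<bar>max (f x) (g x) - max (f y) (g y)\<bar> \<le> (Lip f + Lip g) * dist x y"
    using Lip_bound[OF assms(1), of x y] Lip_bound[OF assms(2), of x y] by (simp add: algebra_simps)
qed (simp add: assms Lip_nonneg)

lemma LIP_compose: "p \<in> LIP \<Longrightarrow> f \<in> LIP \<Longrightarrow> (p \<circ> f) \<in> LIP"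
proof (rule LIP_I[of "Lip p * Lip f"])
  fix x y assume p: "p \<in> LIP" and f: "f \<in> LIP"
  have "\<bar>p (f x) - p (f y)\<bar> \<le> Lip p * \<bar>f x - f y\<bar>" using Lip_bound[OF p] by (simp add: dist_real_def)
  also have "\<dots> \<le> Lip p * (Lip f * dist x y)" by (intro mult_left_mono Lip_bound f Lip_nonneg p)
  finally show "\<bar>(p \<circ> f) x - (p \<circ> f) y\<bar> \<le> Lip p * Lip f * dist x y" by (simp add: mult.assoc)
qed (simp add: Lip_nonneg)

lemma LIP_infdist: "(\<lambda>x. infdist x A) \<in> LIP"
  by (rule LIP_I[of 1]) (auto simp: infdist_triangle_abs)

lemma LIP_dist: "(\<lambda>x. dist c x) \<in> LIP"
  using LIP_infdist[of "{c}"] by (simp add: dist_commute)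

lemma LIPbI: "f \<in> LIP \<Longrightarrow> (\<And>x. \<bar>f x\<bar> \<le> B) \<Longrightarrow> f \<in> LIPb"
  by (auto simp: LIPb_def bounded_iff)

lemma LIPbD: "f \<in> LIPb \<Longrightarrow> f \<in> LIP"
  by (simp add: LIPb_def)

lemma LIPbE: assumes "f \<in> LIPb" obtains B where "0 \<le> B" "\<And>x. \<bar>f x\<bar> \<le> B"
  using assms by (auto simp: LIPb_def bounded_iff) (meson abs_ge_zero order_trans)

lemma LIPb_const: "(\<lambda>_. c) \<in> LIPb"
  by (rule LIPbI[OF LIP_const, of _ "\<bar>c\<bar>"]) auto

lemma LIPb_lincomb: assumes "f \<in> LIPb" "g \<in> LIPb" shows "(\<lambda>x. a * f x + b * g x) \<in> LIPb"
proof -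
  obtain B C where "\<And>x. \<bar>f x\<bar> \<le> B" "\<And>x. \<bar>g x\<bar> \<le> C" using assms by (metis LIPbE)
  then have bd: "\<bar>a * f x + b * g x\<bar> \<le> \<bar>a\<bar> * B + \<bar>b\<bar> * C" for x
    by (intro order_trans[OF abs_triangle_ineq] add_mono) (auto simp: abs_mult mult_left_mono)
  show ?thesis by (rule LIPbI[OF Lip_lincomb(1)[OF LIPbD LIPbD] bd]) (use assms in auto)
qed

lemma LIPb_mult: assumes "f \<in> LIPb" "g \<in> LIPb" shows "(\<lambda>x. f x * g x) \<in> LIPb"
proof -
  obtain B C where B: "0 \<le> B" "\<And>x. \<bar>f x\<bar> \<le> B" and C: "0 \<le> C" "\<And>x. \<bar>g x\<bar> \<le> C" using assms by (metis LIPbE)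
  have "(\<lambda>x. f x * g x) \<in> LIP"
  proof (rule LIP_I[of "B * Lip g + C * Lip f"])
    show "0 \<le> B * Lip g + C * Lip f" using assms B C by (simp add: Lip_nonneg LIPbD)
    fix x y
    have "f x * g x - f y * g y = f x * (g x - g y) + g y * (f x - f y)" by (simp add: algebra_simps)
    then have "\<bar>f x * g x - f y * g y\<bar> \<le> \<bar>f x\<bar> * \<bar>g x - g y\<bar> + \<bar>g y\<bar> * \<bar>f x - f y\<bar>"
      by (metis abs_mult abs_triangle_ineq)
    also have "\<dots> \<le> B * (Lip g * dist x y) + C * (Lip f * dist x y)"
      by (intro add_mono mult_mono Lip_bound LIPbD assms B C) auto
    finally show "\<bar>f x * g x - f y * g y\<bar> \<le> (B * Lip g + C * Lip f) * dist x y" by (simp add: algebra_simps)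
  qed
  moreover have "\<bar>f x * g x\<bar> \<le> B * C" for x using B C by (auto simp: abs_mult intro: mult_mono)
  ultimately show ?thesis by (rule LIPbI)
qed

lemma LIPb_integrable:
  assumes "finite_borel_measure \<mu>" "f \<in> LIPb" shows "integrable \<mu> f"
proof -
  interpret finite_measure \<mu> using assms by (simp add: finite_borel_measure_def)
  obtain B where "\<And>x. \<bar>f x\<bar> \<le> B" using assms by (metis LIPbE)
  then show ?thesis using LIP_measurable[OF LIPbD[OF assms(2)]] assms(1)
    by (intro integrable_const_bound[of _ B]) (auto simp: finite_borel_measure_def cong: measurable_cong_sets)
qed

lemma closed_indicator_LIPb_limit:
  fixes C :: "'a::metric_space set"
  assumes "closed C"
  obtains g where "\<And>n. g n \<in> LIPb" "\<And>n x. 0 \<le> g n x \<and> g n x \<le> 1" "\<And>x. (\<lambda>n. g n x) \<longlonglongrightarrow> (indicator C x :: real)"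
proof (cases "C = {}")
  \<comment> \<open>Separate because \<open>infdist\<close> to the empty set is 0, which would turn
    the cut-offs below into the constant 1.\<close>
  case True
  show ?thesis by (rule that[of "\<lambda>_ _. 0"]) (auto simp: True LIPb_const)
next
  case False
  define g where "g = (\<lambda>(n::nat) x. max 0 (1 - real n * infdist x C))"
  show ?thesis
  proof (rule that[of g])
    show bd: "0 \<le> g n x \<and> g n x \<le> 1" for n x by (auto simp: g_def infdist_nonneg)
    show "g n \<in> LIPb" for n
    proof (rule LIPbI)
      show "g n \<in> LIP" unfolding g_def by (intro LIP_max LIP_const LIP_diff LIP_cmult LIP_infdist)
      show "\<bar>g n x\<bar> \<le> 1" for x using bd[of n x] by auto
    qed
    show "(\<lambda>n. g n x) \<longlonglongrightarrow> indicator C x" for x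
    proof (cases "x \<in> C")
      case True then show ?thesis by (simp add: g_def)
    next
      case x: False
      then have "0 < infdist x C" using assms False by (metis in_closed_iff_infdist_zero infdist_nonneg less_le)
      then obtain N :: nat where N: "1 / infdist x C < real N" using reals_Archimedean2 by blast
      have "g n x = 0" if "N \<le> n" for n
      proof -
        have "1 \<le> real N * infdist x C" using N \<open>0 < infdist x C\<close> by (simp add: field_simps)
        also have "\<dots> \<le> real n * infdist x C" using that by (intro mult_right_mono infdist_nonneg) auto
        finally show ?thesis by (simp add: g_def)
      qed
      then have "eventually (\<lambda>n. g n x = 0) sequentially" unfolding eventually_sequentially by blast
      then show ?thesis using x by (simp add: tendsto_eventually)
    qed
  qed
qed

section \<open>Estimates in \<open>L^1\<close> and bounded linear functionals on it\<close>

lemma L1_dist_triangle: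
  fixes f g h :: "'a \<Rightarrow> real"
  assumes "integrable M f" "integrable M g" "integrable M h"
  shows "(\<integral>x. \<bar>f x - h x\<bar> \<partial>M) \<le> (\<integral>x. \<bar>f x - g x\<bar> \<partial>M) + (\<integral>x. \<bar>g x - h x\<bar> \<partial>M)"
proof -
  have "(\<integral>x. \<bar>f x - h x\<bar> \<partial>M) \<le> (\<integral>x. \<bar>f x - g x\<bar> + \<bar>g x - h x\<bar> \<partial>M)"
    by (rule integral_mono) (use assms in auto)
  also have "\<dots> = (\<integral>x. \<bar>f x - g x\<bar> \<partial>M) + (\<integral>x. \<bar>g x - h x\<bar> \<partial>M)"
    by (rule Bochner_Integration.integral_add) (use assms in auto)
  finally show ?thesis .
qed

lemma L1_dominated_convergence:
  fixes f w :: "'a \<Rightarrow> real"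
  assumes "\<And>n. integrable M (s n)" "integrable M f" "AE x in M. (\<lambda>n. s n x) \<longlonglongrightarrow> f x"
    "integrable M w" "\<And>n. AE x in M. \<bar>s n x\<bar> \<le> w x"
  shows "(\<lambda>n. \<integral>x. \<bar>s n x - f x\<bar> \<partial>M) \<longlonglongrightarrow> 0"
proof -
  have "(\<lambda>n. \<integral>x. \<bar>s n x - f x\<bar> \<partial>M) \<longlonglongrightarrow> (\<integral>x. 0 \<partial>M)"
  proof (rule integral_dominated_convergence[where w = "\<lambda>x. w x + \<bar>f x\<bar>"])
    show "AE x in M. (\<lambda>n. \<bar>s n x - f x\<bar>) \<longlonglongrightarrow> 0"
      using assms(3) by eventually_elim (intro tendsto_rabs_zero LIM_zero)
    show "AE x in M. norm \<bar>s n x - f x\<bar> \<le> w x + \<bar>f x\<bar>" for n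
      using assms(5)[of n] by eventually_elim auto
    show "integrable M (\<lambda>x. w x + \<bar>f x\<bar>)" using assms(2,4) by simp
    show "(\<lambda>x. \<bar>s n x - f x\<bar>) \<in> borel_measurable M" for n
      using borel_measurable_integrable[OF assms(1)[of n]] borel_measurable_integrable[OF assms(2)] by measurable
  qed simp
  then show ?thesis by simp
qed

lemma integrable_bounded_mult:
  fixes f g :: "'a \<Rightarrow> real"
  assumes f: "integrable M f" and g: "g \<in> borel_measurable M" "\<And>x. \<bar>g x\<bar> \<le> B"
  shows "integrable M (\<lambda>x. f x * g x)"
proof (rule Bochner_Integration.integrable_bound[of M "\<lambda>x. B * f x"])
  show "(\<lambda>x. f x * g x) \<in> borel_measurable M"
    by (rule borel_measurable_times[OF borel_measurable_integrable[OF f] g(1)])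
  show "AE x in M. norm (f x * g x) \<le> norm (B * f x)"
  proof (rule AE_I2)
    fix x
    have "0 \<le> B" using g(2) by (meson abs_ge_zero order_trans)
    then show "norm (f x * g x) \<le> norm (B * f x)"
      using mult_left_mono[OF g(2)[of x], of "\<bar>f x\<bar>"] by (simp add: abs_mult mult.commute)
  qed
qed (use f in simp)

lemma L1_norm_lincomb:
  fixes f g u v :: "'a \<Rightarrow> real"
  assumes "integrable M f" "integrable M g" "integrable M u" "integrable M v"
  shows "(\<integral>x. \<bar>(a * u x + b * v x) - (a * f x + b * g x)\<bar> \<partial>M)
    \<le> \<bar>a\<bar> * (\<integral>x. \<bar>u x - f x\<bar> \<partial>M) + \<bar>b\<bar> * (\<integral>x. \<bar>v x - g x\<bar> \<partial>M)"
proof -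
  have "(\<integral>x. \<bar>(a * u x + b * v x) - (a * f x + b * g x)\<bar> \<partial>M) \<le> (\<integral>x. \<bar>a\<bar> * \<bar>u x - f x\<bar> + \<bar>b\<bar> * \<bar>v x - g x\<bar> \<partial>M)"
  proof (rule integral_mono)
    fix x
    have "(a * u x + b * v x) - (a * f x + b * g x) = a * (u x - f x) + b * (v x - g x)" by (simp add: algebra_simps)
    then show "\<bar>(a * u x + b * v x) - (a * f x + b * g x)\<bar> \<le> \<bar>a\<bar> * \<bar>u x - f x\<bar> + \<bar>b\<bar> * \<bar>v x - g x\<bar>"
      by (metis abs_mult abs_triangle_ineq)
  qed (use assms in auto)
  then show ?thesis using assms by simp
qed

lemma L1_functional_diff:
  fixes F :: "('a \<Rightarrow> real) \<Rightarrow> real"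
  assumes lin: "\<And>f g a b. integrable M f \<Longrightarrow> integrable M g \<Longrightarrow> F (\<lambda>x. a * f x + b * g x) = a * F f + b * F g"
    and bound: "\<And>f. integrable M f \<Longrightarrow> \<bar>F f\<bar> \<le> L * (\<integral>x. \<bar>f x\<bar> \<partial>M)"
    and fg: "integrable M f" "integrable M g"
  shows "\<bar>F f - F g\<bar> \<le> L * (\<integral>x. \<bar>f x - g x\<bar> \<partial>M)"
  using bound[of "\<lambda>x. 1 * f x + (-1) * g x"] lin[OF fg, of 1 "-1"] fg by simp

lemma L1_functional_lim:
  fixes F :: "('a \<Rightarrow> real) \<Rightarrow> real"
  assumes lin: "\<And>f g a b. integrable M f \<Longrightarrow> integrable M g \<Longrightarrow> F (\<lambda>x. a * f x + b * g x) = a * F f + b * F g"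
    and bound: "\<And>f. integrable M f \<Longrightarrow> \<bar>F f\<bar> \<le> L * (\<integral>x. \<bar>f x\<bar> \<partial>M)"
    and s: "\<And>n. integrable M (s n)" and f: "integrable M f"
    and lim: "(\<lambda>n. \<integral>x. \<bar>s n x - f x\<bar> \<partial>M) \<longlonglongrightarrow> 0"
  shows "(\<lambda>n. F (s n)) \<longlonglongrightarrow> F f"
proof -
  have 0: "(\<lambda>n. L * (\<integral>x. \<bar>s n x - f x\<bar> \<partial>M)) \<longlonglongrightarrow> 0"
    using tendsto_mult[OF tendsto_const lim, of L] by simp
  have "norm (F (s n) - F f) \<le> L * (\<integral>x. \<bar>s n x - f x\<bar> \<partial>M)" for n
    unfolding real_norm_def by (rule L1_functional_diff[OF _ _ s f]) (fact lin bound)+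
  then have "(\<lambda>n. F (s n) - F f) \<longlonglongrightarrow> 0"
    by (intro Lim_null_comparison[OF always_eventually 0] allI)
  then show ?thesis by (simp add: LIM_zero_iff)
qed

lemma finite_borel_integrable_indicator:
  "finite_borel_measure \<mu> \<Longrightarrow> B \<in> sets borel \<Longrightarrow> integrable \<mu> (indicat_real B)"
  using finite_measure.emeasure_finite[of \<mu> B]
  by (intro integrable_real_indicator) (auto simp: finite_borel_measure_def less_top[symmetric])

lemma L1_indicator_UN:
  fixes A :: "nat \<Rightarrow> 'a::metric_space set"
  assumes \<mu>: "finite_borel_measure \<mu>" and A: "\<And>i. A i \<in> sets borel"
  shows "(\<lambda>n. \<integral>x. \<bar>indicat_real (\<Union>i<n. A i) x - indicat_real (\<Union>(range A)) x\<bar> \<partial>\<mu>) \<longlonglongrightarrow> 0"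
proof (rule L1_dominated_convergence[where w="\<lambda>_. 1"])
  show "integrable \<mu> (indicat_real (\<Union>i<n. A i))" for n
    by (rule finite_borel_integrable_indicator[OF \<mu>]) (use A in auto)
  show "integrable \<mu> (indicat_real (\<Union>(range A)))"
    by (rule finite_borel_integrable_indicator[OF \<mu>]) (use A in auto)
  show "AE x in \<mu>. (\<lambda>n. indicat_real (\<Union>i<n. A i) x) \<longlonglongrightarrow> indicat_real (\<Union>(range A)) x"
    by (intro AE_I2 LIMSEQ_indicator_UN)
  show "AE x in \<mu>. \<bar>indicat_real (\<Union>i<n. A i) x\<bar> \<le> 1" for n
    by (intro AE_I2 indicator_abs_le_1)
  show "integrable \<mu> (\<lambda>_. 1::real)" by (rule LIPb_integrable[OF \<mu> LIPb_const])
qed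

lemma indicator_UN_Suc:
  assumes "disjoint_family A"
  shows "indicat_real (\<Union>i<Suc n. A i) = (\<lambda>x. 1 * indicator (\<Union>i<n. A i) x + 1 * indicator (A n) x)"
proof -
  have "A i \<inter> A n = {}" if "i < n" for i
    using assms that unfolding disjoint_family_on_def by (metis UNIV_I less_irrefl)
  then have "(\<Union>i<n. A i) \<inter> A n = {}" by blast
  moreover have "(\<Union>i<Suc n. A i) = (\<Union>i<n. A i) \<union> A n" by (simp add: lessThan_Suc Un_commute)
  ultimately show ?thesis by (simp add: indicator_disj_union fun_eq_iff)
qed

definition LIPb_approx :: "'a::metric_space measure \<Rightarrow> ('a \<Rightarrow> real) \<Rightarrow> bool" where
  "LIPb_approx \<mu> f \<longleftrightarrow> (\<forall>e>0. \<exists>g\<in>LIPb. (\<integral>x. \<bar>g x - f x\<bar> \<partial>\<mu>) < e)"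

lemma LIPb_approx_limit:
  assumes \<mu>: "finite_borel_measure \<mu>"
    and s: "\<And>n. integrable \<mu> (s n)" "\<And>n. LIPb_approx \<mu> (s n)" and f: "integrable \<mu> f"
    and lim: "(\<lambda>n. \<integral>x. \<bar>s n x - f x\<bar> \<partial>\<mu>) \<longlonglongrightarrow> 0"
  shows "LIPb_approx \<mu> f"
  unfolding LIPb_approx_def
proof (intro allI impI)
  fix e :: real assume e: "0 < e"
  obtain n where n: "(\<integral>x. \<bar>s n x - f x\<bar> \<partial>\<mu>) < e / 2"
    using order_tendstoD(2)[OF lim, of "e / 2"] e by (auto simp: eventually_sequentially)
  obtain g where g: "g \<in> LIPb" "(\<integral>x. \<bar>g x - s n x\<bar> \<partial>\<mu>) < e / 2"
    using s(2)[of n] e unfolding LIPb_approx_def by (metis half_gt_zero)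
  show "\<exists>g\<in>LIPb. (\<integral>x. \<bar>g x - f x\<bar> \<partial>\<mu>) < e"
    using L1_dist_triangle[OF LIPb_integrable[OF \<mu> g(1)] s(1) f, of n] n g by (intro bexI[of _ g]) auto
qed

text \<open>Indicators of closed sets are limits of cut-offs. Closed sets form an
  intersection-stable generator, so complements and disjoint unions lead to all Borel sets, and
  linear combinations with dominated limits to all integrable functions.\<close>

lemma LIPb_approx_integrable:
  assumes \<mu>: "finite_borel_measure \<mu>" and f: "integrable \<mu> f"
  shows "LIPb_approx \<mu> f"
proof -
  interpret finite_measure \<mu> using \<mu> by (simp add: finite_borel_measure_def)
  have sets[measurable_cong, simp]: "sets \<mu> = sets borel" using \<mu> by (simp add: finite_borel_measure_def)
  have space[simp]: "space \<mu> = UNIV" using sets_eq_imp_space_eq[OF sets] by simp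
  have comb: "LIPb_approx \<mu> (\<lambda>x. a * f x + b * g x)"
    if fg: "integrable \<mu> f" "integrable \<mu> g" "LIPb_approx \<mu> f" "LIPb_approx \<mu> g" for f g a b
    unfolding LIPb_approx_def
  proof (intro allI impI)
    fix e :: real assume e: "0 < e"
    define d where "d = e / (\<bar>a\<bar> + \<bar>b\<bar> + 1)"
    have d: "0 < d" using e by (simp add: d_def)
    obtain u v where u: "u \<in> LIPb" "(\<integral>x. \<bar>u x - f x\<bar> \<partial>\<mu>) < d" and v: "v \<in> LIPb" "(\<integral>x. \<bar>v x - g x\<bar> \<partial>\<mu>) < d"
      using fg d unfolding LIPb_approx_def by metis
    have int: "integrable \<mu> u" "integrable \<mu> v" using u v LIPb_integrable[OF \<mu>] by auto
    have "(\<integral>x. \<bar>(a * u x + b * v x) - (a * f x + b * g x)\<bar> \<partial>\<mu>) \<le> \<bar>a\<bar> * (\<integral>x. \<bar>u x - f x\<bar> \<partial>\<mu>) + \<bar>b\<bar> * (\<integral>x. \<bar>v x - g x\<bar> \<partial>\<mu>)"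
      by (rule L1_norm_lincomb[OF fg(1,2) int])
    also have "\<dots> \<le> \<bar>a\<bar> * d + \<bar>b\<bar> * d" using u v by (intro add_mono mult_left_mono) auto
    also have "\<dots> < (\<bar>a\<bar> + \<bar>b\<bar> + 1) * d" using d by (simp add: algebra_simps)
    also have "\<dots> = e"
    proof -
      have "\<bar>a\<bar> + \<bar>b\<bar> + 1 \<noteq> 0" by linarith
      then show ?thesis by (simp add: d_def)
    qed
    finally show "\<exists>g'\<in>LIPb. (\<integral>x. \<bar>g' x - (a * f x + b * g x)\<bar> \<partial>\<mu>) < e"
      by (rule bexI[OF _ LIPb_lincomb[OF u(1) v(1)]])
  qed
  have dom: "(\<lambda>n. \<integral>x. \<bar>s n x - f x\<bar> \<partial>\<mu>) \<longlonglongrightarrow> 0"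
    if "\<And>n. integrable \<mu> (s n)" "integrable \<mu> f" "\<And>x. (\<lambda>n. s n x) \<longlonglongrightarrow> f x" "integrable \<mu> w" "\<And>n x. \<bar>s n x\<bar> \<le> w x"
    for s :: "nat \<Rightarrow> 'a \<Rightarrow> real" and f w
    by (rule L1_dominated_convergence[OF that(1,2) AE_I2[OF that(3)] that(4) AE_I2[OF that(5)]])
  have closed: "LIPb_approx \<mu> (indicator C)" if C: "closed C" for C :: "'a set"
  proof -
    obtain g where g: "\<And>n. g n \<in> LIPb" "\<And>n x. 0 \<le> g n x \<and> g n x \<le> 1" "\<And>x. (\<lambda>n. g n x) \<longlonglongrightarrow> (indicator C x :: real)"
      using closed_indicator_LIPb_limit[OF C] by blast
    show ?thesis
    proof (rule LIPb_approx_limit[OF \<mu>])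
      show "integrable \<mu> (g n)" for n by (rule LIPb_integrable[OF \<mu> g(1)])
      show "LIPb_approx \<mu> (g n)" for n
        unfolding LIPb_approx_def by (intro allI impI bexI[of _ "g n"]) (auto simp: g)
      show int: "integrable \<mu> (indicat_real C)" by (rule finite_borel_integrable_indicator[OF \<mu>]) (use C in auto)
      show "(\<lambda>n. \<integral>x. \<bar>g n x - indicator C x\<bar> \<partial>\<mu>) \<longlonglongrightarrow> 0"
      proof (rule dom[OF LIPb_integrable[OF \<mu> g(1)] int g(3), where w="\<lambda>_. 1"])
        show "\<bar>g n x\<bar> \<le> 1" for n x using g(2)[of n x] by simp
      qed simp
    qed
  qed
  note int_ind = finite_borel_integrable_indicator[OF \<mu>]
  have borel: "LIPb_approx \<mu> (indicator A)" if A: "A \<in> sets borel" for A :: "'a set"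
  proof -
    have "Int_stable {C::'a set. closed C}" by (auto simp: Int_stable_def)
    moreover have "{C::'a set. closed C} \<subseteq> Pow UNIV" by auto
    moreover have "A \<in> sigma_sets UNIV {C. closed C}" using A by (simp add: borel_eq_closed)
    ultimately show ?thesis
    proof (induction rule: sigma_sets_induct_disjoint)
      case (basic A) then show ?case using closed by auto
    next
      case empty show ?case using closed[of "{}"] by (simp only: closed_empty)
    next
      case (compl A)
      have A: "A \<in> sets borel" using compl(1) by (simp add: borel_eq_closed)
      have "LIPb_approx \<mu> (\<lambda>x. 1 * indicator UNIV x + (-1) * indicator A x)"
        by (intro comb int_ind closed compl(2) A) auto
      moreover have "(\<lambda>x. 1 * indicator UNIV x + (-1) * indicator A x) = (indicator (UNIV - A) :: 'a \<Rightarrow> real)"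
        by (auto simp: indicator_def)
      ultimately show ?case by simp
    next
      case (union A)
      have A: "A i \<in> sets borel" for i using union(2) by (auto simp: borel_eq_closed)
      have fin: "LIPb_approx \<mu> (indicator (\<Union>i<n. A i))" for n
      proof (induction n)
        case 0 show ?case using closed[of "{}"] by (simp only: closed_empty lessThan_0 UN_empty)
      next
        case (Suc n)
        show ?case unfolding indicator_UN_Suc[OF union(1)]
          by (intro comb int_ind Suc union(3)) (use A in auto)
      qed
      show ?case
      proof (rule LIPb_approx_limit[OF \<mu> _ fin])
        have UA: "\<Union>(range A) \<in> sets borel" using A by auto
        have FA: "(\<Union>i<n. A i) \<in> sets borel" for n using A by auto
        show "integrable \<mu> (indicat_real (\<Union>i<n. A i))" for n by (rule int_ind[OF FA])
        show "integrable \<mu> (indicat_real (\<Union>(range A)))" by (rule int_ind[OF UA])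
        show "(\<lambda>n. \<integral>x. \<bar>indicat_real (\<Union>i<n. A i) x - indicat_real (\<Union>(range A)) x\<bar> \<partial>\<mu>) \<longlonglongrightarrow> 0"
          by (rule L1_indicator_UN[OF \<mu> A])
      qed
    qed
  qed
  show ?thesis using f
  proof (induction rule: integrable_induct)
    case (base A c)
    then have "LIPb_approx \<mu> (\<lambda>x. c * indicator A x + 0 * indicator A x)"
      by (intro comb int_ind borel) auto
    then show ?case by (simp add: mult.commute)
  next
    case (add f g)
    then show ?case using comb[of f g 1 1] by simp
  next
    case (lim f s)
    show ?case
    proof (rule LIPb_approx_limit[OF \<mu> lim(1) lim(5,4)])
      show "(\<lambda>n. \<integral>x. \<bar>s n x - f x\<bar> \<partial>\<mu>) \<longlonglongrightarrow> 0"
      proof (rule dom[OF lim(1,4), where w="\<lambda>x. 2 * \<bar>f x\<bar>"])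
        show "(\<lambda>n. s n x) \<longlonglongrightarrow> f x" for x using lim(2)[of x] by simp
        show "\<bar>s n x\<bar> \<le> 2 * \<bar>f x\<bar>" for n x using lim(3)[of x n] by simp
        show "integrable \<mu> (\<lambda>x. 2 * \<bar>f x\<bar>)" using lim(4) by simp
      qed
    qed
  qed
qed

section \<open>Mass measure and extension to \<open>L\<^sup>1\<close>\<close>

text \<open>The sum of the two measures works. Approximation in \<open>L^1\<close> of the upper
  bound is approximation in both \<open>L^1\<close> spaces at once.\<close>

lemma measure_sum_upper_bound:
  fixes M N :: "'a::metric_space measure"
  assumes "finite_borel_measure M" "finite_borel_measure N"
  obtains R where "finite_borel_measure R" "M \<le> R" "N \<le> R"
proof -
  have sets: "sets M = sets borel" "sets N = sets borel" and fin: "finite_measure M" "finite_measure N"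
    using assms by (auto simp: finite_borel_measure_def)
  define R where "R = measure_of UNIV (sets (borel :: 'a measure)) (\<lambda>A. emeasure M A + emeasure N A)"
  have setsR: "sets R = sets borel" unfolding R_def
    using sets.sigma_sets_eq[of "borel :: 'a measure"] by (simp add: sets_measure_of)
  have em: "emeasure R A = emeasure M A + emeasure N A" if "A \<in> sets borel" for A
  proof (rule emeasure_measure_of[OF R_def])
    show "countably_additive (sets R) (\<lambda>A. emeasure M A + emeasure N A)"
    proof (rule countably_additiveI)
      fix A :: "nat \<Rightarrow> 'a set" assume A: "range A \<subseteq> sets R" "disjoint_family A" "\<Union>(range A) \<in> sets R"
      have "(\<Sum>i. emeasure M (A i) + emeasure N (A i)) = (\<Sum>i. emeasure M (A i)) + (\<Sum>i. emeasure N (A i))"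
        by (intro suminf_add[symmetric]) auto
      then show "(\<Sum>i. emeasure M (A i) + emeasure N (A i)) = emeasure M (\<Union>(range A)) + emeasure N (\<Union>(range A))"
        using A by (simp add: suminf_emeasure sets setsR)
    qed
  qed (use that setsR in \<open>auto simp: positive_def\<close>)
  have space: "space M = UNIV" "space N = UNIV" "space R = UNIV"
    using sets setsR by (metis sets_eq_imp_space_eq space_borel)+
  have "emeasure M A \<le> emeasure R A \<and> emeasure N A \<le> emeasure R A" for A
    by (cases "A \<in> sets borel") (simp_all add: em emeasure_notin_sets sets)
  then have le: "M \<le> R" "N \<le> R"
    by (simp_all add: le_measure_iff sets setsR space le_fun_def)
  have "finite_measure R"
    by (rule finite_measureI) (use em[of UNIV] space finite_measure.emeasure_finite[OF fin(1)] finite_measure.emeasure_finite[OF fin(2)] in auto)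
  then have "finite_borel_measure R" using setsR by (simp add: finite_borel_measure_def)
  then show ?thesis using le that by blast
qed

lemma integral_abs_mono_measure:
  fixes f :: "'a \<Rightarrow> real"
  assumes "M \<le> N" "sets M = sets N" "integrable N f"
  shows "integrable M f" "(\<integral>x. \<bar>f x\<bar> \<partial>M) \<le> (\<integral>x. \<bar>f x\<bar> \<partial>N)"
proof -
  have m: "f \<in> borel_measurable M"
    using borel_measurable_integrable[OF assms(3)] measurable_cong_sets[OF assms(2)] by blast
  have le: "(\<integral>\<^sup>+x. ennreal \<bar>f x\<bar> \<partial>M) \<le> (\<integral>\<^sup>+x. ennreal \<bar>f x\<bar> \<partial>N)"
    by (rule nn_integral_mono_measure) (use assms in auto)
  have N: "(\<integral>\<^sup>+x. ennreal \<bar>f x\<bar> \<partial>N) = ennreal (\<integral>x. \<bar>f x\<bar> \<partial>N)"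
    by (rule nn_integral_eq_integral) (use assms in auto)
  show int: "integrable M f"
    by (rule integrableI_bounded[OF m]) (use le N in \<open>auto simp: less_top[symmetric] top_unique\<close>)
  have "(\<integral>\<^sup>+x. ennreal \<bar>f x\<bar> \<partial>M) = ennreal (\<integral>x. \<bar>f x\<bar> \<partial>M)"
    by (rule nn_integral_eq_integral) (use int in auto)
  then have "ennreal (\<integral>x. \<bar>f x\<bar> \<partial>M) \<le> ennreal (\<integral>x. \<bar>f x\<bar> \<partial>N)" using le N by simp
  then show "(\<integral>x. \<bar>f x\<bar> \<partial>M) \<le> (\<integral>x. \<bar>f x\<bar> \<partial>N)"
    by (subst (asm) ennreal_le_iff) auto
qed

section \<open>Extension of functionals from bounded Lipschitz functions to
  \<open>L^1\<close>\<close>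

definition LIPb_functional :: "'a::metric_space measure \<Rightarrow> real \<Rightarrow> (('a \<Rightarrow> real) \<Rightarrow> real) \<Rightarrow> bool" where
  "LIPb_functional \<mu> L \<Lambda> \<longleftrightarrow> finite_borel_measure \<mu> \<and> 0 \<le> L \<and>
     (\<forall>f\<in>LIPb. \<forall>g\<in>LIPb. \<forall>a b. \<Lambda> (\<lambda>x. a * f x + b * g x) = a * \<Lambda> f + b * \<Lambda> g) \<and>
     (\<forall>f\<in>LIPb. \<bar>\<Lambda> f\<bar> \<le> L * (\<integral>x. \<bar>f x\<bar> \<partial>\<mu>))"

definition LIPb_seq :: "'a::metric_space measure \<Rightarrow> ('a \<Rightarrow> real) \<Rightarrow> nat \<Rightarrow> 'a \<Rightarrow> real" where
  "LIPb_seq \<mu> f n = (SOME g. g \<in> LIPb \<and> (\<integral>x. \<bar>g x - f x\<bar> \<partial>\<mu>) < inverse (real (Suc n)))"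

text \<open>A fixed choice of approximations makes the extension a total function of
  \<open>f\<close>. For functionals that satisfy \<open>LIPb_functional\<close> the limit exists and
  does not depend on the choice, by \<open>L1_lim_tendsto\<close>.\<close>

definition L1_lim :: "'a::metric_space measure \<Rightarrow> (('a \<Rightarrow> real) \<Rightarrow> real) \<Rightarrow> ('a \<Rightarrow> real) \<Rightarrow> real" where
  "L1_lim \<mu> \<Lambda> f = lim (\<lambda>n. \<Lambda> (LIPb_seq \<mu> f n))"

lemma LIPb_seq:
  assumes "finite_borel_measure \<mu>" "integrable \<mu> f"
  shows "LIPb_seq \<mu> f n \<in> LIPb" "(\<integral>x. \<bar>LIPb_seq \<mu> f n x - f x\<bar> \<partial>\<mu>) < inverse (real (Suc n))"
    "(\<lambda>n. \<integral>x. \<bar>LIPb_seq \<mu> f n x - f x\<bar> \<partial>\<mu>) \<longlonglongrightarrow> 0"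
proof -
  have *: "LIPb_seq \<mu> f n \<in> LIPb \<and> (\<integral>x. \<bar>LIPb_seq \<mu> f n x - f x\<bar> \<partial>\<mu>) < inverse (real (Suc n))" for n
    unfolding LIPb_seq_def
  proof (rule someI_ex[where P="\<lambda>g. g \<in> LIPb \<and> (\<integral>x. \<bar>g x - f x\<bar> \<partial>\<mu>) < inverse (real (Suc n))"])
    have "0 < inverse (real (Suc n))" by simp
    then show "\<exists>g. g \<in> LIPb \<and> (\<integral>x. \<bar>g x - f x\<bar> \<partial>\<mu>) < inverse (real (Suc n))"
      using LIPb_approx_integrable[OF assms] unfolding LIPb_approx_def by blast
  qed
  then show "LIPb_seq \<mu> f n \<in> LIPb" "(\<integral>x. \<bar>LIPb_seq \<mu> f n x - f x\<bar> \<partial>\<mu>) < inverse (real (Suc n))" by auto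
  show "(\<lambda>n. \<integral>x. \<bar>LIPb_seq \<mu> f n x - f x\<bar> \<partial>\<mu>) \<longlonglongrightarrow> 0"
    by (rule tendsto_sandwich[OF _ _ tendsto_const LIMSEQ_inverse_real_of_nat])
      (use * in \<open>simp_all add: less_imp_le integral_nonneg_AE\<close>)
qed

lemma LIPb_functional_diff:
  assumes "LIPb_functional \<mu> L \<Lambda>" "f \<in> LIPb" "g \<in> LIPb"
  shows "\<bar>\<Lambda> f - \<Lambda> g\<bar> \<le> L * (\<integral>x. \<bar>f x - g x\<bar> \<partial>\<mu>)"
proof -
  have "\<Lambda> (\<lambda>x. 1 * f x + (-1) * g x) = 1 * \<Lambda> f + (-1) * \<Lambda> g"
    using assms unfolding LIPb_functional_def by blast
  moreover have "\<bar>\<Lambda> (\<lambda>x. 1 * f x + (-1) * g x)\<bar> \<le> L * (\<integral>x. \<bar>1 * f x + (-1) * g x\<bar> \<partial>\<mu>)"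
    using assms LIPb_lincomb unfolding LIPb_functional_def by blast
  ultimately show ?thesis by simp
qed

text \<open>Two functions that are close to \<open>f\<close> in \<open>L^1\<close> have close values
  under \<Lambda>. This makes the chosen sequence Cauchy and lets every other approximating sequence
  share its limit; linearity and the bound are then limits of the same statements on
  \<open>LIPb\<close>.\<close>

lemma L1_lim_tendsto:
  assumes \<Lambda>: "LIPb_functional \<mu> L \<Lambda>" and f: "integrable \<mu> f"
    and g: "\<And>n. g n \<in> LIPb" "(\<lambda>n. \<integral>x. \<bar>g n x - f x\<bar> \<partial>\<mu>) \<longlonglongrightarrow> 0"
  shows "(\<lambda>n. \<Lambda> (g n)) \<longlonglongrightarrow> L1_lim \<mu> \<Lambda> f"
proof -
  have \<mu>: "finite_borel_measure \<mu>" and L: "0 \<le> L" using \<Lambda> by (auto simp: LIPb_functional_def)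
  define s where "s = LIPb_seq \<mu> f"
  have s: "s n \<in> LIPb" "(\<integral>x. \<bar>s n x - f x\<bar> \<partial>\<mu>) < inverse (real (Suc n))" for n
    using LIPb_seq[OF \<mu> f] by (auto simp: s_def)
  have s0: "(\<lambda>n. \<integral>x. \<bar>s n x - f x\<bar> \<partial>\<mu>) \<longlonglongrightarrow> 0"
    using LIPb_seq[OF \<mu> f] by (auto simp: s_def)
  have close: "\<bar>\<Lambda> u - \<Lambda> v\<bar> \<le> L * ((\<integral>x. \<bar>u x - f x\<bar> \<partial>\<mu>) + (\<integral>x. \<bar>v x - f x\<bar> \<partial>\<mu>))" if "u \<in> LIPb" "v \<in> LIPb" for u v
  proof -
    have "(\<integral>x. \<bar>u x - v x\<bar> \<partial>\<mu>) \<le> (\<integral>x. \<bar>u x - f x\<bar> \<partial>\<mu>) + (\<integral>x. \<bar>f x - v x\<bar> \<partial>\<mu>)"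
      by (rule L1_dist_triangle) (use that f LIPb_integrable[OF \<mu>] in auto)
    then have "L * (\<integral>x. \<bar>u x - v x\<bar> \<partial>\<mu>) \<le> L * ((\<integral>x. \<bar>u x - f x\<bar> \<partial>\<mu>) + (\<integral>x. \<bar>v x - f x\<bar> \<partial>\<mu>))"
      using L by (intro mult_left_mono) (auto simp: abs_minus_commute)
    then show ?thesis using LIPb_functional_diff[OF \<Lambda> that] by linarith
  qed
  have "Cauchy (\<lambda>n. \<Lambda> (s n))"
  proof (rule metric_CauchyI)
    fix e :: real assume e: "0 < e"
    \<comment> \<open>The \<open>+ 1\<close> keeps the quotient meaningful and the final inequality
      strict when \<open>L = 0\<close>.\<close>
    define d where "d = e / (2 * (L + 1))"
    have d: "0 < d" "2 * (L * d) + 2 * d = e"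
      using e L by (simp_all add: d_def divide_simps) (simp add: algebra_simps)
    have "eventually (\<lambda>n. (\<integral>x. \<bar>s n x - f x\<bar> \<partial>\<mu>) < d) sequentially"
      using order_tendstoD(2)[OF s0 d(1)] .
    then obtain N where N: "\<And>n. N \<le> n \<Longrightarrow> (\<integral>x. \<bar>s n x - f x\<bar> \<partial>\<mu>) < d"
      unfolding eventually_sequentially by blast
    have "dist (\<Lambda> (s m)) (\<Lambda> (s n)) < e" if "N \<le> m" "N \<le> n" for m n
    proof -
      have "\<bar>\<Lambda> (s m) - \<Lambda> (s n)\<bar> \<le> L * ((\<integral>x. \<bar>s m x - f x\<bar> \<partial>\<mu>) + (\<integral>x. \<bar>s n x - f x\<bar> \<partial>\<mu>))"
        by (rule close[OF s(1) s(1)])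
      also have "\<dots> \<le> L * (d + d)"
        using N[OF that(1)] N[OF that(2)] by (intro mult_left_mono L) linarith
      also have "\<dots> < e" using d by (simp add: algebra_simps)
      finally show ?thesis by (simp add: dist_real_def)
    qed
    then show "\<exists>M. \<forall>m\<ge>M. \<forall>n\<ge>M. dist (\<Lambda> (s m)) (\<Lambda> (s n)) < e" by blast
  qed
  then have 1: "(\<lambda>n. \<Lambda> (s n)) \<longlonglongrightarrow> L1_lim \<mu> \<Lambda> f"
    by (simp add: L1_lim_def s_def Cauchy_convergent_iff convergent_LIMSEQ_iff)
  have "(\<lambda>n. L * ((\<integral>x. \<bar>g n x - f x\<bar> \<partial>\<mu>) + (\<integral>x. \<bar>s n x - f x\<bar> \<partial>\<mu>))) \<longlonglongrightarrow> L * (0 + 0)"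
    by (intro tendsto_intros g(2) s0)
  then have 2: "(\<lambda>n. L * ((\<integral>x. \<bar>g n x - f x\<bar> \<partial>\<mu>) + (\<integral>x. \<bar>s n x - f x\<bar> \<partial>\<mu>))) \<longlonglongrightarrow> 0"
    by simp
  have "(\<lambda>n. \<Lambda> (g n) - \<Lambda> (s n)) \<longlonglongrightarrow> 0"
  proof (rule Lim_null_comparison[OF always_eventually 2], rule allI)
    show "norm (\<Lambda> (g n) - \<Lambda> (s n)) \<le> L * ((\<integral>x. \<bar>g n x - f x\<bar> \<partial>\<mu>) + (\<integral>x. \<bar>s n x - f x\<bar> \<partial>\<mu>))" for n
      using close[OF g(1) s(1)] by simp
  qed
  from tendsto_add[OF this 1] show ?thesis by simp
qed

lemma L1_lim_extends:
  assumes \<Lambda>: "LIPb_functional \<mu> L \<Lambda>" and f: "f \<in> LIPb"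
  shows "L1_lim \<mu> \<Lambda> f = \<Lambda> f"
proof -
  have \<mu>: "finite_borel_measure \<mu>" using \<Lambda> by (auto simp: LIPb_functional_def)
  have "(\<lambda>n::nat. \<Lambda> f) \<longlonglongrightarrow> L1_lim \<mu> \<Lambda> f"
    by (rule L1_lim_tendsto[OF \<Lambda> LIPb_integrable[OF \<mu> f] f]) simp
  then show ?thesis by (simp add: LIMSEQ_const_iff)
qed

lemma L1_lim_linear:
  assumes \<Lambda>: "LIPb_functional \<mu> L \<Lambda>" and f: "integrable \<mu> f" and g: "integrable \<mu> g"
  shows "L1_lim \<mu> \<Lambda> (\<lambda>x. a * f x + b * g x) = a * L1_lim \<mu> \<Lambda> f + b * L1_lim \<mu> \<Lambda> g"
proof -
  have \<mu>: "finite_borel_measure \<mu>" using \<Lambda> by (auto simp: LIPb_functional_def)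
  let ?s = "LIPb_seq \<mu>"
  have sL: "?s f n \<in> LIPb" "?s g n \<in> LIPb" for n by (rule LIPb_seq[OF \<mu>] f g)+
  have "(\<lambda>n. \<Lambda> (\<lambda>x. a * ?s f n x + b * ?s g n x)) \<longlonglongrightarrow> L1_lim \<mu> \<Lambda> (\<lambda>x. a * f x + b * g x)"
  proof (rule L1_lim_tendsto[OF \<Lambda>])
    have "(\<lambda>n. \<bar>a\<bar> * (\<integral>x. \<bar>?s f n x - f x\<bar> \<partial>\<mu>) + \<bar>b\<bar> * (\<integral>x. \<bar>?s g n x - g x\<bar> \<partial>\<mu>)) \<longlonglongrightarrow> \<bar>a\<bar> * 0 + \<bar>b\<bar> * 0"
      by (intro tendsto_intros LIPb_seq[OF \<mu>] f g)
    then have 0: "(\<lambda>n. \<bar>a\<bar> * (\<integral>x. \<bar>?s f n x - f x\<bar> \<partial>\<mu>) + \<bar>b\<bar> * (\<integral>x. \<bar>?s g n x - g x\<bar> \<partial>\<mu>)) \<longlonglongrightarrow> 0"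
      by simp
    show "(\<lambda>n. \<integral>x. \<bar>(a * ?s f n x + b * ?s g n x) - (a * f x + b * g x)\<bar> \<partial>\<mu>) \<longlonglongrightarrow> 0"
    proof (rule Lim_null_comparison[OF always_eventually 0], rule allI)
      fix n
      show "norm (\<integral>x. \<bar>(a * ?s f n x + b * ?s g n x) - (a * f x + b * g x)\<bar> \<partial>\<mu>)
        \<le> \<bar>a\<bar> * (\<integral>x. \<bar>?s f n x - f x\<bar> \<partial>\<mu>) + \<bar>b\<bar> * (\<integral>x. \<bar>?s g n x - g x\<bar> \<partial>\<mu>)"
        using L1_norm_lincomb[OF f g LIPb_integrable[OF \<mu> sL(1)] LIPb_integrable[OF \<mu> sL(2)], of a n b n]
        by (simp add: integral_nonneg_AE)
    qed
    show "(\<lambda>x. a * ?s f n x + b * ?s g n x) \<in> LIPb" for n by (rule LIPb_lincomb[OF sL])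
    show "integrable \<mu> (\<lambda>x. a * f x + b * g x)" using f g by simp
  qed
  moreover have "(\<lambda>n. \<Lambda> (\<lambda>x. a * ?s f n x + b * ?s g n x)) = (\<lambda>n. a * \<Lambda> (?s f n) + b * \<Lambda> (?s g n))"
    using \<Lambda> sL unfolding LIPb_functional_def by blast
  moreover have "(\<lambda>n. a * \<Lambda> (?s f n) + b * \<Lambda> (?s g n)) \<longlonglongrightarrow> a * L1_lim \<mu> \<Lambda> f + b * L1_lim \<mu> \<Lambda> g"
    by (intro tendsto_intros L1_lim_tendsto[OF \<Lambda>] f g LIPb_seq[OF \<mu>])
  ultimately show ?thesis using LIMSEQ_unique by metis
qed

lemma L1_lim_bound:
  assumes \<Lambda>: "LIPb_functional \<mu> L \<Lambda>" and f: "integrable \<mu> f"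
  shows "\<bar>L1_lim \<mu> \<Lambda> f\<bar> \<le> L * (\<integral>x. \<bar>f x\<bar> \<partial>\<mu>)"
proof -
  have \<mu>: "finite_borel_measure \<mu>" and L: "0 \<le> L" using \<Lambda> by (auto simp: LIPb_functional_def)
  let ?s = "LIPb_seq \<mu> f"
  have sL: "?s n \<in> LIPb" for n by (rule LIPb_seq[OF \<mu>] f)+
  have "(\<lambda>n. L * ((\<integral>x. \<bar>?s n x - f x\<bar> \<partial>\<mu>) + (\<integral>x. \<bar>f x\<bar> \<partial>\<mu>))) \<longlonglongrightarrow> L * (0 + (\<integral>x. \<bar>f x\<bar> \<partial>\<mu>))"
    by (intro tendsto_intros LIPb_seq[OF \<mu>] f)
  moreover have "(\<lambda>n. \<bar>\<Lambda> (?s n)\<bar>) \<longlonglongrightarrow> \<bar>L1_lim \<mu> \<Lambda> f\<bar>"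
    by (intro tendsto_intros L1_lim_tendsto[OF \<Lambda>] f LIPb_seq[OF \<mu>])
  moreover have "\<bar>\<Lambda> (?s n)\<bar> \<le> L * ((\<integral>x. \<bar>?s n x - f x\<bar> \<partial>\<mu>) + (\<integral>x. \<bar>f x\<bar> \<partial>\<mu>))" for n
  proof -
    have "\<bar>\<Lambda> (?s n)\<bar> \<le> L * (\<integral>x. \<bar>?s n x\<bar> \<partial>\<mu>)" using \<Lambda> sL by (auto simp: LIPb_functional_def)
    also have "\<dots> \<le> L * ((\<integral>x. \<bar>?s n x - f x\<bar> \<partial>\<mu>) + (\<integral>x. \<bar>f x\<bar> \<partial>\<mu>))"
      using L1_dist_triangle[OF LIPb_integrable[OF \<mu> sL] f, of "\<lambda>_. 0" n] L by (intro mult_left_mono) auto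
    finally show ?thesis .
  qed
  ultimately show ?thesis using LIMSEQ_le[of _ "\<bar>L1_lim \<mu> \<Lambda> f\<bar>"] by simp
qed

text \<open>This is the duality of \<open>L^1\<close> and \<open>L^\<infinity>\<close>. The set
  function \<open>A \<mapsto> F (indicator A)\<close> is a signed measure dominated by
  \<open>L\<close> times \<open>\<mu>\<close>, and its Radon-Nikodym density represents
  \<open>F\<close> on indicators, hence on simple functions and their limits.\<close>

lemma L1_functional_density:
  fixes F :: "('a::metric_space \<Rightarrow> real) \<Rightarrow> real"
  assumes \<mu>: "finite_borel_measure \<mu>" and L: "0 \<le> L"
    and lin: "\<And>f g a b. integrable \<mu> f \<Longrightarrow> integrable \<mu> g \<Longrightarrow> F (\<lambda>x. a * f x + b * g x) = a * F f + b * F g"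
    and bound: "\<And>f. integrable \<mu> f \<Longrightarrow> \<bar>F f\<bar> \<le> L * (\<integral>x. \<bar>f x\<bar> \<partial>\<mu>)"
  obtains h where "h \<in> borel_measurable borel" "\<And>x. \<bar>h x\<bar> \<le> L"
    "\<And>f. integrable \<mu> f \<Longrightarrow> F f = (\<integral>x. f x * h x \<partial>\<mu>)"
proof -
  interpret finite_measure \<mu> using \<mu> by (simp add: finite_borel_measure_def)
  have sets[measurable_cong, simp]: "sets \<mu> = sets borel" using \<mu> by (simp add: finite_borel_measure_def)
  have space[simp]: "space \<mu> = UNIV" using sets_eq_imp_space_eq[OF sets] by simp
  note int_ind = finite_borel_integrable_indicator[OF \<mu>]
  have F_lim: "(\<lambda>n. F (s n)) \<longlonglongrightarrow> F f"
    if "\<And>n. integrable \<mu> (s n)" "integrable \<mu> f" "(\<lambda>n. \<integral>x. \<bar>s n x - f x\<bar> \<partial>\<mu>) \<longlonglongrightarrow> 0" for s f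
    by (rule L1_functional_lim[OF _ _ that]) (fact lin bound)+
  \<comment> \<open>Adding \<open>L\<close> times \<open>\<mu>\<close> turns the signed set function
    into a nonnegative one, at most \<open>2 * L\<close> times \<open>\<mu>\<close>. Subtracting
    \<open>L\<close> from its density undoes the shift.\<close>
  define r where "r = (\<lambda>A. F (indicator A) + L * measure \<mu> A)"
  have r0: "0 \<le> r A" and r2: "r A \<le> 2 * L * measure \<mu> A" if "A \<in> sets borel" for A
  proof -
    have "\<bar>F (indicator A)\<bar> \<le> L * measure \<mu> A" using bound[OF int_ind[OF that]] that by simp
    then show "0 \<le> r A" "r A \<le> 2 * L * measure \<mu> A" by (auto simp: r_def)
  qed
  have F_empty: "F (\<lambda>_. 0) = 0" using bound[of "\<lambda>_. 0"] by simp
  have F_sums: "(\<lambda>i. F (indicator (A i))) sums F (indicator (\<Union>(range A)))"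
    if A: "\<And>i. A i \<in> sets borel" and disj: "disjoint_family A" for A :: "nat \<Rightarrow> 'a set"
  proof -
    have UA: "\<Union>(range A) \<in> sets borel" and FA: "(\<Union>i<n. A i) \<in> sets borel" for n using A by auto
    have fin: "(\<Sum>i<n. F (indicator (A i))) = F (indicator (\<Union>i<n. A i))" for n
    proof (induction n)
      case 0 show ?case using F_empty by simp
    next
      case (Suc n)
      show ?case
        using lin[OF int_ind[OF FA] int_ind[OF A], of 1 n 1 n] Suc indicator_UN_Suc[OF disj, of n] by simp
    qed
    have "(\<lambda>n. F (indicator (\<Union>i<n. A i))) \<longlonglongrightarrow> F (indicator (\<Union>(range A)))"
      by (rule F_lim[OF int_ind[OF FA] int_ind[OF UA] L1_indicator_UN[OF \<mu> A]])
    then show ?thesis by (simp add: sums_def fin)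
  qed
  define \<rho> where "\<rho> = measure_of UNIV (sets (borel::'a measure)) (\<lambda>A. ennreal (r A))"
  have sets_rho: "sets \<rho> = sets borel" unfolding \<rho>_def
    using sets.sigma_sets_eq[of "borel :: 'a measure"] by (simp add: sets_measure_of)
  have em: "emeasure \<rho> A = ennreal (r A)" if "A \<in> sets borel" for A
  proof (rule emeasure_measure_of[OF \<rho>_def])
    show "countably_additive (sets \<rho>) (\<lambda>A. ennreal (r A))"
    proof (rule countably_additiveI)
      fix A :: "nat \<Rightarrow> 'a set" assume "range A \<subseteq> sets \<rho>" "disjoint_family A" "\<Union>(range A) \<in> sets \<rho>"
      then have A: "\<And>i. A i \<in> sets borel" "disjoint_family A" "\<Union>(range A) \<in> sets borel" by (auto simp: sets_rho)
      have m: "(\<lambda>i. measure \<mu> (A i)) sums measure \<mu> (\<Union>(range A))"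
        using finite_measure_UNION[of A] A by auto
      have "(\<lambda>i. r (A i)) sums r (\<Union>(range A))"
        unfolding r_def by (intro sums_add sums_mult m F_sums A)
      then have "(\<lambda>i. ennreal (r (A i))) sums ennreal (r (\<Union>(range A)))"
        using A r0 by (subst sums_ennreal) auto
      then show "(\<Sum>i. ennreal (r (A i))) = ennreal (r (\<Union>(range A)))" by (rule sums_unique[symmetric])
    qed
    show "positive (sets \<rho>) (\<lambda>A. ennreal (r A))" using r0[of "{}"] r2[of "{}"] by (simp add: positive_def)
  qed (use that sets_rho in auto)
  have "absolutely_continuous \<mu> \<rho>"
  proof (unfold absolutely_continuous_def, rule subsetI)
    fix A assume "A \<in> null_sets \<mu>"
    then have A: "A \<in> sets borel" "measure \<mu> A = 0" by (auto simp: null_sets_def measure_def)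
    then have "r A = 0" using r0[OF A(1)] r2[OF A(1)] by simp
    then show "A \<in> null_sets \<rho>" using A em by (auto simp: null_sets_def sets_rho)
  qed
  then obtain h0 where h0: "h0 \<in> borel_measurable \<mu>" "density \<mu> h0 = \<rho>"
    using Radon_Nikodym[of \<rho>] sets_rho by auto
  have [measurable]: "h0 \<in> borel_measurable borel" using h0(1) by simp
  have h0_int: "(\<integral>\<^sup>+x. h0 x * indicator A x \<partial>\<mu>) = ennreal (r A)" if "A \<in> sets borel" for A
    using em[OF that] that h0 by (metis emeasure_density sets)
  have "(\<integral>\<^sup>+x. h0 x \<partial>\<mu>) \<noteq> \<infinity>" using h0_int[of UNIV] by simp
  then have fin: "AE x in \<mu>. h0 x \<noteq> \<infinity>" using h0(1) by (intro nn_integral_PInf_AE) auto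
  define k where "k = (\<lambda>x. enn2real (h0 x))"
  have k[measurable]: "k \<in> borel_measurable borel" unfolding k_def by measurable
  have k0: "0 \<le> k x" for x by (simp add: k_def)
  have k_nn: "(\<integral>\<^sup>+x. ennreal (k x * indicator A x) \<partial>\<mu>) = ennreal (r A)" if "A \<in> sets borel" for A
  proof -
    have "(\<integral>\<^sup>+x. ennreal (k x * indicator A x) \<partial>\<mu>) = (\<integral>\<^sup>+x. h0 x * indicator A x \<partial>\<mu>)"
      by (rule nn_integral_cong_AE) (use fin in eventually_elim, auto simp: k_def indicator_def less_top)
    then show ?thesis using h0_int[OF that] by simp
  qed
  have k_int: "integrable \<mu> (\<lambda>x. k x * indicator A x)" if A: "A \<in> sets borel" for A
    using k_nn[OF A] A k0 by (intro integrableI_nonneg) (auto simp: less_top[symmetric])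
  have k_val: "(\<integral>x. k x * indicator A x \<partial>\<mu>) = r A" if A: "A \<in> sets borel" for A
    using k_nn[OF A] A k0 r0[OF A] by (subst integral_eq_nn_integral) auto
  have k_le: "AE x in \<mu>. k x \<le> 2 * L"
  proof -
    define A where "A = {x. 2 * L < k x}"
    have A: "A \<in> sets borel" unfolding A_def by measurable
    have int: "integrable \<mu> (\<lambda>x. k x * indicator A x - 2 * L * indicator A x)"
      by (intro Bochner_Integration.integrable_diff k_int[OF A] integrable_mult_right int_ind[OF A])
    have "(\<integral>x. k x * indicator A x - 2 * L * indicator A x \<partial>\<mu>) = r A - 2 * L * measure \<mu> A"
      using k_int[OF A] int_ind[OF A] k_val[OF A] A by simp
    also have "\<dots> \<le> 0" using r2[OF A] by simp
    finally have "(\<integral>x. k x * indicator A x - 2 * L * indicator A x \<partial>\<mu>) \<le> 0" .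
    moreover have nn: "0 \<le> k x * indicator A x - 2 * L * indicator A x" for x by (simp add: A_def indicator_def)
    ultimately have "(\<integral>x. k x * indicator A x - 2 * L * indicator A x \<partial>\<mu>) = 0"
      by (intro antisym integral_nonneg_AE) auto
    then have "AE x in \<mu>. k x * indicator A x - 2 * L * indicator A x = 0"
      using integral_nonneg_eq_0_iff_AE[OF int] nn by simp
    then show ?thesis by eventually_elim (auto simp: A_def indicator_def split: if_splits)
  qed
  \<comment> \<open>The shifted density obeys the bound only almost everywhere; clamping makes
    \<open>\<bar>h x\<bar> \<le> L\<close> hold at every point.\<close>
  define h where "h = (\<lambda>x. max (-L) (min L (k x - L)))"
  have hb: "\<bar>h x\<bar> \<le> L" for x using L by (auto simp: h_def)
  have hm[measurable]: "h \<in> borel_measurable borel" unfolding h_def by measurable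
  have hk: "AE x in \<mu>. h x = k x - L" using k_le by eventually_elim (use k0 L in \<open>auto simp: h_def max_def min_def\<close>)
  have h_int: "integrable \<mu> (\<lambda>x. f x * h x)" if f: "integrable \<mu> f" for f
    by (rule integrable_bounded_mult[OF f _ hb]) simp
  have ind_val: "F (indicator A) = (\<integral>x. indicator A x * h x \<partial>\<mu>)" if A: "A \<in> sets borel" for A
  proof -
    have "(\<integral>x. indicator A x * h x \<partial>\<mu>) = (\<integral>x. k x * indicator A x - L * indicator A x \<partial>\<mu>)"
    proof (rule integral_cong_AE)
      show "AE x in \<mu>. indicator A x * h x = k x * indicator A x - L * indicator A x"
        using hk by eventually_elim (simp add: right_diff_distrib mult.commute)
    qed (use A in measurable)
    also have "\<dots> = r A - L * measure \<mu> A"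
      using k_int[OF A] int_ind[OF A] k_val[OF A] A by simp
    finally show ?thesis by (simp add: r_def)
  qed
  show ?thesis
  proof (rule that[of h, OF hm hb])
    fix f :: "'a \<Rightarrow> real" assume "integrable \<mu> f"
    then show "F f = (\<integral>x. f x * h x \<partial>\<mu>)"
    proof (induction rule: integrable_induct)
      case (base A c)
      have A: "A \<in> sets borel" using base by simp
      have "F (\<lambda>x. c * indicator A x + 0 * indicator A x) = c * F (indicator A) + 0 * F (indicator A)"
        by (rule lin[OF int_ind[OF A] int_ind[OF A]])
      also have "\<dots> = (\<integral>x. c * (indicator A x * h x) \<partial>\<mu>)"
        by (simp add: ind_val[OF A])
      finally show ?case by (simp add: mult_ac)
    next
      case (add f g)
      then show ?case using lin[of f g 1 1] h_int[of f] h_int[of g] by (simp add: distrib_right)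
    next
      case (lim f s)
      have sf: "(\<lambda>n. \<integral>x. \<bar>s n x - f x\<bar> \<partial>\<mu>) \<longlonglongrightarrow> 0"
      proof (rule L1_dominated_convergence[OF lim(1,4), where w="\<lambda>x. 2 * \<bar>f x\<bar>"])
        show "AE x in \<mu>. (\<lambda>n. s n x) \<longlonglongrightarrow> f x" using lim(2) by simp
        show "AE x in \<mu>. \<bar>s n x\<bar> \<le> 2 * \<bar>f x\<bar>" for n using lim(3) by simp
        show "integrable \<mu> (\<lambda>x. 2 * \<bar>f x\<bar>)" using lim(4) by simp
      qed
      have "(\<lambda>n. F (s n)) \<longlonglongrightarrow> F f" by (rule F_lim[OF lim(1,4) sf])
      moreover have "(\<lambda>n. \<integral>x. s n x * h x \<partial>\<mu>) \<longlonglongrightarrow> (\<integral>x. f x * h x \<partial>\<mu>)"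
      proof (rule integral_dominated_convergence[where w="\<lambda>x. 2 * \<bar>f x\<bar> * L"])
        show "AE x in \<mu>. (\<lambda>n. s n x * h x) \<longlonglongrightarrow> f x * h x"
          using lim(2) by (intro AE_I2 tendsto_mult tendsto_const) simp
        show "AE x in \<mu>. norm (s n x * h x) \<le> 2 * \<bar>f x\<bar> * L" for n
        proof (rule AE_I2)
          fix x show "norm (s n x * h x) \<le> 2 * \<bar>f x\<bar> * L"
            using mult_mono[OF lim(3)[of x n] hb[of x]] by (simp add: abs_mult)
        qed
      qed (use lim(1,4)[THEN borel_measurable_integrable] lim(4) in auto)
      ultimately show ?case using lim(5) LIMSEQ_unique by fastforce
    qed
  qed
qed


text \<open>The bound is tested on functions that approximate \<open>sgn h\<close> on a Borel set simultaneously in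
  \<open>L\<^sup>1(\<mu>)\<close> and \<open>L\<^sup>1(\<nu>)\<close>.\<close>

lemma density_le_dominating_measure:
  fixes \<mu> \<nu> :: "'a::metric_space measure"
  assumes \<mu>: "finite_borel_measure \<mu>" and \<nu>: "finite_borel_measure \<nu>"
    and h: "h \<in> borel_measurable borel" "\<And>x. \<bar>h x\<bar> \<le> L"
    and dom: "\<And>f. f \<in> LIPb \<Longrightarrow> \<bar>\<integral>x. f x * h x \<partial>\<mu>\<bar> \<le> (\<integral>x. \<bar>f x\<bar> \<partial>\<nu>)"
  shows "density \<mu> (\<lambda>x. ennreal \<bar>h x\<bar>) \<le> \<nu>"
proof -
  have sets[simp]: "sets \<mu> = sets borel" "sets \<nu> = sets borel" and fin: "finite_measure \<mu>" "finite_measure \<nu>"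
    using \<mu> \<nu> by (auto simp: finite_borel_measure_def)
  have space[simp]: "space \<mu> = UNIV" "space \<nu> = UNIV"
    using sets_eq_imp_space_eq[OF sets(1)] sets_eq_imp_space_eq[OF sets(2)] by auto
  obtain R where R: "finite_borel_measure R" "\<mu> \<le> R" "\<nu> \<le> R" using measure_sum_upper_bound[OF \<mu> \<nu>] .
  have setsR[simp]: "sets R = sets borel" and finR: "finite_measure R" using R by (auto simp: finite_borel_measure_def)
  have L: "0 \<le> L" using h(2) by (meson abs_ge_zero order_trans)
  have toM: "integrable \<mu> f" "(\<integral>x. \<bar>f x\<bar> \<partial>\<mu>) \<le> (\<integral>x. \<bar>f x\<bar> \<partial>R)"
    and toN: "integrable \<nu> f" "(\<integral>x. \<bar>f x\<bar> \<partial>\<nu>) \<le> (\<integral>x. \<bar>f x\<bar> \<partial>R)" if "integrable R f" for f :: "'a \<Rightarrow> real"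
    using integral_abs_mono_measure[OF R(2) _ that] integral_abs_mono_measure[OF R(3) _ that] by auto
  have prod_int: "integrable \<mu> (\<lambda>x. f x * h x)" "\<bar>\<integral>x. f x * h x \<partial>\<mu>\<bar> \<le> L * (\<integral>x. \<bar>f x\<bar> \<partial>\<mu>)"
    if f: "integrable \<mu> f" for f
  proof -
    have le: "\<bar>f x * h x\<bar> \<le> L * \<bar>f x\<bar>" for x
      using mult_right_mono[OF h(2)[of x] abs_ge_zero[of "f x"]] by (simp add: abs_mult mult.commute)
    have hm: "h \<in> borel_measurable \<mu>" using h(1) measurable_cong_sets[OF sets(1) refl] by blast
    show int: "integrable \<mu> (\<lambda>x. f x * h x)" by (rule integrable_bounded_mult[OF f hm h(2)])
    have "\<bar>\<integral>x. f x * h x \<partial>\<mu>\<bar> \<le> (\<integral>x. \<bar>f x * h x\<bar> \<partial>\<mu>)"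
      using integral_norm_bound[of \<mu> "\<lambda>x. f x * h x"] by simp
    also have "\<dots> \<le> (\<integral>x. L * \<bar>f x\<bar> \<partial>\<mu>)" by (rule integral_mono) (use int f le in auto)
    finally show "\<bar>\<integral>x. f x * h x \<partial>\<mu>\<bar> \<le> L * (\<integral>x. \<bar>f x\<bar> \<partial>\<mu>)" by simp
  qed
  have "emeasure (density \<mu> (\<lambda>x. ennreal \<bar>h x\<bar>)) B \<le> emeasure \<nu> B" if B: "B \<in> sets borel" for B
  proof -
    define f where "f = (\<lambda>x. indicator B x * sgn (h x))"
    have fm: "f \<in> borel_measurable borel" unfolding f_def using h(1) B by measurable
    have fint: "integrable R f"
    proof (rule finite_measure.integrable_const_bound[OF finR, where B=1])
      show "AE x in R. norm (f x) \<le> 1" by (intro AE_I2) (auto simp: f_def indicator_def sgn_if)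
      show "f \<in> borel_measurable R" using fm measurable_cong_sets[OF setsR refl] by blast
    qed
    have indint: "integrable \<nu> (indicat_real B)" by (rule finite_borel_integrable_indicator[OF \<nu> B])
    let ?I = "\<integral>x. indicator B x * \<bar>h x\<bar> \<partial>\<mu>"
    have fh: "f x * h x = indicator B x * \<bar>h x\<bar>" for x by (simp add: f_def indicator_def sgn_if)
    have "?I \<le> measure \<nu> B"
    proof (rule field_le_epsilon)
      fix e :: real assume e: "0 < e"
      \<comment> \<open>The error is paid twice: \<open>L * d\<close> for exchanging
        \<open>f\<close> and \<open>g\<close> against \<open>h\<close> under \<mu>, and
        \<open>d\<close> for the \<open>L^1\<close> norm under \<nu>.\<close>
      define d where "d = e / (L + 1)"
      have "L + 1 \<noteq> 0" using L by simp
      then have "(L + 1) * d = e" by (simp add: d_def)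
      then have d: "0 < d" "L * d + d = e" using e L by (simp add: d_def, simp add: algebra_simps)
      obtain g where g: "g \<in> LIPb" "(\<integral>x. \<bar>g x - f x\<bar> \<partial>R) < d"
        using LIPb_approx_integrable[OF R(1) fint] d(1) unfolding LIPb_approx_def by blast
      have gR: "integrable R g" by (rule LIPb_integrable[OF R(1) g(1)])
      have dR: "integrable R (\<lambda>x. g x - f x)" using gR fint by simp
      have "?I = (\<integral>x. f x * h x \<partial>\<mu>)" by (simp add: fh)
      also have "\<dots> = (\<integral>x. g x * h x - (g x - f x) * h x \<partial>\<mu>)" by (simp add: algebra_simps)
      also have "\<dots> = (\<integral>x. g x * h x \<partial>\<mu>) - (\<integral>x. (g x - f x) * h x \<partial>\<mu>)"
        by (rule Bochner_Integration.integral_diff[OF prod_int(1)[OF toM(1)[OF gR]] prod_int(1)[OF toM(1)[OF dR]]])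
      also have "\<dots> \<le> (\<integral>x. \<bar>g x\<bar> \<partial>\<nu>) + L * (\<integral>x. \<bar>g x - f x\<bar> \<partial>\<mu>)"
        using dom[OF g(1)] prod_int(2)[OF toM(1)[OF dR]] by linarith
      also have "\<dots> \<le> (\<integral>x. \<bar>g x\<bar> \<partial>\<nu>) + L * d"
        using toM(2)[OF dR] g(2) L by (intro add_left_mono mult_left_mono) auto
      also have "(\<integral>x. \<bar>g x\<bar> \<partial>\<nu>) \<le> (\<integral>x. \<bar>g x - f x\<bar> + indicator B x \<partial>\<nu>)"
      proof (rule integral_mono)
        fix x
        have "\<bar>f x\<bar> \<le> indicator B x" by (auto simp: f_def indicator_def sgn_if)
        then show "\<bar>g x\<bar> \<le> \<bar>g x - f x\<bar> + indicator B x" by linarith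
      qed (use toN(1)[OF gR] toN(1)[OF dR] indint in auto)
      also have "\<dots> = (\<integral>x. \<bar>g x - f x\<bar> \<partial>\<nu>) + measure \<nu> B"
        using toN(1)[OF dR] indint B by simp
      also have "\<dots> \<le> d + measure \<nu> B" using toN(2)[OF dR] g(2) by simp
      finally show "?I \<le> measure \<nu> B + e" using d(2) by simp
    qed
    have hI: "integrable \<mu> (\<lambda>x. indicator B x * \<bar>h x\<bar>)"
      using prod_int(1)[OF toM(1)[OF fint]] by (simp add: fh)
    have "emeasure (density \<mu> (\<lambda>x. ennreal \<bar>h x\<bar>)) B = (\<integral>\<^sup>+x. ennreal (indicator B x * \<bar>h x\<bar>) \<partial>\<mu>)"
    proof (subst emeasure_density)
      have "h \<in> borel_measurable \<mu>" using h(1) measurable_cong_sets[OF sets(1) refl] by blast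
      then show "(\<lambda>x. ennreal \<bar>h x\<bar>) \<in> borel_measurable \<mu>" by measurable
      show "B \<in> sets \<mu>" using B by simp
      show "(\<integral>\<^sup>+x. ennreal \<bar>h x\<bar> * indicator B x \<partial>\<mu>) = (\<integral>\<^sup>+x. ennreal (indicator B x * \<bar>h x\<bar>) \<partial>\<mu>)"
        by (rule nn_integral_cong) (auto simp: indicator_def)
    qed
    also have "\<dots> = ennreal ?I" by (rule nn_integral_eq_integral[OF hI]) auto
    also have "\<dots> \<le> ennreal (measure \<nu> B)" by (rule ennreal_leI) fact
    also have "\<dots> = emeasure \<nu> B" using finite_measure.emeasure_eq_measure[OF fin(2)] by simp
    finally show ?thesis .
  qed
  then have "emeasure (density \<mu> (\<lambda>x. ennreal \<bar>h x\<bar>)) B \<le> emeasure \<nu> B" for B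
    by (cases "B \<in> sets borel") (auto simp: emeasure_notin_sets)
  then show ?thesis by (simp add: le_measure_iff le_fun_def)
qed

section \<open>Mass bounds of 1-currents and the minimal one\<close>

lemma LIPs_1: "ps \<in> LIPs (Suc 0) \<longleftrightarrow> (\<exists>p\<in>LIP. ps = [p])"
  by (auto simp: LIPs_def length_Suc_conv)

lemma metric_1current_linear:
  assumes "metric_current 1 T" "p \<in> LIP"
  shows "f \<in> LIPb \<Longrightarrow> g \<in> LIPb \<Longrightarrow> T (\<lambda>x. a * f x + b * g x) [p] = a * T f [p] + b * T g [p]"
    and "f \<in> LIPb \<Longrightarrow> q \<in> LIP \<Longrightarrow> T f [\<lambda>x. a * p x + b * q x] = a * T f [p] + b * T f [q]"
proof -
  have m: "multilinear_on LIPb 1 T" using assms by (simp add: metric_current_def)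
  have p: "[p] \<in> LIPs 1" using assms by (simp add: LIPs_1)
  show "f \<in> LIPb \<Longrightarrow> g \<in> LIPb \<Longrightarrow> T (\<lambda>x. a * f x + b * g x) [p] = a * T f [p] + b * T g [p]"
    using m p unfolding multilinear_on_def by blast
  assume f: "f \<in> LIPb" and q: "q \<in> LIP"
  have "T f ([p][0 := \<lambda>x. a * p x + b * q x]) = a * T f ([p][0 := p]) + b * T f ([p][0 := q])"
    using m p f q assms(2) unfolding multilinear_on_def by (metis (no_types, lifting) less_one)
  then show "T f [\<lambda>x. a * p x + b * q x] = a * T f [p] + b * T f [q]" by simp
qed

lemma mass_bound_1:
  fixes T :: "'a::metric_space functional"
  shows "mass_bound (Suc 0) T \<mu> \<longleftrightarrow> finite_borel_measure \<mu> \<and> (\<forall>f\<in>LIPb. \<forall>p\<in>LIP. \<bar>T f [p]\<bar> \<le> Lip p * (\<integral>x. \<bar>f x\<bar> \<partial>\<mu>))"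
proof -
  have "(\<forall>ps\<in>LIPs (Suc 0). Q ps) \<longleftrightarrow> (\<forall>p\<in>LIP. Q [p])" for Q :: "('a \<Rightarrow> real) list \<Rightarrow> bool"
    by (auto simp: LIPs_1)
  then show ?thesis by (simp add: mass_bound_def)
qed

lemma mass_bound_functional:
  assumes "metric_current 1 T" "mass_bound 1 T \<mu>" "p \<in> LIP"
  shows "LIPb_functional \<mu> (Lip p) (\<lambda>f. T f [p])"
  using assms metric_1current_linear(1)[OF assms(1,3)]
  by (auto simp: LIPb_functional_def mass_bound_1 Lip_nonneg)

text \<open>The minimal measure is the supremum, in the complete lattice of measures, of the variation
  measures of the functionals \<open>f \<mapsto> T f [p]\<close> over all 1-Lipschitz \<open>p\<close>.\<close>

lemma minimal_mass_exists:
  fixes T :: "'a::metric_space functional"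
  assumes T: "metric_current 1 T"
  obtains m where "mass_bound 1 T m" "\<And>\<nu>. mass_bound 1 T \<nu> \<Longrightarrow> m \<le> \<nu>"
proof -
  obtain \<mu> where \<mu>: "mass_bound 1 T \<mu>" using T by (auto simp: metric_current_def)
  then have fb: "finite_borel_measure \<mu>" by (simp add: mass_bound_1)
  then have sets[simp]: "sets \<mu> = sets borel" by (simp add: finite_borel_measure_def)
  have "\<exists>h. h \<in> borel_measurable borel \<and> (\<forall>x. \<bar>h x\<bar> \<le> Lip p) \<and> (\<forall>f\<in>LIPb. T f [p] = (\<integral>x. f x * h x \<partial>\<mu>))"
    if p: "p \<in> LIP" for p
  proof -
    note \<Lambda> = mass_bound_functional[OF T \<mu> p]
    obtain h where "h \<in> borel_measurable borel" "\<And>x. \<bar>h x\<bar> \<le> Lip p"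
        "\<And>f. integrable \<mu> f \<Longrightarrow> L1_lim \<mu> (\<lambda>f. T f [p]) f = (\<integral>x. f x * h x \<partial>\<mu>)"
      using L1_functional_density[OF fb Lip_nonneg[OF p] L1_lim_linear[OF \<Lambda>] L1_lim_bound[OF \<Lambda>]] by blast
    then show ?thesis using L1_lim_extends[OF \<Lambda>] LIPb_integrable[OF fb] by metis
  qed
  then obtain h where h: "\<And>p. p \<in> LIP \<Longrightarrow> h p \<in> borel_measurable borel"
      "\<And>p x. p \<in> LIP \<Longrightarrow> \<bar>h p x\<bar> \<le> Lip p"
      "\<And>p f. p \<in> LIP \<Longrightarrow> f \<in> LIPb \<Longrightarrow> T f [p] = (\<integral>x. f x * h p x \<partial>\<mu>)"
    by metis
  define P where "P = {p :: 'a \<Rightarrow> real. p \<in> LIP \<and> Lip p \<le> 1}"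
  define lam where "lam = (\<lambda>p. density \<mu> (\<lambda>x. ennreal \<bar>h p x\<bar>))"
  define m where "m = (SUP p\<in>P. lam p)"
  have le: "lam p \<le> \<nu>" if "p \<in> P" "mass_bound 1 T \<nu>" for p \<nu>
    unfolding lam_def
  proof (rule density_le_dominating_measure[OF fb])
    have p: "p \<in> LIP" "Lip p \<le> 1" using that by (auto simp: P_def)
    show "\<bar>h p x\<bar> \<le> Lip p" for x by (rule h[OF p(1)])
    show "\<bar>\<integral>x. f x * h p x \<partial>\<mu>\<bar> \<le> (\<integral>x. \<bar>f x\<bar> \<partial>\<nu>)" if f: "f \<in> LIPb" for f
    proof -
      have "\<bar>T f [p]\<bar> \<le> Lip p * (\<integral>x. \<bar>f x\<bar> \<partial>\<nu>)" using \<open>mass_bound 1 T \<nu>\<close> f p by (simp add: mass_bound_1)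
      also have "\<dots> \<le> 1 * (\<integral>x. \<bar>f x\<bar> \<partial>\<nu>)" using p by (intro mult_right_mono integral_nonneg_AE) auto
      finally show ?thesis using h(3)[OF p(1) f] by simp
    qed
  qed (use that h in \<open>auto simp: mass_bound_1 P_def\<close>)
  have m_le: "m \<le> \<nu>" if "mass_bound 1 T \<nu>" for \<nu>
    unfolding m_def by (rule SUP_least) (rule le[OF _ that])
  \<comment> \<open>The family is nonempty, so the supremum lies above a measure with the Borel
    sets.\<close>
  have c0: "(\<lambda>_. 0) \<in> P" by (auto simp: P_def LIP_const intro: order_trans[OF Lip_leI[of 0]])
  have m_ge: "lam p \<le> m" if "p \<in> P" for p unfolding m_def by (rule SUP_upper[OF that])
  have sets_l: "sets (lam p) = sets borel" for p by (simp add: lam_def)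
  \<comment> \<open>The order on measures is lexicographic in space, \<sigma>-algebra and values.
    Being squeezed between \<open>lam (\<lambda>_. 0)\<close> and \<mu>, which agree in the first
    two, fixes both for \<open>m\<close>.\<close>
  have setsm: "sets m = sets borel"
  proof -
    have sp: "space (lam (\<lambda>_. 0)) = space \<mu>" by (simp add: lam_def)
    have spm: "space m = space \<mu>"
      using le_measureD1[OF m_ge[OF c0]] le_measureD1[OF m_le[OF \<mu>]] sp by auto
    show ?thesis
      using le_measureD2[OF m_ge[OF c0]] le_measureD2[OF m_le[OF \<mu>]] sp spm sets_l[of "\<lambda>_. 0"] sets by auto
  qed
  have "emeasure m UNIV \<le> emeasure \<mu> UNIV" by (rule le_measureD3[OF m_le[OF \<mu>]]) (simp add: setsm)
  moreover have "emeasure \<mu> UNIV \<noteq> \<infinity>" using fb finite_measure.emeasure_finite[of \<mu> UNIV] by (auto simp: finite_borel_measure_def)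
  ultimately have fm: "finite_borel_measure m"
    using sets_eq_imp_space_eq[OF setsm]
    by (auto simp: finite_borel_measure_def setsm top_unique intro!: finite_measureI)
  have "mass_bound 1 T m"
    unfolding One_nat_def mass_bound_1
  proof (intro conjI fm ballI)
    fix f p :: "'a \<Rightarrow> real" assume f: "f \<in> LIPb" and p: "p \<in> LIP"
    show "\<bar>T f [p]\<bar> \<le> Lip p * (\<integral>x. \<bar>f x\<bar> \<partial>m)"
    proof (cases "Lip p = 0")
      \<comment> \<open>Normalisation to Lipschitz constant at most 1 is impossible here, but the
        bound by the given \<mu> already makes the value 0.\<close>
      case True
      have "\<bar>T f [p]\<bar> \<le> Lip p * (\<integral>x. \<bar>f x\<bar> \<partial>\<mu>)" using \<mu> f p by (simp add: mass_bound_1)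
      then show ?thesis using True by simp
    next
      case False
      then have pos: "0 < Lip p" using Lip_nonneg[OF p] by simp
      define q where "q = (\<lambda>x. (1 / Lip p) * p x + 0 * p x)"
      have qL: "q \<in> LIP" unfolding q_def by (rule Lip_lincomb[OF p p])
      have "Lip q \<le> 1" using Lip_lincomb(2)[OF p p, of "1 / Lip p" 0] pos by (simp add: q_def)
      then have q: "q \<in> P" using qL by (simp add: P_def)
      have "T f [q] = (1 / Lip p) * T f [p]"
        using metric_1current_linear(2)[OF T p f p, of "1 / Lip p" 0] by (simp add: q_def)
      then have "\<bar>T f [p]\<bar> = Lip p * \<bar>T f [q]\<bar>" using pos by (simp add: abs_mult)
      moreover have "\<bar>T f [q]\<bar> \<le> (\<integral>x. \<bar>f x\<bar> \<partial>m)"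
      proof -
        have hm: "h q \<in> borel_measurable \<mu>" and fmm: "f \<in> borel_measurable \<mu>"
          using h(1)[OF qL] LIP_measurable[OF LIPbD[OF f]] measurable_cong_sets[OF sets refl] by auto
        have "\<bar>T f [q]\<bar> \<le> (\<integral>x. \<bar>f x * h q x\<bar> \<partial>\<mu>)"
          using integral_norm_bound[of \<mu> "\<lambda>x. f x * h q x"] by (simp add: h(3)[OF qL f])
        also have "\<dots> = (\<integral>x. \<bar>f x\<bar> \<partial>lam q)"
          unfolding lam_def using hm fmm by (subst integral_density) (auto simp: abs_mult mult.commute)
        also have "\<dots> \<le> (\<integral>x. \<bar>f x\<bar> \<partial>m)"
          by (rule integral_abs_mono_measure(2)[OF m_ge[OF q] _ LIPb_integrable[OF fm f]]) (simp add: sets_l setsm)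
        finally show ?thesis .
      qed
      ultimately show ?thesis using pos by (simp add: mult_left_mono)
    qed
  qed
  then show ?thesis using m_le by (rule that)
qed

section \<open>The definite descriptions of mass measure and extension\<close>

definition mass1 :: "'a::metric_space functional \<Rightarrow> 'a measure" where
  "mass1 T = mass_measure 1 T"

definition extend1 :: "'a::metric_space functional \<Rightarrow> ('a \<Rightarrow> real) \<Rightarrow> ('a \<Rightarrow> real) \<Rightarrow> real" where
  "extend1 T f p = L1_extension 1 T f [p]"

lemma LIMSEQ_lower_bound:
  fixes X :: "nat \<Rightarrow> real"
  shows "(\<And>n. c \<le> X n) \<Longrightarrow> X \<longlonglongrightarrow> L \<Longrightarrow> c \<le> L"
  by (rule LIMSEQ_le_const) auto

text \<open>A minimal mass bound exists, and two minimal ones dominate each other on every Borel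
  set, so the description picks it out.\<close>

lemma mass1_bound:
  assumes T: "metric_current 1 T"
  shows "mass_bound 1 T (mass1 T)"
proof -
  obtain m where m: "mass_bound 1 T m" "\<And>\<nu>. mass_bound 1 T \<nu> \<Longrightarrow> m \<le> \<nu>"
    using minimal_mass_exists[OF T] by blast
  let ?P = "\<lambda>\<mu>. mass_bound 1 T \<mu> \<and> (\<forall>\<nu>. mass_bound 1 T \<nu> \<longrightarrow> (\<forall>A\<in>sets borel. emeasure \<mu> A \<le> emeasure \<nu> A))"
  have sets: "sets \<nu> = sets borel" if "mass_bound 1 T \<nu>" for \<nu>
    using that by (simp add: mass_bound_def finite_borel_measure_def)
  have "?P m" using m sets le_measureD3 by metis
  moreover have "\<mu> = m" if "?P \<mu>" for \<mu>
  proof (rule measure_eqI)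
    show "sets \<mu> = sets m" using sets that m by blast
    fix A assume "A \<in> sets \<mu>"
    then have "A \<in> sets borel" using sets that by blast
    then show "emeasure \<mu> A = emeasure m A" using that \<open>?P m\<close> by (meson order_antisym)
  qed
  ultimately have "?P (mass_measure 1 T)" unfolding mass_measure_def by (rule theI)
  then show ?thesis by (simp add: mass1_def)
qed

lemma mass1_finite_borel: "metric_current 1 T \<Longrightarrow> finite_borel_measure (mass1 T)"
  using mass1_bound by (auto simp: mass_bound_def)

text \<open>\<open>L1_lim\<close> in each admissible second argument gives an extension. Two
  extensions agree on \<open>LIPb\<close>, and both are continuous in \<open>L^1\<close>, where
  \<open>LIPb\<close> is dense; hence the description has a unique solution.\<close>

lemma L1_extension_spec:
  fixes T :: "'a::metric_space functional"
  assumes T: "metric_current 1 T"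
  shows "is_L1_extension 1 T (L1_extension 1 T)"
proof -
  let ?\<mu> = "mass_measure 1 T"
  have mb: "mass_bound 1 T ?\<mu>" using mass1_bound[OF T] by (simp add: mass1_def)
  have fb: "finite_borel_measure ?\<mu>" using mb by (simp add: mass_bound_def)
  have func: "LIPb_functional ?\<mu> (Lip p) (\<lambda>f. T f [p])" if "p \<in> LIP" for p
    by (rule mass_bound_functional[OF T mb that])
  have LIPs: "ps \<in> LIPs 1 \<longleftrightarrow> (\<exists>p\<in>LIP. ps = [p])" for ps :: "('a \<Rightarrow> real) list" by (simp add: LIPs_1)
  let ?Q = "\<lambda>S. is_L1_extension 1 T S \<and> (\<forall>f ps. \<not> (integrable ?\<mu> f \<and> ps \<in> LIPs 1) \<longrightarrow> S f ps = 0)"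
  define S where "S = (\<lambda>f ps. if integrable ?\<mu> f \<and> ps \<in> LIPs 1 then L1_lim ?\<mu> (\<lambda>f. T f ps) f else 0)"
  have S: "S f [p] = L1_lim ?\<mu> (\<lambda>f. T f [p]) f" if "integrable ?\<mu> f" "p \<in> LIP" for f p
    unfolding S_def LIPs by (rule if_P) (use that in blast)
  have "functional_eq 1 S T"
    unfolding functional_eq_def
  proof (intro ballI)
    fix f :: "'a \<Rightarrow> real" and ps :: "('a \<Rightarrow> real) list" assume f: "f \<in> LIPb" and "ps \<in> LIPs 1"
    then obtain p where p: "p \<in> LIP" "ps = [p]" using LIPs by blast
    show "S f ps = T f ps"
      using S[OF LIPb_integrable[OF fb f] p(1)] L1_lim_extends[OF func[OF p(1)] f] p by simp
  qed
  moreover have "multilinear_on {f. integrable ?\<mu> f} 1 S"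
    unfolding multilinear_on_def
  proof (intro conjI ballI allI impI)
    fix f g :: "'a \<Rightarrow> real" and ps :: "('a \<Rightarrow> real) list" and a b :: real assume fg: "f \<in> {f. integrable ?\<mu> f}" "g \<in> {f. integrable ?\<mu> f}" and "ps \<in> LIPs 1"
    then obtain p where p: "p \<in> LIP" "ps = [p]" using LIPs by blast
    have "integrable ?\<mu> (\<lambda>x. a * f x + b * g x)" using fg by simp
    then show "S (\<lambda>x. a * f x + b * g x) ps = a * S f ps + b * S g ps"
      using fg L1_lim_linear[OF func[OF p(1)]] p by (simp add: S)
  next
    fix f p q :: "'a \<Rightarrow> real" and ps :: "('a \<Rightarrow> real) list" and i :: nat and a b :: real
    assume f: "f \<in> {f. integrable ?\<mu> f}" and "ps \<in> LIPs 1" "i < (1::nat)" and p: "p \<in> LIP" and q: "q \<in> LIP"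
    then obtain r where r: "ps = [r]" and i: "i = 0" using LIPs less_one by blast
    have f: "integrable ?\<mu> f" using f by simp
    let ?s = "LIPb_seq ?\<mu> f"
    \<comment> \<open>One sequence approximates \<open>f\<close> for all second arguments, so
      linearity of \<open>T\<close> in that slot passes to the limit.\<close>
    have lim: "(\<lambda>n. T (?s n) [w]) \<longlonglongrightarrow> S f [w]" if "w \<in> LIP" for w
      unfolding S[OF f that] by (rule L1_lim_tendsto[OF func[OF that] f LIPb_seq(1)[OF fb f] LIPb_seq(3)[OF fb f]])
    have eq: "T (?s n) [\<lambda>x. a * p x + b * q x] = a * T (?s n) [p] + b * T (?s n) [q]" for n
      by (rule metric_1current_linear(2)[OF T p LIPb_seq(1)[OF fb f] q])
    have "(\<lambda>n. T (?s n) [\<lambda>x. a * p x + b * q x]) \<longlonglongrightarrow> a * S f [p] + b * S f [q]"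
      unfolding eq by (intro tendsto_intros lim p q)
    then have "S f [\<lambda>x. a * p x + b * q x] = a * S f [p] + b * S f [q]"
      using lim[OF Lip_lincomb(1)[OF p q]] LIMSEQ_unique by blast
    then show "S f (ps[i := \<lambda>x. a * p x + b * q x]) = a * S f (ps[i := p]) + b * S f (ps[i := q])"
      by (simp add: r i)
  qed
  moreover have "\<bar>S f ps\<bar> \<le> prod_list (map Lip ps) * (\<integral>x. \<bar>f x\<bar> \<partial>?\<mu>)"
    if f: "integrable ?\<mu> f" and ps: "ps \<in> LIPs 1" for f ps
  proof -
    obtain p where p: "p \<in> LIP" "ps = [p]" using LIPs ps by blast
    show ?thesis using L1_lim_bound[OF func[OF p(1)] f] by (simp only: p(2) S[OF f p(1)]) simp
  qed
  ultimately have "is_L1_extension 1 T S" unfolding is_L1_extension_def by blast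
  moreover have "S f ps = 0" if "\<not> (integrable ?\<mu> f \<and> ps \<in> LIPs 1)" for f ps
    unfolding S_def using that by (rule if_not_P)
  ultimately have QS: "?Q S" by blast
  have uniq: "S' = S" if Q': "?Q S'" for S'
  proof (intro ext)
    fix f ps
    show "S' f ps = S f ps"
    proof (cases "integrable ?\<mu> f \<and> ps \<in> LIPs 1")
      case False then show ?thesis using QS Q' by metis
    next
      case True
      then have f: "integrable ?\<mu> f" and ps: "ps \<in> LIPs 1" by auto
      define K where "K = prod_list (map Lip ps)"
      have dist: "\<bar>R g ps - R f ps\<bar> \<le> K * (\<integral>x. \<bar>g x - f x\<bar> \<partial>?\<mu>)" if R: "?Q R" and g: "integrable ?\<mu> g" for R g
      proof -
        have "R (\<lambda>x. 1 * g x + (-1) * f x) ps = 1 * R g ps + (-1) * R f ps"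
          using R f g ps unfolding is_L1_extension_def multilinear_on_def by blast
        moreover have "integrable ?\<mu> (\<lambda>x. 1 * g x + (-1) * f x)" using f g by simp
        then have "\<bar>R (\<lambda>x. 1 * g x + (-1) * f x) ps\<bar> \<le> K * (\<integral>x. \<bar>1 * g x + (-1) * f x\<bar> \<partial>?\<mu>)"
          using R ps unfolding is_L1_extension_def K_def by blast
        ultimately show ?thesis by simp
      qed
      let ?s = "LIPb_seq ?\<mu> f"
      have "\<bar>S' f ps - S f ps\<bar> \<le> 2 * (K * (\<integral>x. \<bar>?s n x - f x\<bar> \<partial>?\<mu>))" for n
      proof -
        have sn: "?s n \<in> LIPb" by (rule LIPb_seq(1)[OF fb f])
        have "S' (?s n) ps = T (?s n) ps" "S (?s n) ps = T (?s n) ps"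
          using Q' QS sn ps unfolding is_L1_extension_def functional_eq_def by blast+
        then show ?thesis using dist[OF Q' LIPb_integrable[OF fb sn]] dist[OF QS LIPb_integrable[OF fb sn]] by linarith
      qed
      moreover have "(\<lambda>n. 2 * (K * (\<integral>x. \<bar>?s n x - f x\<bar> \<partial>?\<mu>))) \<longlonglongrightarrow> 2 * (K * 0)"
        by (intro tendsto_intros LIPb_seq[OF fb f])
      ultimately have "\<bar>S' f ps - S f ps\<bar> \<le> 2 * (K * 0)" by (rule LIMSEQ_lower_bound)
      then show ?thesis by simp
    qed
  qed
  have "?Q (L1_extension 1 T)" unfolding L1_extension_def by (rule theI[of ?Q, OF QS uniq])
  then show ?thesis by blast
qed

lemma extend1_eq: "metric_current 1 T \<Longrightarrow> f \<in> LIPb \<Longrightarrow> p \<in> LIP \<Longrightarrow> extend1 T f p = T f [p]"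
  using L1_extension_spec[of T] by (simp add: extend1_def is_L1_extension_def functional_eq_def LIPs_1)

lemma extend1_linear:
  assumes T: "metric_current 1 T" and p: "p \<in> LIP" and f: "integrable (mass1 T) f"
  shows "integrable (mass1 T) g \<Longrightarrow> extend1 T (\<lambda>x. a * f x + b * g x) p = a * extend1 T f p + b * extend1 T g p"
    and "q \<in> LIP \<Longrightarrow> extend1 T f (\<lambda>x. a * p x + b * q x) = a * extend1 T f p + b * extend1 T f q"
proof -
  have m: "multilinear_on {f. integrable (mass1 T) f} 1 (L1_extension 1 T)"
    using L1_extension_spec[OF T] by (simp add: is_L1_extension_def mass1_def)
  have p1: "[p] \<in> LIPs 1" using p by (simp add: LIPs_1)
  show "integrable (mass1 T) g \<Longrightarrow> extend1 T (\<lambda>x. a * f x + b * g x) p = a * extend1 T f p + b * extend1 T g p"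
    using m p1 f unfolding multilinear_on_def extend1_def by blast
  assume q: "q \<in> LIP"
  have "\<forall>f\<in>{f. integrable (mass1 T) f}. \<forall>ps\<in>LIPs 1. \<forall>i<1. \<forall>p\<in>LIP. \<forall>q\<in>LIP. \<forall>a b.
        L1_extension 1 T f (ps[i := \<lambda>x. a * p x + b * q x]) = a * L1_extension 1 T f (ps[i := p]) + b * L1_extension 1 T f (ps[i := q])"
    using m unfolding multilinear_on_def by (rule conjunct2)
  then have "L1_extension 1 T f ([p][0 := \<lambda>x. a * p x + b * q x]) = a * L1_extension 1 T f ([p][0 := p]) + b * L1_extension 1 T f ([p][0 := q])"
    using p1 f q p by blast
  then show "extend1 T f (\<lambda>x. a * p x + b * q x) = a * extend1 T f p + b * extend1 T f q" by (simp add: extend1_def)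
qed

lemma extend1_bound:
  assumes "metric_current 1 T" "p \<in> LIP" "integrable (mass1 T) f"
  shows "\<bar>extend1 T f p\<bar> \<le> Lip p * (\<integral>x. \<bar>f x\<bar> \<partial>mass1 T)"
proof -
  have "[p] \<in> LIPs 1" using assms by (simp add: LIPs_1)
  then have "\<bar>L1_extension 1 T f [p]\<bar> \<le> prod_list (map Lip [p]) * (\<integral>x. \<bar>f x\<bar> \<partial>mass_measure 1 T)"
    using L1_extension_spec[OF assms(1)] assms(3) unfolding is_L1_extension_def mass1_def by blast
  then show ?thesis by (simp add: extend1_def mass1_def)
qed

lemma extend1_dist:
  assumes T: "metric_current 1 T" and p: "p \<in> LIP" and f: "integrable (mass1 T) f" "integrable (mass1 T) g"
  shows "\<bar>extend1 T f p - extend1 T g p\<bar> \<le> Lip p * (\<integral>x. \<bar>f x - g x\<bar> \<partial>mass1 T)"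
  by (rule L1_functional_diff[OF _ _ f]) (fact extend1_linear(1)[OF T p] extend1_bound[OF T p])+

lemma extend1_lim:
  assumes T: "metric_current 1 T" and p: "p \<in> LIP" and s: "\<And>n. integrable (mass1 T) (s n)" and f: "integrable (mass1 T) f"
    and lim: "(\<lambda>n. \<integral>x. \<bar>s n x - f x\<bar> \<partial>mass1 T) \<longlonglongrightarrow> 0"
  shows "(\<lambda>n. extend1 T (s n) p) \<longlonglongrightarrow> extend1 T f p"
  by (rule L1_functional_lim[OF _ _ s f lim]) (fact extend1_linear(1)[OF T p] extend1_bound[OF T p])+

section \<open>Continuity and locality of the extension\<close>

lemma metric_1current_local:
  assumes T: "metric_current 1 T" and f: "f \<in> LIPb" and p: "p \<in> LIP"
    and "open U" "{x. f x \<noteq> 0} \<subseteq> U" "\<And>x. x \<in> U \<Longrightarrow> p x = c"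
  shows "T f [p] = 0"
proof -
  have ps: "[p] \<in> LIPs 1" using p by (simp add: LIPs_1)
  have "\<exists>i<1. \<exists>U c. open U \<and> {x. f x \<noteq> 0} \<subseteq> U \<and> (\<forall>x\<in>U. ([p] ! i) x = c)"
    by (rule exI[of _ 0]) (use assms in auto)
  then show ?thesis using T f ps unfolding metric_current_def by blast
qed

lemma metric_1current_continuous:
  assumes T: "metric_current 1 T" and f: "f \<in> LIPb" and p: "p \<in> LIP" and q: "\<And>n. q n \<in> LIP" "\<And>n. Lip (q n) \<le> B"
    and lim: "\<And>x. (\<lambda>n. q n x) \<longlonglongrightarrow> p x"
  shows "(\<lambda>n. T f [q n]) \<longlonglongrightarrow> T f [p]"
proof -
  have cont: "\<forall>f\<in>LIPb. \<forall>ps\<in>LIPs 1. \<forall>pn.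
        (\<forall>n. pn n \<in> LIPs 1) \<and>
        (\<forall>i<1. \<forall>x. (\<lambda>n. (pn n ! i) x) \<longlonglongrightarrow> (ps ! i) x) \<and>
        (\<forall>i<1. bdd_above (range (\<lambda>n. Lip (pn n ! i))))
        \<longrightarrow> (\<lambda>n. T f (pn n)) \<longlonglongrightarrow> T f ps"
    using T unfolding metric_current_def by blast
  have 1: "\<forall>n. [q n] \<in> LIPs 1" and 2: "[p] \<in> LIPs 1" using p q by (simp_all add: LIPs_1)
  have 3: "\<forall>i<(1::nat). \<forall>x. (\<lambda>n. ([q n] ! i) x) \<longlonglongrightarrow> ([p] ! i) x" using lim by simp
  have "bdd_above (range (\<lambda>n. Lip (q n)))" by (rule bdd_aboveI[of _ B]) (use q in auto)
  then have 4: "\<forall>i<(1::nat). bdd_above (range (\<lambda>n. Lip ([q n] ! i)))" by simp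
  show ?thesis
    using cont[rule_format, OF f 2, of "\<lambda>n. [q n]"] 1 3 4 by blast
qed

text \<open>Flattening \<open>p\<close> near its level \<open>c\<close> makes it constant on a neighbourhood of \<open>{p = c}\<close>, so that
  the locality axiom applies after a cut-off; the flattening is then undone by continuity.\<close>

lemma extend1_local:
  fixes T :: "'a::metric_space functional"
  assumes T: "metric_current 1 T" and p: "p \<in> LIP" and f: "integrable (mass1 T) f"
    and ae: "AE x in mass1 T. f x \<noteq> 0 \<longrightarrow> p x = c"
  shows "extend1 T f p = 0"
proof -
  let ?\<mu> = "mass1 T"
  have fb: "finite_borel_measure ?\<mu>" by (rule mass1_finite_borel[OF T])
  define \<epsilon> where "\<epsilon> = (\<lambda>k::nat. inverse (real (Suc k)))"
  have \<epsilon>: "0 < \<epsilon> k" for k by (simp add: \<epsilon>_def)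
  \<comment> \<open>Soft thresholding of \<open>p\<close> around \<open>c\<close>: the value is
    \<open>c\<close> where \<open>\<bar>p x - c\<bar> \<le> \<epsilon> k\<close>, and elsewhere
    \<open>p x\<close> is moved towards \<open>c\<close> by \<open>\<epsilon> k\<close>. As a
    function of \<open>p\<close> this is 1-Lipschitz, so the constants stay below
    \<open>Lip p\<close>.\<close>
  define q where "q = (\<lambda>k x. c + max (p x - c - \<epsilon> k) 0 + min (p x - c + \<epsilon> k) 0)"
  have q_diff: "\<bar>q k x - q k y\<bar> \<le> \<bar>p x - p y\<bar>" for k x y
    using \<epsilon>[of k] unfolding q_def by (auto simp: max_def min_def)
  have q_lip: "\<bar>q k x - q k y\<bar> \<le> Lip p * dist x y" for k x y
    using q_diff Lip_bound[OF p] order_trans by blast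
  have q: "q k \<in> LIP" "Lip (q k) \<le> Lip p" for k
    using LIP_I[OF Lip_nonneg[OF p] q_lip] Lip_leI[OF Lip_nonneg[OF p] q_lip] by auto
  have q_lim: "(\<lambda>k. q k x) \<longlonglongrightarrow> p x" for x
  proof -
    have near: "norm (q k x - p x) \<le> \<epsilon> k" for k
      using \<epsilon>[of k] unfolding q_def by (auto simp: max_def min_def)
    have "\<epsilon> \<longlonglongrightarrow> 0" unfolding \<epsilon>_def by (rule LIMSEQ_inverse_real_of_nat)
    then have "(\<lambda>k. q k x - p x) \<longlonglongrightarrow> 0" by (rule Lim_null_comparison[OF always_eventually, rotated]) (intro allI near)
    then show ?thesis by (simp add: LIM_zero_iff)
  qed
  let ?s = "LIPb_seq ?\<mu> f"
  have s: "?s n \<in> LIPb" for n by (rule LIPb_seq(1)[OF fb f])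
  have sint: "integrable ?\<mu> (?s n)" for n by (rule LIPb_integrable[OF fb s])
  have zero: "extend1 T f (q k) = 0" for k
  proof -
    \<comment> \<open>The \<open>max\<close> is \<open>\<bar>p x - c\<bar>\<close>. Thus
      \<open>\<eta>\<close> is 1 on the level set, where \<open>f\<close> lives, and vanishes at
      distance \<open>\<epsilon> k / 2\<close> from the level, well inside the open set on which
      \<open>q k\<close> is constant.\<close>
    define \<eta> where "\<eta> = (\<lambda>x. max 0 (1 - 2 / \<epsilon> k * max (p x - c) (c - p x)))"
    have \<eta>b: "0 \<le> \<eta> x" "\<eta> x \<le> 1" for x using \<epsilon>[of k] by (auto simp: \<eta>_def max_def zero_le_divide_iff mult_nonneg_nonneg)
    have \<eta>L: "\<eta> \<in> LIPb"
    proof (rule LIPbI[of _ 1])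
      show "\<eta> \<in> LIP" unfolding \<eta>_def by (intro LIP_max LIP_const LIP_diff LIP_cmult p)
      show "\<bar>\<eta> x\<bar> \<le> 1" for x using \<eta>b[of x] by simp
    qed
    have g: "(\<lambda>x. ?s n x * \<eta> x) \<in> LIPb" for n by (rule LIPb_mult[OF s \<eta>L])
    have gint: "integrable ?\<mu> (\<lambda>x. ?s n x * \<eta> x)" for n by (rule LIPb_integrable[OF fb g])
    have T0: "extend1 T (\<lambda>x. ?s n x * \<eta> x) (q k) = 0" for n
    proof (subst extend1_eq[OF T g q(1)], rule metric_1current_local[OF T g q(1)])
      show "open {x. \<bar>p x - c\<bar> < \<epsilon> k}"
        by (intro open_Collect_less continuous_intros LIP_continuous[OF p])
      show "{x. ?s n x * \<eta> x \<noteq> 0} \<subseteq> {x. \<bar>p x - c\<bar> < \<epsilon> k}"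
      proof
        fix x assume "x \<in> {x. ?s n x * \<eta> x \<noteq> 0}"
        then have "\<eta> x \<noteq> 0" by auto
        moreover have "z < 1" if "max 0 (1 - z) \<noteq> 0" for z :: real using that by (auto simp: max_def split: if_splits)
        ultimately have "2 / \<epsilon> k * max (p x - c) (c - p x) < 1" unfolding \<eta>_def by blast
        then have "2 * max (p x - c) (c - p x) < \<epsilon> k" using \<epsilon>[of k] by (simp add: field_simps)
        then show "x \<in> {x. \<bar>p x - c\<bar> < \<epsilon> k}" using \<epsilon>[of k] by (auto simp: max_def abs_real_def split: if_splits)
      qed
      show "q k x = c" if "x \<in> {x. \<bar>p x - c\<bar> < \<epsilon> k}" for x
        using that unfolding q_def by auto
    qed
    have 0: "(\<lambda>n. \<integral>x. \<bar>?s n x * \<eta> x - f x\<bar> \<partial>?\<mu>) \<longlonglongrightarrow> 0"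
    proof (rule Lim_null_comparison[OF always_eventually LIPb_seq(3)[OF fb f]], rule allI)
      fix n
      have "(\<integral>x. \<bar>?s n x * \<eta> x - f x\<bar> \<partial>?\<mu>) \<le> (\<integral>x. \<bar>?s n x - f x\<bar> \<partial>?\<mu>)"
      proof (rule integral_mono_AE)
        show "AE x in ?\<mu>. \<bar>?s n x * \<eta> x - f x\<bar> \<le> \<bar>?s n x - f x\<bar>"
          using ae
        proof eventually_elim
          case (elim x)
          show ?case
          proof (cases "f x = 0")
            case True
            have "\<bar>?s n x\<bar> * \<bar>\<eta> x\<bar> \<le> \<bar>?s n x\<bar> * 1" by (rule mult_left_mono) (use \<eta>b[of x] in auto)
            then show ?thesis using True by (simp add: abs_mult)
          next
            case False then show ?thesis using elim by (simp add: \<eta>_def)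
          qed
        qed
      qed (use gint sint f in auto)
      then show "norm (\<integral>x. \<bar>?s n x * \<eta> x - f x\<bar> \<partial>?\<mu>) \<le> (\<integral>x. \<bar>?s n x - f x\<bar> \<partial>?\<mu>)"
        by (simp add: integral_nonneg_AE)
    qed
    show ?thesis
      using extend1_lim[OF T q(1)[of k] gint f 0] by (simp add: T0 LIMSEQ_const_iff)
  qed
  \<comment> \<open>Two errors of size \<open>Lip p\<close> times the \<open>L^1\<close> distance
    arise from exchanging \<open>f\<close> with its approximation, once against \<open>p\<close> and
    once against \<open>q k\<close>. The error between \<open>p\<close> and \<open>q k\<close> needs
    a Lipschitz first argument and vanishes as \<open>k\<close> grows.\<close>
  have "\<bar>extend1 T f p\<bar> \<le> 2 * (Lip p * (\<integral>x. \<bar>?s n x - f x\<bar> \<partial>?\<mu>))" for n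
  proof -
    have "(\<lambda>k. \<bar>extend1 T (?s n) p - T (?s n) [q k]\<bar> + 2 * (Lip p * (\<integral>x. \<bar>?s n x - f x\<bar> \<partial>?\<mu>)))
        \<longlonglongrightarrow> \<bar>extend1 T (?s n) p - T (?s n) [p]\<bar> + 2 * (Lip p * (\<integral>x. \<bar>?s n x - f x\<bar> \<partial>?\<mu>))"
      by (intro tendsto_intros metric_1current_continuous[OF T s p q q_lim])
    then have lim: "(\<lambda>k. \<bar>extend1 T (?s n) p - T (?s n) [q k]\<bar> + 2 * (Lip p * (\<integral>x. \<bar>?s n x - f x\<bar> \<partial>?\<mu>)))
        \<longlonglongrightarrow> 2 * (Lip p * (\<integral>x. \<bar>?s n x - f x\<bar> \<partial>?\<mu>))"
      by (simp add: extend1_eq[OF T s p])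
    have "\<bar>extend1 T f p\<bar> \<le> \<bar>extend1 T (?s n) p - T (?s n) [q k]\<bar> + 2 * (Lip p * (\<integral>x. \<bar>?s n x - f x\<bar> \<partial>?\<mu>))" for k
    proof -
      have "Lip (q k) * (\<integral>x. \<bar>?s n x - f x\<bar> \<partial>?\<mu>) \<le> Lip p * (\<integral>x. \<bar>?s n x - f x\<bar> \<partial>?\<mu>)"
        by (intro mult_right_mono q integral_nonneg_AE) auto
      then show ?thesis
        using extend1_dist[OF T p sint f, of n] extend1_dist[OF T q(1) sint f, of n k] zero[of k]
          extend1_eq[OF T s q(1), of n k] by linarith
    qed
    then show ?thesis by (rule LIMSEQ_lower_bound[OF _ lim])
  qed
  moreover have "(\<lambda>n. 2 * (Lip p * (\<integral>x. \<bar>?s n x - f x\<bar> \<partial>?\<mu>))) \<longlonglongrightarrow> 2 * (Lip p * 0)"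
    by (intro tendsto_intros LIPb_seq[OF fb f])
  ultimately have "\<bar>extend1 T f p\<bar> \<le> 2 * (Lip p * 0)" by (rule LIMSEQ_lower_bound)
  then show ?thesis by simp
qed

section \<open>Consequences of rectifiability\<close>

text \<open>Without any admissible covering the infimum would be that of the empty set, which is
  \<open>top\<close>.\<close>

lemma hausdorff1_null_cover:
  fixes A :: "'a::metric_space set"
  assumes "hausdorff1 A = 0" "0 < \<delta>"
  obtains C :: "nat \<Rightarrow> 'a set" where "A \<subseteq> (\<Union>i. C i)" "\<And>i. bounded (C i)" "\<And>i. diameter (C i) \<le> \<delta>"
proof -
  have "hausdorff1_delta \<delta> A \<le> hausdorff1 A"
    unfolding hausdorff1_def by (rule SUP_upper) (use assms in auto)
  then have "hausdorff1_delta \<delta> A < top" using assms(1) by simp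
  then have "{C :: nat \<Rightarrow> 'a set. A \<subseteq> (\<Union>i. C i) \<and> (\<forall>i. bounded (C i) \<and> diameter (C i) \<le> \<delta>)} \<noteq> {}"
    unfolding hausdorff1_delta_def by (metis INF_empty less_irrefl)
  then show ?thesis using that by blast
qed

lemma hausdorff1_singleton: "hausdorff1 {x} = 0"
proof -
  have "hausdorff1_delta \<delta> {x} \<le> 0" if "0 < \<delta>" for \<delta> :: real
    unfolding hausdorff1_delta_def by (rule INF_lower2[of "\<lambda>_. {x}"]) (use that in auto)
  then have "hausdorff1 {x} \<le> 0" unfolding hausdorff1_def by (intro SUP_least) auto
  then show ?thesis by simp
qed

text \<open>Lipschitz images of subsets of the line are separable. The remaining null set has, for
  each \<open>n\<close>, a countable covering by sets of diameter at most
  \<open>inverse (real (Suc n))\<close>, and one point from each of these sets suffices.\<close>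

lemma countably_rectifiable1_separable:
  fixes S :: "'a::metric_space set"
  assumes "countably_rectifiable1 S"
  obtains D where "countable D" "S \<subseteq> closure D"
proof -
  obtain A :: "nat \<Rightarrow> real set" and g :: "nat \<Rightarrow> real \<Rightarrow> 'a"
    where g: "\<And>i. \<exists>C. lipschitz_on C (A i) (g i)" and null: "hausdorff1 (S - (\<Union>i. g i ` A i)) = 0"
    using assms unfolding countably_rectifiable1_def by blast
  let ?N = "S - (\<Union>i. g i ` A i)"
  have "\<exists>E. countable E \<and> E \<subseteq> A i \<and> A i \<subseteq> closure E" for i
    by (metis separable)
  then obtain E where E: "\<And>i. countable (E i)" "\<And>i. E i \<subseteq> A i" "\<And>i. A i \<subseteq> closure (E i)" by metis
  have "\<exists>C :: nat \<Rightarrow> 'a set. ?N \<subseteq> (\<Union>i. C i) \<and> (\<forall>i. bounded (C i) \<and> diameter (C i) \<le> inverse (real (Suc n)))" for n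
    using hausdorff1_null_cover[OF null, of "inverse (real (Suc n))"] by (metis inverse_positive_iff_positive of_nat_0_less_iff zero_less_Suc)
  then obtain C :: "nat \<Rightarrow> nat \<Rightarrow> 'a set" where C: "\<And>n. ?N \<subseteq> (\<Union>i. C n i)" "\<And>n i. bounded (C n i)" "\<And>n i. diameter (C n i) \<le> inverse (real (Suc n))"
    by metis
  \<comment> \<open>For an empty covering set the chosen point is arbitrary; this only enlarges the
    countable set \<open>D\<close>.\<close>
  define pt where "pt = (\<lambda>n i. SOME x. x \<in> C n i)"
  define D where "D = (\<Union>i. g i ` E i) \<union> range (\<lambda>(n,i). pt n i)"
  show ?thesis
  proof (rule that)
    show "countable D" unfolding D_def using E(1) by auto
    show "S \<subseteq> closure D"
    proof
      fix x assume x: "x \<in> S"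
      show "x \<in> closure D"
      proof (cases "x \<in> ?N")
        case True
        show ?thesis
        proof (rule closure_approachable[THEN iffD2], intro allI impI)
          fix e :: real assume "0 < e"
          then obtain n where n: "inverse (real (Suc n)) < e" using reals_Archimedean by blast
          have "x \<in> (\<Union>i. C n i)" by (rule subsetD[OF C(1) True])
          then obtain i where i: "x \<in> C n i" by blast
          then have "pt n i \<in> C n i" unfolding pt_def by (metis someI_ex)
          then have "dist (pt n i) x \<le> diameter (C n i)" using i by (intro diameter_bounded_bound C)
          then have "dist (pt n i) x < e" using C(3)[of n i] n by linarith
          moreover have "pt n i \<in> D" unfolding D_def by (intro UnI2 image_eqI[of _ _ "(n, i)"]) auto
          ultimately show "\<exists>y\<in>D. dist y x < e" by blast
        qed
      next
        case False
        then obtain i t where t: "t \<in> A i" "x = g i t" using x by auto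
        obtain L where L: "lipschitz_on L (A i) (g i)" using g by blast
        have "x \<in> closure (g i ` E i)"
        proof (rule closure_approachable[THEN iffD2], intro allI impI)
          fix e :: real assume e: "0 < e"
          have L0: "0 \<le> L" using L by (rule lipschitz_on_nonneg)
          have "0 < e / (L + 1)" using e L0 by simp
          then obtain s where s: "s \<in> E i" "dist s t < e / (L + 1)"
            using E(3) t(1) unfolding closure_approachable subset_iff by blast
          have "dist (g i s) x \<le> L * dist s t" unfolding t(2) by (rule lipschitz_onD[OF L]) (use s t E(2) in auto)
          also have "\<dots> \<le> (L + 1) * dist s t" by (simp add: distrib_right)
          also have "\<dots> < e" using s(2) L0 by (simp add: field_simps)
          finally show "\<exists>y\<in>g i ` E i. dist y x < e" using s by blast
        qed
        moreover have "g i ` E i \<subseteq> D" unfolding D_def by auto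
        ultimately show ?thesis using closure_mono by blast
      qed
    qed
  qed
qed

text \<open>Null balls with centres in \<open>D\<close> and rational radii replace the Lindelof property, which the
  ambient space need not have.\<close>

lemma measure_concentrated_on_support:
  fixes \<mu> :: "'a::metric_space measure"
  assumes sets: "sets \<mu> = sets borel"
    and S: "countable D" "S \<subseteq> closure D" "concentrated_on \<mu> S"
    and K: "closed K" "measure_support \<mu> \<subseteq> K"
  shows "- K \<in> null_sets \<mu>"
proof -
  obtain N where N: "N \<in> null_sets \<mu>" "- S \<subseteq> N" using S(3) by (auto simp: concentrated_on_def)
  define I where "I = {(d, q). d \<in> D \<and> emeasure \<mu> (ball d (real_of_rat q)) = 0}"
  have "I \<subseteq> D \<times> UNIV" by (auto simp: I_def)
  then have cI: "countable I" by (rule countable_subset) (use S(1) in auto)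
  have null: "(\<Union>(d,q)\<in>I. ball d (real_of_rat q)) \<in> null_sets \<mu>"
    by (rule null_sets_UN'[OF cI]) (auto simp: I_def null_sets_def sets)
  have "- K \<subseteq> N \<union> (\<Union>(d,q)\<in>I. ball d (real_of_rat q))"
  proof
    fix x assume x: "x \<in> - K"
    show "x \<in> N \<union> (\<Union>(d,q)\<in>I. ball d (real_of_rat q))"
    proof (cases "x \<in> S")
      case False then show ?thesis using N by auto
    next
      case True
      have "\<not> (\<forall>r>0. emeasure \<mu> (ball x r) > 0)"
        using x K(2) unfolding measure_support_def by blast
      then obtain r where r: "0 < r" "emeasure \<mu> (ball x r) = 0" by (auto simp: not_less)
      \<comment> \<open>With \<open>dist d x < r / 4\<close>, the lower bound on \<open>q\<close>
        puts \<open>x\<close> into the ball around \<open>d\<close>, and the upper bound keeps that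
        ball inside \<open>ball x r\<close>.\<close>
      obtain q where q: "r / 4 < real_of_rat q" "real_of_rat q < r / 2"
        using of_rat_dense[of "r/4" "r/2"] r by auto
      obtain d where d: "d \<in> D" "dist d x < r / 4"
        using True S(2) r by (metis closure_approachable divide_pos_pos subsetD zero_less_numeral)
      have "ball d (real_of_rat q) \<subseteq> ball x r"
      proof
        fix y assume "y \<in> ball d (real_of_rat q)"
        then have "dist x y < r / 4 + r / 2" using d q dist_triangle[of x y d] by (simp add: dist_commute)
        then show "y \<in> ball x r" using r by simp
      qed
      then have "emeasure \<mu> (ball d (real_of_rat q)) \<le> emeasure \<mu> (ball x r)"
        by (rule emeasure_mono) (simp add: sets)
      then have "(d, q) \<in> I" using d r by (simp add: I_def)
      moreover have "x \<in> ball d (real_of_rat q)" using d q by simp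
      ultimately show ?thesis by blast
    qed
  qed
  moreover have "- K \<in> sets \<mu>" using K sets by auto
  ultimately show ?thesis using N(1) null by (meson null_sets.Un null_sets_subset)
qed

text \<open>Rectifiability gives a separable carrier, so the complement of the support is covered by
  countably many null balls up to a null set. Points are null because the Hausdorff measure of a
  point is 0.\<close>

lemma rectifiable_mass_outside_support:
  fixes T :: "'a::metric_space functional"
  assumes T: "rectifiable_1current T" and K: "closed K" "spt 1 T \<subseteq> K"
  shows "AE x in mass1 T. x \<in> K" and "emeasure (mass1 T) {x} = 0"
proof -
  have m: "metric_current 1 T" using T by (simp add: rectifiable_1current_def)
  have sets: "sets (mass1 T) = sets borel" using mass1_finite_borel[OF m] by (simp add: finite_borel_measure_def)
  obtain S where S: "countably_rectifiable1 S" "concentrated_on (mass1 T) S"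
    using T unfolding rectifiable_1current_def mass1_def by blast
  obtain D where D: "countable D" "S \<subseteq> closure D" using countably_rectifiable1_separable[OF S(1)] .
  have "- K \<in> null_sets (mass1 T)"
    by (rule measure_concentrated_on_support[OF sets D S(2) K(1)]) (use K(2) in \<open>simp add: spt_def mass1_def\<close>)
  then show "AE x in mass1 T. x \<in> K" by (rule AE_I') auto
  have "\<forall>N\<in>sets borel. hausdorff1 N = 0 \<longrightarrow> emeasure (mass1 T) N = 0"
    using T unfolding rectifiable_1current_def mass1_def by blast
  then show "emeasure (mass1 T) {x} = 0" using hausdorff1_singleton[of x] borel_singleton[OF sets.empty_sets, of x] by blast
qed

section \<open>The Leibniz rule\<close>

lemma max_0_square_deriv: "((\<lambda>t::real. (max 0 t)\<^sup>2) has_field_derivative 2 * max 0 x) (at x)"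
proof -
  consider "x > 0" | "x < 0" | "x = 0" by linarith
  then show ?thesis
  proof cases
    case 1
    have "((\<lambda>t::real. t\<^sup>2) has_field_derivative 2 * x) (at x)" by (auto intro!: derivative_eq_intros)
    then show ?thesis
      using 1 by (subst DERIV_cong_ev[OF refl eventually_mono[OF eventually_nhds_in_open[of "{0<..}"]] refl, where g="\<lambda>t. t\<^sup>2"]) auto
  next
    case 2
    have "((\<lambda>t::real. 0::real) has_field_derivative 0) (at x)" by simp
    then show ?thesis
      using 2 by (subst DERIV_cong_ev[OF refl eventually_mono[OF eventually_nhds_in_open[of "{..<0}"]] refl, where g="\<lambda>t. 0"]) auto
  next
    case 3
    have "((\<lambda>h::real. (max 0 h)\<^sup>2 / h) \<longlongrightarrow> 0) (at 0)"
    proof (rule Lim_null_comparison[where g="\<lambda>h. \<bar>h\<bar>"])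
      show "\<forall>\<^sub>F h::real in at 0. norm ((max 0 h)\<^sup>2 / h) \<le> \<bar>h\<bar>"
        by (rule always_eventually) (auto simp: max_def power2_eq_square)
      show "((\<lambda>h::real. \<bar>h\<bar>) \<longlongrightarrow> 0) (at 0)" by (rule tendsto_rabs_zero) (rule tendsto_ident_at)
    qed
    then show ?thesis using 3 by (simp add: DERIV_def)
  qed
qed

lemma integer_rectifiable_multiplicity:
  fixes T :: "'a::metric_space functional"
  assumes T: "integer_rectifiable_1current T" and \<phi>: "\<phi> \<in> LIP" and \<Omega>: "open \<Omega>"
  obtains \<theta> :: "real \<Rightarrow> int" where "integrable lebesgue (\<lambda>x. real_of_int (\<theta> x))"
    "\<And>f p. f \<in> LIPb \<Longrightarrow> p \<in> LIP \<Longrightarrow> extend1 T (\<lambda>x. indicator \<Omega> x * f (\<phi> x)) (p \<circ> \<phi>) =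
       (\<integral>x. real_of_int (\<theta> x) * f x * deriv p x \<partial>lebesgue)"
proof -
  have "\<forall>\<phi>\<in>LIP. \<forall>\<Omega>. open \<Omega> \<longrightarrow> (\<exists>\<theta> :: real \<Rightarrow> int. integrable lebesgue (\<lambda>x. real_of_int (\<theta> x)) \<and>
           (\<forall>f\<in>LIPb. \<forall>p\<in>LIP. push_forward \<phi> (current_restrict 1 T \<Omega>) f [p] =
              (\<integral>x. real_of_int (\<theta> x) * f x * deriv p x \<partial>lebesgue)))"
    using T unfolding integer_rectifiable_1current_def by (rule conjunct2)
  from this[rule_format, OF \<phi> \<Omega>] show ?thesis
    using that by (auto simp: push_forward_def current_restrict_def extend1_def o_def)
qed

text \<open>The square is truncated to the \<open>C\<^sup>1\<close> function \<open>p2\<close>, whose derivative is twice the truncated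
  identity \<open>c\<close> at every point, so that the two integrands against \<open>\<theta>\<close> agree everywhere.\<close>

lemma integer_rectifiable_square:
  fixes T :: "'a::metric_space functional"
  assumes T: "integer_rectifiable_1current T" and \<phi>: "\<phi> \<in> LIPb"
  shows "2 * T \<phi> [\<phi>] = T (\<lambda>_. 1) [\<lambda>x. \<phi> x * \<phi> x]"
proof -
  have m: "metric_current 1 T" using T by (simp add: integer_rectifiable_1current_def rectifiable_1current_def)
  obtain M where M: "0 \<le> M" "\<And>x. \<bar>\<phi> x\<bar> \<le> M" using LIPbE[OF \<phi>] by blast
  obtain \<theta> :: "real \<Rightarrow> int" where "integrable lebesgue (\<lambda>x. real_of_int (\<theta> x))"
    and \<theta>: "\<And>f p. f \<in> LIPb \<Longrightarrow> p \<in> LIP \<Longrightarrow>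
      extend1 T (\<lambda>x. indicator UNIV x * f (\<phi> x)) (p \<circ> \<phi>) = (\<integral>x. real_of_int (\<theta> x) * f x * deriv p x \<partial>lebesgue)"
    using integer_rectifiable_multiplicity[OF T LIPbD[OF \<phi>] open_UNIV] by blast
  have res: "extend1 T (\<lambda>x. indicator UNIV x * f (\<phi> x)) (p \<circ> \<phi>) = T (f \<circ> \<phi>) [p \<circ> \<phi>]"
    if "f \<circ> \<phi> \<in> LIPb" "p \<in> LIP" for f p
    using extend1_eq[OF m that(1) LIP_compose[OF that(2) LIPbD[OF \<phi>]]] by (simp add: o_def)
  define c where "c = (\<lambda>y. max (-M) (min M y))"
  \<comment> \<open>Beyond \<open>M\<close> the subtraction leaves the tangent
    \<open>2 * M * y - M * M\<close>, and symmetrically below \<open>- M\<close>. The square itself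
    is not Lipschitz on the line, whereas this function has constant \<open>2 * M\<close>.\<close>
  define p2 where "p2 = (\<lambda>y. y\<^sup>2 - (max 0 (y - M))\<^sup>2 - (max 0 (-y - M))\<^sup>2)"
  have c: "c \<in> LIPb" unfolding c_def
    by (rule LIPbI[of _ M]) (use M in \<open>auto intro!: LIP_max LIP_min LIP_const LIP_id\<close>)
  have d: "(p2 has_field_derivative 2 * c y) (at y)" for y
  proof -
    have 1: "((\<lambda>y. (max 0 (y - M))\<^sup>2) has_field_derivative 2 * max 0 (y - M) * 1) (at y)"
      by (rule DERIV_chain2[OF max_0_square_deriv]) (auto intro!: derivative_eq_intros)
    have 2: "((\<lambda>y. (max 0 (- y - M))\<^sup>2) has_field_derivative 2 * max 0 (- y - M) * (-1)) (at y)"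
      by (rule DERIV_chain2[OF max_0_square_deriv]) (auto intro!: derivative_eq_intros)
    have "(p2 has_field_derivative 2 * y - 2 * max 0 (y - M) * 1 - 2 * max 0 (- y - M) * (-1)) (at y)"
      unfolding p2_def by (intro DERIV_diff 1 2) (auto intro!: derivative_eq_intros)
    moreover have "2 * y - 2 * max 0 (y - M) - 2 * max 0 (- y - M) * (-1) = 2 * c y"
      using M(1) by (auto simp: c_def max_def min_def)
    ultimately show ?thesis by simp
  qed
  have p2: "p2 \<in> LIP"
  proof (rule LIP_I[of "2 * M"])
    fix x y :: real
    have "norm (p2 x - p2 y) \<le> 2 * M * norm (x - y)"
    proof (rule field_differentiable_bound[of UNIV p2 "\<lambda>y. 2 * c y"])
      show "norm (2 * c z) \<le> 2 * M" for z using M(1) by (auto simp: c_def)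
    qed (use d in auto)
    then show "\<bar>p2 x - p2 y\<bar> \<le> 2 * M * dist x y" by (simp add: dist_real_def)
  qed (use M in simp)
  have c\<phi>: "c \<circ> \<phi> = \<phi>"
  proof
    fix x show "(c \<circ> \<phi>) x = \<phi> x" using M(2)[of x] by (auto simp: c_def)
  qed
  have p2\<phi>: "p2 \<circ> \<phi> = (\<lambda>x. \<phi> x * \<phi> x)"
  proof
    fix x
    have "max 0 (\<phi> x - M) = 0" "max 0 (- \<phi> x - M) = 0" using M(2)[of x] by auto
    then show "(p2 \<circ> \<phi>) x = \<phi> x * \<phi> x" by (simp add: p2_def power2_eq_square)
  qed
  have "T \<phi> [\<phi>] = (\<integral>x. real_of_int (\<theta> x) * c x * deriv (\<lambda>y. y) x \<partial>lebesgue)"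
    using \<theta>[OF c LIP_id] res[of c "\<lambda>y. y"] \<phi> LIP_id c\<phi> by (simp add: o_def)
  moreover have "T (\<lambda>_. 1) [\<lambda>x. \<phi> x * \<phi> x] = (\<integral>x. real_of_int (\<theta> x) * 1 * deriv p2 x \<partial>lebesgue)"
    using \<theta>[OF LIPb_const p2, of 1] res[of "\<lambda>_. 1" p2] p2 p2\<phi> by (simp add: o_def LIPb_const)
  moreover have "deriv p2 x = 2 * c x" for x by (rule DERIV_imp_deriv[OF d])
  moreover have "(\<integral>x. 2 * (real_of_int (\<theta> x) * c x) \<partial>lebesgue) = 2 * (\<integral>x. real_of_int (\<theta> x) * c x \<partial>lebesgue)"
    by (rule integral_mult_right_zero)
  ultimately show ?thesis by (simp add: mult_ac)
qed

lemma integer_rectifiable_Leibniz: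
  fixes T :: "'a::metric_space functional"
  assumes T: "integer_rectifiable_1current T" and f: "f \<in> LIPb" and p: "p \<in> LIPb"
  shows "T f [p] + T p [f] = T (\<lambda>_. 1) [\<lambda>x. f x * p x]"
proof -
  have m: "metric_current 1 T" using T by (simp add: integer_rectifiable_1current_def rectifiable_1current_def)
  have fp: "(\<lambda>x. 1 * f x + 1 * p x) \<in> LIPb" by (rule LIPb_lincomb[OF f p])
  note lin1 = metric_1current_linear(1)[OF m] and lin2 = metric_1current_linear(2)[OF m]
  have ff: "(\<lambda>x. f x * f x) \<in> LIPb" and pp: "(\<lambda>x. p x * p x) \<in> LIPb" and fp': "(\<lambda>x. f x * p x) \<in> LIPb"
    by (rule LIPb_mult; fact)+
  have "T (\<lambda>x. 1 * f x + 1 * p x) [\<lambda>x. 1 * f x + 1 * p x] = T f [f] + T f [p] + T p [f] + T p [p]"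
    using lin1[OF LIPbD[OF fp] f p, of 1 1] lin2[OF LIPbD[OF f] f LIPbD[OF p], of 1 1] lin2[OF LIPbD[OF f] p LIPbD[OF p], of 1 1]
    by simp
  moreover have "T (\<lambda>_. 1) [\<lambda>x. (1 * f x + 1 * p x) * (1 * f x + 1 * p x)]
      = T (\<lambda>_. 1) [\<lambda>x. f x * f x] + T (\<lambda>_. 1) [\<lambda>x. p x * p x] + 2 * T (\<lambda>_. 1) [\<lambda>x. f x * p x]"
  proof -
    have s: "(\<lambda>x. 1 * (f x * f x) + 1 * (p x * p x)) \<in> LIPb" by (rule LIPb_lincomb[OF ff pp])
    have eq: "(\<lambda>x. (1 * f x + 1 * p x) * (1 * f x + 1 * p x)) = (\<lambda>x. 1 * (1 * (f x * f x) + 1 * (p x * p x)) + 2 * (f x * p x))"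
      by (simp add: algebra_simps)
    show ?thesis unfolding eq
      using lin2[OF LIPbD[OF s] LIPb_const LIPbD[OF fp'], of 1 1 2] lin2[OF LIPbD[OF ff] LIPb_const LIPbD[OF pp], of 1 1 1]
      by simp
  qed
  ultimately show ?thesis
    using integer_rectifiable_square[OF T fp] integer_rectifiable_square[OF T f] integer_rectifiable_square[OF T p]
    by linarith
qed

section \<open>Currents carried by an arc\<close>

text \<open>The intended instance is \<open>mass1 T\<close> with \<open>extend1 T\<close>.
  \<open>curve_inj\<close> covers injective curves and injective loops together, and
  \<open>boundary_endpoints\<close> holds both for cycles and for currents with the boundary of the
  curve. Integrality is left out: within the locale the multiplicity is a real number.\<close>

locale current_on_arc =
  fixes \<mu> :: "'a::metric_space measure" and \<Lambda> :: "('a \<Rightarrow> real) \<Rightarrow> ('a \<Rightarrow> real) \<Rightarrow> real"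
    and \<gamma> :: "real \<Rightarrow> 'a" and a C :: real
  assumes finite_borel: "finite_borel_measure \<mu>"
    and linear_left: "p \<in> LIP \<Longrightarrow> integrable \<mu> f \<Longrightarrow> integrable \<mu> g \<Longrightarrow>
      \<Lambda> (\<lambda>x. b * f x + c * g x) p = b * \<Lambda> f p + c * \<Lambda> g p"
    and linear_right: "integrable \<mu> f \<Longrightarrow> p \<in> LIP \<Longrightarrow> q \<in> LIP \<Longrightarrow>
      \<Lambda> f (\<lambda>x. b * p x + c * q x) = b * \<Lambda> f p + c * \<Lambda> f q"
    and bound: "p \<in> LIP \<Longrightarrow> integrable \<mu> f \<Longrightarrow> \<bar>\<Lambda> f p\<bar> \<le> Lip p * (\<integral>x. \<bar>f x\<bar> \<partial>\<mu>)"
    and locality: "p \<in> LIP \<Longrightarrow> integrable \<mu> f \<Longrightarrow> AE x in \<mu>. f x \<noteq> 0 \<longrightarrow> p x = c \<Longrightarrow> \<Lambda> f p = 0"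
    and Leibniz: "f \<in> LIPb \<Longrightarrow> p \<in> LIPb \<Longrightarrow> \<Lambda> f p + \<Lambda> p f = \<Lambda> (\<lambda>_. 1) (\<lambda>x. f x * p x)"
    and length_pos: "0 < a"
    and curve_lipschitz: "C-lipschitz_on {0..a} \<gamma>"
    and curve_inj: "0 \<le> r \<Longrightarrow> r < t \<Longrightarrow> t \<le> a \<Longrightarrow> \<gamma> r = \<gamma> t \<Longrightarrow> r = 0 \<and> t = a"
    and concentrated: "AE x in \<mu>. x \<in> \<gamma> ` {0..a}"
    and null_point: "emeasure \<mu> {x} = 0"
    and boundary_endpoints: "\<phi> \<in> LIPb \<Longrightarrow> \<phi> (\<gamma> 0) = 0 \<Longrightarrow> \<phi> (\<gamma> a) = 0 \<Longrightarrow> \<Lambda> (\<lambda>_. 1) \<phi> = 0"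
begin

lemma finite_mu: "finite_measure \<mu>" and sets_mu: "sets \<mu> = sets borel"
  using finite_borel by (auto simp: finite_borel_measure_def)

lemma curve_dist: "r \<in> {0..a} \<Longrightarrow> t \<in> {0..a} \<Longrightarrow> dist (\<gamma> r) (\<gamma> t) \<le> C * \<bar>r - t\<bar>"
  using lipschitz_onD[OF curve_lipschitz] by (simp add: dist_real_def)

lemma C_nonneg: "0 \<le> C"
  by (rule lipschitz_on_nonneg[OF curve_lipschitz])

lemma compact_arc: "compact A \<Longrightarrow> A \<subseteq> {0..a} \<Longrightarrow> compact (\<gamma> ` A)"
  by (rule compact_continuous_image[OF continuous_on_subset[OF lipschitz_on_continuous_on[OF curve_lipschitz]]])

lemma arc_borel: "0 \<le> s \<Longrightarrow> t \<le> a \<Longrightarrow> \<gamma> ` {s..t} \<in> sets borel"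
  by (intro borel_closed compact_imp_closed compact_arc) auto

lemma integrable_indicator: "B \<in> sets borel \<Longrightarrow> integrable \<mu> (indicat_real B)"
  by (rule finite_borel_integrable_indicator[OF finite_borel])

lemma integrable_LIPb: "f \<in> LIPb \<Longrightarrow> integrable \<mu> f"
  by (rule LIPb_integrable[OF finite_borel])

lemma integrable_indicator_mult:
  fixes f :: "'a \<Rightarrow> real"
  shows "B \<in> sets borel \<Longrightarrow> integrable \<mu> f \<Longrightarrow> integrable \<mu> (\<lambda>x. indicator B x * f x)"
  using integrable_mult_indicator[of B \<mu> f] by (simp add: sets_mu)

lemma null_finite: "finite N \<Longrightarrow> AE x in \<mu>. x \<notin> N"
proof (induction rule: finite_induct)
  case (insert y N)
  have "AE x in \<mu>. x \<noteq> y"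
    by (rule AE_I[of _ _ "{y}"]) (auto simp: null_point sets_mu)
  then show ?case using insert.IH by eventually_elim auto
qed simp

lemma left_diff:
  assumes "p \<in> LIP" "integrable \<mu> f" "integrable \<mu> g"
  shows "\<bar>\<Lambda> f p - \<Lambda> g p\<bar> \<le> Lip p * (\<integral>x. \<bar>f x - g x\<bar> \<partial>\<mu>)"
  by (rule L1_functional_diff[OF _ _ assms(2,3)]) (fact linear_left[OF assms(1)] bound[OF assms(1)])+

lemma left_cong_AE:
  assumes "p \<in> LIP" "integrable \<mu> f" "integrable \<mu> g" "AE x in \<mu>. f x = g x"
  shows "\<Lambda> f p = \<Lambda> g p"
proof -
  have "(\<integral>x. \<bar>f x - g x\<bar> \<partial>\<mu>) = (\<integral>x. 0 \<partial>\<mu>)"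
    by (rule integral_cong_AE) (use assms borel_measurable_integrable in auto)
  then show ?thesis using left_diff[OF assms(1-3)] by simp
qed

lemma left_add:
  assumes "p \<in> LIP" "integrable \<mu> f" "integrable \<mu> g" "integrable \<mu> h" "AE x in \<mu>. f x = g x + h x"
  shows "\<Lambda> f p = \<Lambda> g p + \<Lambda> h p"
proof -
  have "\<Lambda> f p = \<Lambda> (\<lambda>x. 1 * g x + 1 * h x) p"
    by (rule left_cong_AE) (use assms in auto)
  then show ?thesis using linear_left[OF assms(1,3,4), of 1 1] by simp
qed

lemma left_scale: "p \<in> LIP \<Longrightarrow> integrable \<mu> f \<Longrightarrow> \<Lambda> (\<lambda>x. b * f x) p = b * \<Lambda> f p"
  using linear_left[of p f f b 0] by simp

text \<open>The difference \<open>p - b * q\<close> is constant where \<open>f\<close> does not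
  vanish, so locality removes it. This allows a function to be replaced separately on each piece of
  the curve.\<close>

lemma right_cong:
  assumes p: "p \<in> LIP" and q: "q \<in> LIP" and f: "integrable \<mu> f"
    and ae: "AE x in \<mu>. f x \<noteq> 0 \<longrightarrow> p x = b * q x + c"
  shows "\<Lambda> f p = b * \<Lambda> f q"
proof -
  have L: "(\<lambda>x. 1 * p x + (-b) * q x) \<in> LIP" by (rule Lip_lincomb(1)[OF p q])
  have "\<Lambda> f (\<lambda>x. 1 * p x + (-b) * q x) = 0"
    by (rule locality[OF L f, where c=c]) (use ae in eventually_elim, auto)
  then show ?thesis using linear_right[OF f p q, of 1 "-b"] by simp
qed

text \<open>Locality admits one constant value only, hence the splitting of \<open>f\<close> along
  the closed set \<open>{x. p x = 0}\<close>.\<close>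

lemma local_01:
  assumes p: "p \<in> LIP" and f: "integrable \<mu> f" and ae: "AE x in \<mu>. f x \<noteq> 0 \<longrightarrow> p x = 0 \<or> p x = 1"
  shows "\<Lambda> f p = 0"
proof -
  define B where "B = {x. p x = 0}"
  have "closed B" unfolding B_def by (intro closed_Collect_eq LIP_continuous p continuous_on_const)
  then have B: "B \<in> sets borel" "-B \<in> sets borel" by auto
  have "\<Lambda> f p = \<Lambda> (\<lambda>x. indicator B x * f x) p + \<Lambda> (\<lambda>x. indicator (-B) x * f x) p"
    by (rule left_add[OF p f integrable_indicator_mult[OF B(1) f] integrable_indicator_mult[OF B(2) f]])
      (auto simp: indicator_def)
  moreover have "\<Lambda> (\<lambda>x. indicator B x * f x) p = 0"
    by (rule locality[OF p integrable_indicator_mult[OF B(1) f], where c=0]) (auto simp: indicator_def B_def)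
  moreover have "\<Lambda> (\<lambda>x. indicator (-B) x * f x) p = 0"
    by (rule locality[OF p integrable_indicator_mult[OF B(2) f], where c=1])
      (use ae in eventually_elim, auto simp: indicator_def B_def split: if_splits)
  ultimately show ?thesis by simp
qed

lemma left_lim:
  assumes p: "p \<in> LIP" and s: "\<And>n. integrable \<mu> (s n)" and f: "integrable \<mu> f"
    and lim: "(\<lambda>n. \<integral>x. \<bar>s n x - f x\<bar> \<partial>\<mu>) \<longlonglongrightarrow> 0"
  shows "(\<lambda>n. \<Lambda> (s n) p) \<longlonglongrightarrow> \<Lambda> f p"
  by (rule L1_functional_lim[OF _ _ s f lim]) (fact linear_left[OF p] bound[OF p])+

section \<open>Windows, cut-offs and ramps along the curve\<close>

definition window :: "real \<Rightarrow> real \<Rightarrow> 'a set" where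
  "window s \<delta> = \<gamma> ` ({s - \<delta>..s + \<delta>} \<inter> {0..a})"

lemma window_borel: "window s \<delta> \<in> sets borel"
  unfolding window_def by (intro borel_closed compact_imp_closed compact_arc compact_Int_closed) auto

lemma window_mono: "\<delta> \<le> \<epsilon> \<Longrightarrow> window s \<delta> \<subseteq> window s \<epsilon>"
  unfolding window_def by (rule image_mono) force

text \<open>The windows decrease to a single point, which carries no mass. Every error term below is
  a fixed multiple of such a measure.\<close>

lemma window_measure_tendsto_0:
  assumes s: "s \<in> {0..a}"
  shows "((\<lambda>\<delta>. measure \<mu> (window s \<delta>)) \<longlongrightarrow> 0) (at_right 0)"
proof -
  interpret finite_measure \<mu> by (rule finite_mu)
  define W where "W = (\<lambda>n. window s (inverse (real (Suc n))))"
  have dec: "decseq W"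
  proof (rule decseq_SucI)
    fix n
    have "inverse (real (Suc (Suc n))) \<le> inverse (real (Suc n))" by simp
    then show "W (Suc n) \<subseteq> W n" unfolding W_def by (rule window_mono)
  qed
  have "(\<Inter>n. W n) = {\<gamma> s}"
  proof
    show "{\<gamma> s} \<subseteq> (\<Inter>n. W n)" using s unfolding W_def window_def by auto
    show "(\<Inter>n. W n) \<subseteq> {\<gamma> s}"
    proof
      fix x assume x: "x \<in> (\<Inter>n. W n)"
      have "dist x (\<gamma> s) \<le> C * inverse (real (Suc n))" for n
      proof -
        have "x \<in> W n" using x by blast
        then obtain r where r: "x = \<gamma> r" "r \<in> {0..a}" "\<bar>r - s\<bar> \<le> inverse (real (Suc n))"
          unfolding W_def window_def by (auto simp: abs_le_iff)
        have "dist x (\<gamma> s) \<le> C * \<bar>r - s\<bar>" unfolding r(1) by (rule curve_dist[OF r(2) s])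
        also have "\<dots> \<le> C * inverse (real (Suc n))" by (rule mult_left_mono[OF r(3) C_nonneg])
        finally show ?thesis .
      qed
      moreover have "(\<lambda>n. C * inverse (real (Suc n))) \<longlonglongrightarrow> C * 0"
        by (intro tendsto_intros LIMSEQ_inverse_real_of_nat)
      ultimately have "dist x (\<gamma> s) \<le> C * 0" by (rule LIMSEQ_lower_bound)
      then show "x \<in> {\<gamma> s}" by simp
    qed
  qed
  then have lim: "(\<lambda>n. measure \<mu> (W n)) \<longlonglongrightarrow> 0"
    using finite_Lim_measure_decseq[of W] dec window_borel null_point[of "\<gamma> s"]
    by (auto simp: sets_mu W_def measure_def)
  show ?thesis
  proof (rule tendstoI)
    fix e :: real assume "0 < e"
    then obtain n where n: "measure \<mu> (W n) < e"
      using order_tendstoD(2)[OF lim] by (auto simp: eventually_sequentially)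
    have "dist (measure \<mu> (window s \<delta>)) 0 < e" if "\<delta> < inverse (real (Suc n))" for \<delta>
    proof -
      have "window s \<delta> \<subseteq> W n" unfolding W_def by (rule window_mono) (use that in simp)
      then have "measure \<mu> (window s \<delta>) \<le> measure \<mu> (W n)"
        by (rule finite_measure_mono) (simp add: W_def window_borel sets_mu)
      then show ?thesis using n by simp
    qed
    then show "\<forall>\<^sub>F \<delta> in at_right 0. dist (measure \<mu> (window s \<delta>)) 0 < e"
      unfolding eventually_at_right_field by (intro exI[of _ "inverse (real (Suc n))"]) auto
  qed
qed

text \<open>Only the parameters \<open>0\<close> and \<open>a\<close> may share a point, and the
  inner arc avoids both, so it is disjoint from the two outer arcs. Compactness makes their distance
  positive, and a truncated multiple of the distance to the outer arcs works. Its Lipschitz constant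
  is not controlled.\<close>

lemma plateau:
  assumes "0 < s" "s < s'" "s' \<le> t'" "t' < t" "t < a"
  obtains w where "w \<in> LIP" "\<And>x. 0 \<le> w x" "\<And>x. w x \<le> 1"
    "\<And>r. s' \<le> r \<Longrightarrow> r \<le> t' \<Longrightarrow> w (\<gamma> r) = 1"
    "\<And>r. r \<in> {0..a} \<Longrightarrow> r \<le> s \<or> t \<le> r \<Longrightarrow> w (\<gamma> r) = 0"
proof -
  define A where "A = \<gamma> ` {s'..t'}"
  define B where "B = \<gamma> ` ({0..s} \<union> {t..a})"
  have cA: "compact A" unfolding A_def by (rule compact_arc) (use assms in auto)
  have cB: "compact B" unfolding B_def by (rule compact_arc) (use assms in \<open>auto intro: compact_Un\<close>)
  have B0: "B \<noteq> {}" unfolding B_def using assms by auto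
  have "A \<inter> B = {}"
  proof (rule ccontr)
    assume "A \<inter> B \<noteq> {}"
    then obtain r q where r: "s' \<le> r" "r \<le> t'" and q: "0 \<le> q" "q \<le> a" "q \<le> s \<or> t \<le> q" "\<gamma> r = \<gamma> q"
      using assms unfolding A_def B_def by fastforce
    show False
      using curve_inj[of r q] curve_inj[of q r] r q assms by (cases "r < q") auto
  qed
  have "A \<noteq> {}" unfolding A_def using assms by auto
  then obtain z where z: "z \<in> A" "\<And>x. x \<in> A \<Longrightarrow> infdist z B \<le> infdist x B"
    using continuous_attains_inf[OF cA _ LIP_continuous[OF LIP_infdist, of A B]] by auto
  define d where "d = infdist z B"
  have "z \<notin> B" using z(1) \<open>A \<inter> B = {}\<close> by blast
  then have d: "0 < d"
    using in_closed_iff_infdist_zero[OF compact_imp_closed[OF cB] B0, of z] infdist_nonneg[of z B]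
    by (simp add: d_def less_le)
  define w where "w = (\<lambda>x. min 1 (1 / d * infdist x B))"
  show ?thesis
  proof (rule that[of w])
    show "w \<in> LIP" unfolding w_def by (intro LIP_min LIP_const LIP_cmult LIP_infdist)
    show "0 \<le> w x" "w x \<le> 1" for x using d infdist_nonneg[of x B] by (auto simp: w_def)
    show "w (\<gamma> r) = 1" if "s' \<le> r" "r \<le> t'" for r
    proof -
      have "d \<le> infdist (\<gamma> r) B"
        unfolding d_def by (rule z(2)) (use that in \<open>auto simp: A_def\<close>)
      then show ?thesis using d by (simp add: w_def)
    qed
    show "w (\<gamma> r) = 0" if "r \<in> {0..a}" "r \<le> s \<or> t \<le> r" for r
    proof -
      have "\<gamma> r \<in> B" unfolding B_def using that by auto
      then show ?thesis by (simp add: w_def)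
    qed
  qed
qed

text \<open>\<open>steep g c d s\<close>: at the parameter \<open>s\<close> the curve is crossed transversally by the level sets of
  the Lipschitz function \<open>g\<close>.\<close>

definition steep :: "('a \<Rightarrow> real) \<Rightarrow> real \<Rightarrow> real \<Rightarrow> real \<Rightarrow> bool" where
  "steep g c d s \<longleftrightarrow> g \<in> LIP \<and> 0 < c \<and> 0 < d \<and> d \<le> s \<and> s + d \<le> a \<and>
     (\<forall>r. s \<le> r \<longrightarrow> r < s + d \<longrightarrow> c * (r - s) \<le> g (\<gamma> r) - g (\<gamma> s)) \<and>
     (\<forall>r. s - d < r \<longrightarrow> r \<le> s \<longrightarrow> c * (s - r) \<le> g (\<gamma> s) - g (\<gamma> r))"

text \<open>The distance from \<open>\<gamma> x\<close> is 0 at \<open>x\<close> and positive at the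
  midpoint \<open>z\<close>. Its derivative along the curve has positive integral over
  \<open>{x..z}\<close>, so it is positive at some point of differentiability, where half of the
  derivative serves as slope on both sides.\<close>

lemma steep_dense:
  assumes "0 \<le> x" "x < y" "y \<le> a"
  obtains g c d s where "x < s" "s < y" "steep g c d s"
proof -
  define z where "z = (x + y) / 2"
  have z: "x < z" "z < y" using assms by (auto simp: z_def)
  have "\<gamma> x \<noteq> \<gamma> z" using curve_inj[of x z] z assms by auto
  define g where "g = (\<lambda>v. dist (\<gamma> x) v)"
  define w where "w = (\<lambda>r. g (\<gamma> r))"
  have gL: "g \<in> LIP" unfolding g_def by (rule LIP_dist)
  have wL: "C-lipschitz_on {0..a} w"
  proof (rule lipschitz_onI[OF _ C_nonneg])
    fix r t assume "r \<in> {0..a}" "t \<in> {0..a}"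
    then have "dist (\<gamma> r) (\<gamma> t) \<le> C * dist r t" using curve_dist by (simp add: dist_real_def)
    moreover have "\<bar>dist (\<gamma> x) (\<gamma> r) - dist (\<gamma> x) (\<gamma> t)\<bar> \<le> dist (\<gamma> r) (\<gamma> t)"
      using dist_triangle[of "\<gamma> x" "\<gamma> r" "\<gamma> t"] dist_triangle[of "\<gamma> x" "\<gamma> t" "\<gamma> r"]
      by (auto simp: abs_le_iff dist_commute)
    ultimately show "dist (w r) (w t) \<le> C * dist r t" by (simp add: w_def g_def dist_real_def[of "dist _ _"])
  qed
  obtain N where N: "negligible N" "\<And>t. t \<in> {0<..<a} - N \<Longrightarrow> w differentiable at t"
    "\<And>c d. 0 \<le> c \<Longrightarrow> c \<le> d \<Longrightarrow> d \<le> a \<Longrightarrow> deriv w absolutely_integrable_on {c..d}"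
    "\<And>c d. 0 \<le> c \<Longrightarrow> c \<le> d \<Longrightarrow> d \<le> a \<Longrightarrow> integral {c..d} (deriv w) = w d - w c"
    using lipschitz_on_interval_deriv[OF wL] by metis
  have "\<exists>s\<in>{x<..<z} - N. 0 < deriv w s"
  proof (rule ccontr)
    assume neg: "\<not> (\<exists>s\<in>{x<..<z} - N. 0 < deriv w s)"
    have N': "negligible (N \<union> {x, z})" using N(1) by (simp add: negligible_Un)
    define v where "v = (\<lambda>s. if s \<in> N \<union> {x, z} then 0 else deriv w s)"
    have int: "deriv w integrable_on {x..z}"
      using N(3)[of x z] assms z by (simp add: absolutely_integrable_on_def)
    have "integral {x..z} (deriv w) = integral {x..z} v"
      by (rule integral_spike[OF N']) (auto simp: v_def)
    also have "\<dots> \<le> integral {x..z} (\<lambda>_. 0)"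
    proof (rule integral_le)
      show "v integrable_on {x..z}" by (rule integrable_spike[OF int N']) (auto simp: v_def)
      show "v s \<le> 0" if s: "s \<in> {x..z}" for s
      proof (cases "s \<in> N \<union> {x, z}")
        case False
        then have "s \<in> {x<..<z} - N" using s by auto
        then show ?thesis using neg False by (auto simp: v_def not_less)
      qed (simp add: v_def)
    qed (rule integrable_0)
    finally have "w z - w x \<le> 0" using N(4)[of x z] assms z by simp
    then show False using \<open>\<gamma> x \<noteq> \<gamma> z\<close> by (simp add: w_def g_def)
  qed
  then obtain s where s: "s \<in> {x<..<z}" "s \<notin> N" "0 < deriv w s" by blast
  have "w differentiable at s" by (rule N(2)) (use s assms z in auto)
  then have "(w has_field_derivative deriv w s) (at s)"
    by (metis DERIV_imp_deriv real_differentiable_def)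
  then have "((\<lambda>r. (w r - w s) / (r - s)) \<longlongrightarrow> deriv w s) (at s)" by (simp add: has_field_derivative_iff)
  then have "\<forall>\<^sub>F r in at s. deriv w s / 2 < (w r - w s) / (r - s)"
    by (rule order_tendstoD) (use s in simp)
  then obtain d0 where d0: "0 < d0" "\<And>r. r \<noteq> s \<Longrightarrow> dist r s < d0 \<Longrightarrow> deriv w s / 2 < (w r - w s) / (r - s)"
    unfolding eventually_at by auto
  \<comment> \<open>The bounds \<open>s\<close> and \<open>a - s\<close> keep the neighbourhood
    inside \<open>{0..a}\<close>.\<close>
  define d where "d = min d0 (min s (a - s))"
  have d: "0 < d" "d \<le> d0" "d \<le> s" "s + d \<le> a" using d0 s z assms by (auto simp: d_def)
  have up: "deriv w s / 2 * (r - s) \<le> g (\<gamma> r) - g (\<gamma> s)" if "s \<le> r" "r < s + d" for r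
  proof (cases "r = s")
    case False
    then have "deriv w s / 2 < (w r - w s) / (r - s)" using d0(2)[of r] that d by (simp add: dist_real_def)
    then have "deriv w s / 2 * (r - s) < w r - w s" using False that by (simp add: pos_less_divide_eq)
    then show ?thesis by (simp add: w_def)
  qed simp
  have dn: "deriv w s / 2 * (s - r) \<le> g (\<gamma> s) - g (\<gamma> r)" if "s - d < r" "r \<le> s" for r
  proof (cases "r = s")
    case False
    then have "deriv w s / 2 < (w r - w s) / (r - s)" using d0(2)[of r] that d by (simp add: dist_real_def)
    also have "(w r - w s) / (r - s) = (w s - w r) / (s - r)" by (metis minus_diff_eq minus_divide_divide)
    finally have "deriv w s / 2 * (s - r) < w s - w r" using False that by (simp add: pos_less_divide_eq)
    then show ?thesis by (simp add: w_def)
  qed simp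
  have "steep g (deriv w s / 2) d s"
    unfolding steep_def using gL s d up dn by auto
  then show ?thesis using that s z by auto
qed

text \<open>The value rises from 0 to 1 while \<open>g\<close> runs from \<open>c * \<delta>\<close>
  below \<open>g (\<gamma> s)\<close> to \<open>c * \<delta>\<close> above it. At a steep parameter
  this range is left as soon as the parameter is \<delta> away from \<open>s\<close>, provided that
  it stays within the distance \<open>d\<close>.\<close>

definition ramp :: "('a \<Rightarrow> real) \<Rightarrow> real \<Rightarrow> real \<Rightarrow> real \<Rightarrow> 'a \<Rightarrow> real" where
  "ramp g c s \<delta> x = max 0 (min 1 (1 / (2 * c * \<delta>) * (g x - g (\<gamma> s)) + 1 / 2))"

lemma ramp_bounds: "0 \<le> ramp g c s \<delta> x" "ramp g c s \<delta> x \<le> 1"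
  by (auto simp: ramp_def)

lemma ramp_LIP:
  assumes "g \<in> LIP" "0 < c" "0 < \<delta>"
  shows "ramp g c s \<delta> \<in> LIP" "Lip (ramp g c s \<delta>) \<le> Lip g / (2 * c * \<delta>)"
proof -
  have *: "\<bar>ramp g c s \<delta> x - ramp g c s \<delta> y\<bar> \<le> Lip g / (2 * c * \<delta>) * dist x y" for x y
  proof -
    have "\<bar>ramp g c s \<delta> x - ramp g c s \<delta> y\<bar> \<le> \<bar>1 / (2 * c * \<delta>) * (g x - g (\<gamma> s)) - 1 / (2 * c * \<delta>) * (g y - g (\<gamma> s))\<bar>"
    proof -
      have "\<bar>max 0 (min 1 (X + 1 / 2)) - max 0 (min 1 (Y + 1 / 2))\<bar> \<le> \<bar>X - Y\<bar>" for X Y :: real by auto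
      then show ?thesis unfolding ramp_def .
    qed
    also have "\<dots> = 1 / (2 * c * \<delta>) * \<bar>g x - g y\<bar>"
    proof -
      have "1 / (2 * c * \<delta>) * (g x - g (\<gamma> s)) - 1 / (2 * c * \<delta>) * (g y - g (\<gamma> s)) = 1 / (2 * c * \<delta>) * (g x - g y)"
        by (simp add: diff_divide_distrib)
      then show ?thesis using assms by (simp add: abs_mult)
    qed
    also have "\<dots> \<le> 1 / (2 * c * \<delta>) * (Lip g * dist x y)"
      using assms by (intro mult_left_mono Lip_bound) auto
    finally show ?thesis by simp
  qed
  have "0 \<le> Lip g / (2 * c * \<delta>)" using assms by (simp add: Lip_nonneg)
  then show "ramp g c s \<delta> \<in> LIP" "Lip (ramp g c s \<delta>) \<le> Lip g / (2 * c * \<delta>)"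
    using LIP_I Lip_leI * by blast+
qed

lemma ramp_values:
  assumes st: "steep g c d s" and "0 < \<delta>"
  shows "s + \<delta> \<le> r \<Longrightarrow> r < s + d \<Longrightarrow> ramp g c s \<delta> (\<gamma> r) = 1"
    and "r \<le> s - \<delta> \<Longrightarrow> s - d < r \<Longrightarrow> ramp g c s \<delta> (\<gamma> r) = 0"
proof -
  have c: "0 < c" using st by (simp add: steep_def)
  { assume r: "s + \<delta> \<le> r" "r < s + d"
    have "c * \<delta> \<le> c * (r - s)" using c r by simp
    also have "\<dots> \<le> g (\<gamma> r) - g (\<gamma> s)" using st r assms(2) by (simp add: steep_def)
    finally have "1 / (2 * c * \<delta>) * (c * \<delta>) \<le> 1 / (2 * c * \<delta>) * (g (\<gamma> r) - g (\<gamma> s))"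
      using c assms(2) by (intro mult_left_mono) auto
    moreover have "1 / (2 * c * \<delta>) * (c * \<delta>) = 1 / 2" using c assms(2) by simp
    moreover have "max 0 (min 1 (X + 1 / 2)) = 1" if "1 / 2 \<le> X" for X :: real using that by simp
    ultimately show "ramp g c s \<delta> (\<gamma> r) = 1" unfolding ramp_def by metis }
  { assume r: "r \<le> s - \<delta>" "s - d < r"
    have "c * \<delta> \<le> c * (s - r)" using c r by simp
    also have "\<dots> \<le> g (\<gamma> s) - g (\<gamma> r)" using st r assms(2) by (simp add: steep_def)
    finally have "g (\<gamma> r) - g (\<gamma> s) \<le> - (c * \<delta>)" by simp
    then have "1 / (2 * c * \<delta>) * (g (\<gamma> r) - g (\<gamma> s)) \<le> 1 / (2 * c * \<delta>) * (- (c * \<delta>))"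
      using c assms(2) by (intro mult_left_mono) auto
    moreover have "1 / (2 * c * \<delta>) * (- (c * \<delta>)) = - (1 / 2)" using c assms(2) by simp
    moreover have "max 0 (min 1 (X + 1 / 2)) = 0" if "X \<le> - (1 / 2)" for X :: real using that by simp
    ultimately show "ramp g c s \<delta> (\<gamma> r) = 0" unfolding ramp_def by metis }
qed

text \<open>A ramp up at \<open>s\<close>, a plateau in the middle and a ramp down at
  \<open>t\<close>, glued by \<open>max\<close>. The ramps say nothing about the curve far from
  their base points, so plateaus \<alpha> and \<beta> cut them off. The margins let neighbouring
  pieces overlap where both are 1: \<open>3 * \<delta> < d\<close> keeps the support of \<alpha>
  within the range where the ramp is known, and \<open>6 * \<delta> < t - s\<close> separates the
  two ends.\<close>

lemma step_function:
  assumes s: "steep g c d s" and t: "steep h b e t" and \<delta>: "0 < \<delta>" "3 * \<delta> < d" "3 * \<delta> < e" "6 * \<delta> < t - s"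
  obtains F where "F \<in> LIPb" "\<And>x. 0 \<le> F x" "\<And>x. F x \<le> 1"
    "\<And>r. r \<in> {0..a} \<Longrightarrow> r \<le> s - \<delta> \<or> t + \<delta> \<le> r \<Longrightarrow> F (\<gamma> r) = 0"
    "\<And>r. s + \<delta> \<le> r \<Longrightarrow> r \<le> t - \<delta> \<Longrightarrow> F (\<gamma> r) = 1"
    "\<And>r. \<bar>r - s\<bar> \<le> \<delta> \<Longrightarrow> F (\<gamma> r) = ramp g c s \<delta> (\<gamma> r)"
    "\<And>r. \<bar>r - t\<bar> \<le> \<delta> \<Longrightarrow> F (\<gamma> r) = 1 - ramp h b t \<delta> (\<gamma> r)"
proof -
  have sd: "g \<in> LIP" "0 < c" "d \<le> s" "s + d \<le> a" and te: "h \<in> LIP" "0 < b" "e \<le> t" "t + e \<le> a"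
    using s t by (auto simp: steep_def)
  have pre1: "0 < s - 2 * \<delta>" "s - 2 * \<delta> < s - \<delta>" "s - \<delta> \<le> s + 2 * \<delta>" "s + 2 * \<delta> < s + 3 * \<delta>" "s + 3 * \<delta> < a"
    using \<delta> sd by linarith+
  obtain \<alpha> where \<alpha>: "\<alpha> \<in> LIP" "\<And>x. 0 \<le> \<alpha> x" "\<And>x. \<alpha> x \<le> 1"
    "\<And>r. s - \<delta> \<le> r \<Longrightarrow> r \<le> s + 2 * \<delta> \<Longrightarrow> \<alpha> (\<gamma> r) = 1"
    "\<And>r. r \<in> {0..a} \<Longrightarrow> r \<le> s - 2 * \<delta> \<or> s + 3 * \<delta> \<le> r \<Longrightarrow> \<alpha> (\<gamma> r) = 0"
    using plateau[OF pre1] by blast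
  have pre2: "0 < s + \<delta>" "s + \<delta> < s + 2 * \<delta>" "s + 2 * \<delta> \<le> t - 2 * \<delta>" "t - 2 * \<delta> < t - \<delta>" "t - \<delta> < a"
    using \<delta> sd te by linarith+
  obtain \<kappa> where \<kappa>: "\<kappa> \<in> LIP" "\<And>x. 0 \<le> \<kappa> x" "\<And>x. \<kappa> x \<le> 1"
    "\<And>r. s + 2 * \<delta> \<le> r \<Longrightarrow> r \<le> t - 2 * \<delta> \<Longrightarrow> \<kappa> (\<gamma> r) = 1"
    "\<And>r. r \<in> {0..a} \<Longrightarrow> r \<le> s + \<delta> \<or> t - \<delta> \<le> r \<Longrightarrow> \<kappa> (\<gamma> r) = 0"
    using plateau[OF pre2] by blast
  have pre3: "0 < t - 3 * \<delta>" "t - 3 * \<delta> < t - 2 * \<delta>" "t - 2 * \<delta> \<le> t + \<delta>" "t + \<delta> < t + 2 * \<delta>" "t + 2 * \<delta> < a"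
    using \<delta> te by linarith+
  obtain \<beta> where \<beta>: "\<beta> \<in> LIP" "\<And>x. 0 \<le> \<beta> x" "\<And>x. \<beta> x \<le> 1"
    "\<And>r. t - 2 * \<delta> \<le> r \<Longrightarrow> r \<le> t + \<delta> \<Longrightarrow> \<beta> (\<gamma> r) = 1"
    "\<And>r. r \<in> {0..a} \<Longrightarrow> r \<le> t - 3 * \<delta> \<or> t + 2 * \<delta> \<le> r \<Longrightarrow> \<beta> (\<gamma> r) = 0"
    using plateau[OF pre3] by blast
  let ?u = "ramp g c s \<delta>" and ?v = "ramp h b t \<delta>"
  define F where "F = (\<lambda>x. max (min (?u x) (\<alpha> x)) (max (\<kappa> x) (min (1 - ?v x) (\<beta> x))))"
  have bounds: "0 \<le> ?u x" "?u x \<le> 1" "0 \<le> ?v x" "?v x \<le> 1" for x using ramp_bounds by auto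
  note uv = ramp_values[OF s \<delta>(1)] ramp_values[OF t \<delta>(1)]
  have F01: "0 \<le> F x" "F x \<le> 1" for x
    using bounds[of x] \<alpha>(2,3)[of x] \<kappa>(2,3)[of x] \<beta>(2,3)[of x] by (auto simp: F_def)
  have FL: "F \<in> LIP" unfolding F_def
    by (intro LIP_max LIP_min LIP_diff LIP_const \<alpha>(1) \<kappa>(1) \<beta>(1) ramp_LIP(1) sd te \<delta>(1))
  show ?thesis
  proof (rule that[of F])
    show "F \<in> LIPb" by (rule LIPbI[OF FL, of 1]) (use F01 in auto)
    show "0 \<le> F x" "F x \<le> 1" for x using F01 by auto
    show "F (\<gamma> r) = 0" if r: "r \<in> {0..a}" "r \<le> s - \<delta> \<or> t + \<delta> \<le> r" for r
    proof -
      have "\<kappa> (\<gamma> r) = 0" using \<kappa>(5) r \<delta> by auto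
      moreover have "?u (\<gamma> r) = 0 \<or> \<alpha> (\<gamma> r) = 0"
        using uv(2)[of r] \<alpha>(5)[of r] r \<delta> by (cases "r \<le> s - 2 * \<delta>") auto
      moreover have "?v (\<gamma> r) = 1 \<or> \<beta> (\<gamma> r) = 0"
        using uv(3)[of r] \<beta>(5)[of r] r \<delta> by (cases "t + 2 * \<delta> \<le> r") auto
      ultimately show ?thesis
        using bounds[of "\<gamma> r"] \<alpha>(2)[of "\<gamma> r"] \<beta>(2)[of "\<gamma> r"] by (auto simp: F_def)
    qed
    show "F (\<gamma> r) = 1" if r: "s + \<delta> \<le> r" "r \<le> t - \<delta>" for r
    proof -
      consider "r \<le> s + 2 * \<delta>" | "s + 2 * \<delta> \<le> r" "r \<le> t - 2 * \<delta>" | "t - 2 * \<delta> \<le> r" using r by linarith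
      then have "1 \<le> F (\<gamma> r)"
      proof cases
        case 1 then show ?thesis using uv(1)[of r] \<alpha>(4)[of r] r \<delta> by (simp add: F_def)
      next
        case 2 then show ?thesis using \<kappa>(4)[of r] by (simp add: F_def)
      next
        case 3 then show ?thesis using uv(4)[of r] \<beta>(4)[of r] r \<delta> by (simp add: F_def)
      qed
      then show ?thesis using F01(2)[of "\<gamma> r"] by simp
    qed
    show "F (\<gamma> r) = ?u (\<gamma> r)" if r: "\<bar>r - s\<bar> \<le> \<delta>" for r
    proof -
      have "r \<in> {0..a}" "s - \<delta> \<le> r" "r \<le> s + 2 * \<delta>" "r \<le> s + \<delta>" "r \<le> t - 3 * \<delta>"
        using r \<delta> sd by auto
      then have "\<alpha> (\<gamma> r) = 1" "\<kappa> (\<gamma> r) = 0" "\<beta> (\<gamma> r) = 0"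
        using \<alpha>(4)[of r] \<kappa>(5)[of r] \<beta>(5)[of r] by simp_all
      then show ?thesis using bounds[of "\<gamma> r"] by (simp add: F_def)
    qed
    show "F (\<gamma> r) = 1 - ?v (\<gamma> r)" if r: "\<bar>r - t\<bar> \<le> \<delta>" for r
    proof -
      have "r \<in> {0..a}" "t - 2 * \<delta> \<le> r" "r \<le> t + \<delta>" "t - \<delta> \<le> r" "s + 3 * \<delta> \<le> r"
        using r \<delta> te by auto
      then have "\<alpha> (\<gamma> r) = 0" "\<kappa> (\<gamma> r) = 0" "\<beta> (\<gamma> r) = 1"
        using \<alpha>(5)[of r] \<kappa>(5)[of r] \<beta>(4)[of r] by simp_all
      then show ?thesis using bounds[of "\<gamma> r"] by (simp add: F_def)
    qed
  qed
qed

end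

context current_on_arc
begin

lemma space_mu: "space \<mu> = UNIV"
  using sets_eq_imp_space_eq[OF sets_mu] by simp

lemma arc_iff:
  assumes "0 < u" "v < a" "r \<in> {0..a}"
  shows "\<gamma> r \<in> \<gamma> ` {u..v} \<longleftrightarrow> u \<le> r \<and> r \<le> v"
proof
  assume "\<gamma> r \<in> \<gamma> ` {u..v}"
  then obtain q where q: "u \<le> q" "q \<le> v" "\<gamma> r = \<gamma> q" by auto
  have "r = q"
    using curve_inj[of r q] curve_inj[of q r] q assms by (cases r q rule: linorder_cases) auto
  then show "u \<le> r \<and> r \<le> v" using q by simp
qed auto

lemma window_eq: "0 \<le> s - \<delta> \<Longrightarrow> s + \<delta> \<le> a \<Longrightarrow> window s \<delta> = \<gamma> ` {s - \<delta>..s + \<delta>}"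
  unfolding window_def by (rule arg_cong[where f="image \<gamma>"]) auto

lemma steep_exists:
  assumes "0 \<le> x" "x < y" "y \<le> a" shows "\<exists>g c d s. x < s \<and> s < y \<and> steep g c d s"
  by (rule steep_dense[OF assms]) (intro exI conjI; assumption)

section \<open>The weight of the current at a steep parameter\<close>

text \<open>A mollified slice of the current by \<open>g\<close> at \<open>\<gamma> s\<close>; its
  limit as \<delta> tends to 0 is the multiplicity.\<close>

definition crossing :: "('a \<Rightarrow> real) \<Rightarrow> real \<Rightarrow> real \<Rightarrow> real \<Rightarrow> real" where
  "crossing g c s \<delta> = \<Lambda> (indicator (window s \<delta>)) (ramp g c s \<delta>)"

text \<open>On the window \<open>p\<close> differs from \<open>p (\<gamma> s)\<close> by at most
  \<open>Lip p * (C * \<delta>)\<close>, and the ramp has constant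
  \<open>Lip g / (2 * c * \<delta>)\<close>. The factors \<delta> cancel, and the mass of the window
  is left.\<close>

lemma window_term:
  assumes st: "steep g c d s" and \<delta>: "0 < \<delta>" "\<delta> < d" and p: "p \<in> LIPb"
  shows "\<bar>\<Lambda> (\<lambda>x. indicator (window s \<delta>) x * p x) (ramp g c s \<delta>) - p (\<gamma> s) * crossing g c s \<delta>\<bar>
    \<le> Lip p * (C * Lip g / (2 * c)) * measure \<mu> (window s \<delta>)"
proof -
  let ?W = "window s \<delta>" and ?u = "ramp g c s \<delta>"
  have g: "g \<in> LIP" "0 < c" "d \<le> s" "s + d \<le> a" using st by (auto simp: steep_def)
  have u: "?u \<in> LIP" "Lip ?u \<le> Lip g / (2 * c * \<delta>)" using ramp_LIP[OF g(1,2) \<delta>(1)] by auto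
  have iW: "integrable \<mu> (indicat_real ?W)" by (rule integrable_indicator[OF window_borel])
  have iWp: "integrable \<mu> (\<lambda>x. indicator ?W x * p x)"
    by (rule integrable_indicator_mult[OF window_borel integrable_LIPb[OF p]])
  have iWc: "integrable \<mu> (\<lambda>x. p (\<gamma> s) * indicator ?W x)" using iW by simp
  have pL: "p \<in> LIP" by (rule LIPbD[OF p])
  have pt: "\<bar>indicator ?W x * p x - p (\<gamma> s) * indicator ?W x\<bar> \<le> (Lip p * (C * \<delta>)) * indicator ?W x" for x
  proof (cases "x \<in> ?W")
    case True
    then obtain r where r: "x = \<gamma> r" "r \<in> {0..a}" "\<bar>r - s\<bar> \<le> \<delta>" unfolding window_def by (auto simp: abs_le_iff)
    have "s \<in> {0..a}" using g \<delta> by auto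
    then have "dist x (\<gamma> s) \<le> C * \<bar>r - s\<bar>" unfolding r(1) by (rule curve_dist[OF r(2)])
    also have "\<dots> \<le> C * \<delta>" by (rule mult_left_mono[OF r(3) C_nonneg])
    finally have "Lip p * dist x (\<gamma> s) \<le> Lip p * (C * \<delta>)" by (rule mult_left_mono[OF _ Lip_nonneg[OF pL]])
    then show ?thesis using Lip_bound[OF pL, of x "\<gamma> s"] True by simp
  qed simp
  have "\<bar>\<Lambda> (\<lambda>x. indicator ?W x * p x) ?u - \<Lambda> (\<lambda>x. p (\<gamma> s) * indicator ?W x) ?u\<bar>
      \<le> Lip ?u * (\<integral>x. \<bar>indicator ?W x * p x - p (\<gamma> s) * indicator ?W x\<bar> \<partial>\<mu>)"
    by (rule left_diff[OF u(1) iWp iWc])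
  also have "\<dots> \<le> Lip ?u * (\<integral>x. (Lip p * (C * \<delta>)) * indicator ?W x \<partial>\<mu>)"
    by (intro mult_left_mono integral_mono Lip_nonneg u(1)) (use pt iWp iWc iW in auto)
  also have "\<dots> = Lip ?u * ((Lip p * (C * \<delta>)) * measure \<mu> ?W)"
    by (simp add: space_mu)
  also have "\<dots> \<le> Lip g / (2 * c * \<delta>) * ((Lip p * (C * \<delta>)) * measure \<mu> ?W)"
    using \<delta> C_nonneg Lip_nonneg[OF pL] by (intro mult_right_mono u(2)) auto
  also have "\<dots> = Lip p * (C * Lip g / (2 * c)) * measure \<mu> ?W"
    using \<delta> g by (simp add: field_simps)
  finally show ?thesis by (simp add: left_scale[OF u(1) iW] crossing_def)
qed

text \<open>Apply the Leibniz rule to \<open>p\<close> and the step function \<open>F\<close>: the right-hand side vanishes, and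
  \<open>\<Lambda> p F\<close> only sees the two short arcs on which \<open>F\<close> is not locally constant. There \<open>p\<close> oscillates by
  \<open>O(\<delta>)\<close> while \<open>Lip F = O(1 / \<delta>)\<close>.\<close>

lemma crossing_estimate:
  assumes s: "steep g c d s" and t: "steep h b e t" and \<delta>: "0 < \<delta>" "3 * \<delta> < d" "3 * \<delta> < e" "6 * \<delta> < t - s"
  shows "crossing g c s \<delta> = crossing h b t \<delta>"
    and "p \<in> LIPb \<Longrightarrow> \<bar>\<Lambda> (indicator (\<gamma> ` {s..t})) p - crossing g c s \<delta> * (p (\<gamma> t) - p (\<gamma> s))\<bar>
      \<le> Lip p * (C * Lip g / (2 * c) + 1) * measure \<mu> (window s \<delta>) + Lip p * (C * Lip h / (2 * b) + 1) * measure \<mu> (window t \<delta>)"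
proof -
  let ?S = "window s \<delta>" and ?T = "window t \<delta>" and ?u = "ramp g c s \<delta>" and ?v = "ramp h b t \<delta>"
  obtain F where F: "F \<in> LIPb" "\<And>x. 0 \<le> F x" "\<And>x. F x \<le> 1"
    "\<And>r. r \<in> {0..a} \<Longrightarrow> r \<le> s - \<delta> \<or> t + \<delta> \<le> r \<Longrightarrow> F (\<gamma> r) = 0"
    "\<And>r. s + \<delta> \<le> r \<Longrightarrow> r \<le> t - \<delta> \<Longrightarrow> F (\<gamma> r) = 1"
    "\<And>r. \<bar>r - s\<bar> \<le> \<delta> \<Longrightarrow> F (\<gamma> r) = ?u (\<gamma> r)"
    "\<And>r. \<bar>r - t\<bar> \<le> \<delta> \<Longrightarrow> F (\<gamma> r) = 1 - ?v (\<gamma> r)"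
    using step_function[OF s t \<delta>] by blast
  have g: "g \<in> LIP" "0 < c" "d \<le> s" "s + d \<le> a" and h: "h \<in> LIP" "0 < b" "e \<le> t" "t + e \<le> a"
    using s t by (auto simp: steep_def)
  have u: "?u \<in> LIP" and v: "?v \<in> LIP" by (intro ramp_LIP g h \<delta>(1))+
  have FL: "F \<in> LIP" by (rule LIPbD[OF F(1)])
  have Sin: "\<gamma> r \<in> ?S \<longleftrightarrow> \<bar>r - s\<bar> \<le> \<delta>" and Tin: "\<gamma> r \<in> ?T \<longleftrightarrow> \<bar>r - t\<bar> \<le> \<delta>"
    and Iin: "\<gamma> r \<in> \<gamma> ` {s..t} \<longleftrightarrow> s \<le> r \<and> r \<le> t" if "r \<in> {0..a}" for r
  proof -
    have "?S = \<gamma> ` {s - \<delta>..s + \<delta>}" "?T = \<gamma> ` {t - \<delta>..t + \<delta>}"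
      by (rule window_eq; use g h \<delta> in linarith)+
    moreover have "0 < s - \<delta>" "s + \<delta> < a" "0 < t - \<delta>" "t + \<delta> < a" using g h \<delta> by linarith+
    ultimately show "\<gamma> r \<in> ?S \<longleftrightarrow> \<bar>r - s\<bar> \<le> \<delta>" "\<gamma> r \<in> ?T \<longleftrightarrow> \<bar>r - t\<bar> \<le> \<delta>"
      using arc_iff[OF _ _ that] by (auto simp: abs_le_iff)
    show "\<gamma> r \<in> \<gamma> ` {s..t} \<longleftrightarrow> s \<le> r \<and> r \<le> t" by (rule arc_iff[OF _ _ that]) (use g h \<delta> in linarith)+
  qed
  have near: "\<bar>\<Lambda> q F - (q (\<gamma> s) * crossing g c s \<delta> - q (\<gamma> t) * crossing h b t \<delta>)\<bar>
      \<le> Lip q * (C * Lip g / (2 * c)) * measure \<mu> ?S + Lip q * (C * Lip h / (2 * b)) * measure \<mu> ?T"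
    if q: "q \<in> LIPb" for q
  proof -
    have iq: "integrable \<mu> q" by (rule integrable_LIPb[OF q])
    have iS: "integrable \<mu> (\<lambda>x. indicator ?S x * q x)" and iT: "integrable \<mu> (\<lambda>x. indicator ?T x * q x)"
      by (intro integrable_indicator_mult window_borel iq)+
    \<comment> \<open>Off the two windows \<open>F\<close> is 0 or 1 along the curve, so this part
      of \<open>q\<close> contributes nothing; on the windows \<open>F\<close> may be replaced by a
      ramp.\<close>
    let ?R = "\<lambda>x. q x - indicator ?S x * q x - indicator ?T x * q x"
    have iR: "integrable \<mu> ?R" using iq iS iT by simp
    have iST: "integrable \<mu> (\<lambda>x. indicator ?S x * q x + indicator ?T x * q x)" using iS iT by simp
    have R0: "\<Lambda> ?R F = 0"
    proof (rule local_01[OF FL iR])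
      show "AE x in \<mu>. ?R x \<noteq> 0 \<longrightarrow> F x = 0 \<or> F x = 1"
        using concentrated
      proof eventually_elim
        case (elim x)
        then obtain r where r: "x = \<gamma> r" "r \<in> {0..a}" by blast
        show ?case
        proof
          assume "?R x \<noteq> 0"
          then have "\<not> (\<bar>r - s\<bar> \<le> \<delta> \<and> \<not> \<bar>r - t\<bar> \<le> \<delta>)" "\<not> (\<bar>r - t\<bar> \<le> \<delta> \<and> \<not> \<bar>r - s\<bar> \<le> \<delta>)"
            using Sin[OF r(2)] Tin[OF r(2)] r(1) by (auto simp: indicator_def)
          then have "r \<le> s - \<delta> \<or> t + \<delta> \<le> r \<or> (s + \<delta> \<le> r \<and> r \<le> t - \<delta>)" using \<delta> by linarith
          then show "F x = 0 \<or> F x = 1" using F(4)[OF r(2)] F(5)[of r] r(1) by blast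
        qed
      qed
    qed
    have "\<Lambda> q F = \<Lambda> ?R F + \<Lambda> (\<lambda>x. indicator ?S x * q x + indicator ?T x * q x) F"
      by (rule left_add[OF FL iq iR iST]) simp
    moreover have "\<Lambda> (\<lambda>x. indicator ?S x * q x + indicator ?T x * q x) F
        = \<Lambda> (\<lambda>x. indicator ?S x * q x) F + \<Lambda> (\<lambda>x. indicator ?T x * q x) F"
      by (rule left_add[OF FL iST iS iT]) simp
    moreover have "\<Lambda> (\<lambda>x. indicator ?S x * q x) F = 1 * \<Lambda> (\<lambda>x. indicator ?S x * q x) ?u"
    proof (rule right_cong[OF FL u iS, where c=0])
      show "AE x in \<mu>. indicator ?S x * q x \<noteq> 0 \<longrightarrow> F x = 1 * ?u x + 0"
        using concentrated by eventually_elim (use Sin F(6) in \<open>auto simp: indicator_def\<close>)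
    qed
    moreover have "\<Lambda> (\<lambda>x. indicator ?T x * q x) F = -1 * \<Lambda> (\<lambda>x. indicator ?T x * q x) ?v"
    proof (rule right_cong[OF FL v iT, where c=1])
      show "AE x in \<mu>. indicator ?T x * q x \<noteq> 0 \<longrightarrow> F x = -1 * ?v x + 1"
        using concentrated by eventually_elim (use Tin F(7) in \<open>auto simp: indicator_def\<close>)
    qed
    ultimately have "\<Lambda> q F = \<Lambda> (\<lambda>x. indicator ?S x * q x) ?u - \<Lambda> (\<lambda>x. indicator ?T x * q x) ?v"
      using R0 by simp
    moreover have "\<delta> < d" "\<delta> < e" using \<delta> by linarith+
    ultimately show ?thesis
      using window_term[OF s \<delta>(1) _ q] window_term[OF t \<delta>(1) _ q] by linarith
  qed
  have end0: "F (\<gamma> 0) = 0" "F (\<gamma> a) = 0"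
    using F(4)[of 0] F(4)[of a] length_pos g h \<delta> by auto
  have one: "\<Lambda> (\<lambda>_. 1) F = 0" by (rule boundary_endpoints[OF F(1) end0])
  \<comment> \<open>For \<open>q = 1\<close> the error bound in \<open>near\<close> is exactly 0, so
    the weights at \<open>s\<close> and \<open>t\<close> coincide for each admissible \<delta>, not
    merely in the limit.\<close>
  have Lip1: "Lip (\<lambda>_::'a. 1) = 0"
    by (rule antisym[OF Lip_leI[of 0] Lip_nonneg[OF LIP_const]]) auto
  show eq: "crossing g c s \<delta> = crossing h b t \<delta>"
    using near[OF LIPb_const[of 1]] one Lip1 by simp
  assume p: "p \<in> LIPb"
  have pL: "p \<in> LIP" by (rule LIPbD[OF p])
  have "\<Lambda> (\<lambda>_. 1) (\<lambda>x. F x * p x) = 0"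
    by (rule boundary_endpoints[OF LIPb_mult[OF F(1) p]]) (simp_all add: end0)
  then have anti: "\<Lambda> F p = - \<Lambda> p F" using Leibniz[OF F(1) p] by simp
  have iF: "integrable \<mu> F" by (rule integrable_LIPb[OF F(1)])
  have Ib: "\<gamma> ` {s..t} \<in> sets borel" by (rule arc_borel) (use g h \<delta> in linarith)+
  have iI: "integrable \<mu> (indicat_real (\<gamma> ` {s..t}))" by (rule integrable_indicator[OF Ib])
  have iW: "integrable \<mu> (indicat_real ?S)" "integrable \<mu> (indicat_real ?T)"
    by (intro integrable_indicator window_borel)+
  have "\<bar>\<Lambda> (indicator (\<gamma> ` {s..t})) p - \<Lambda> F p\<bar> \<le> Lip p * (\<integral>x. \<bar>indicator (\<gamma> ` {s..t}) x - F x\<bar> \<partial>\<mu>)"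
    by (rule left_diff[OF pL iI iF])
  also have "(\<integral>x. \<bar>indicator (\<gamma> ` {s..t}) x - F x\<bar> \<partial>\<mu>) \<le> (\<integral>x. indicator ?S x + indicator ?T x \<partial>\<mu>)"
  proof (rule integral_mono_AE)
    show "AE x in \<mu>. \<bar>indicator (\<gamma> ` {s..t}) x - F x\<bar> \<le> indicator ?S x + indicator ?T x"
      using concentrated
    proof eventually_elim
      case (elim x)
      then obtain r where r: "x = \<gamma> r" "r \<in> {0..a}" by blast
      consider "\<bar>r - s\<bar> \<le> \<delta>" | "\<bar>r - t\<bar> \<le> \<delta>" | "r < s - \<delta> \<or> t + \<delta> < r" | "s + \<delta> < r" "r < t - \<delta>" by linarith
      then show ?case
      proof cases
        case 1 then show ?thesis using F(2,3)[of x] Sin[OF r(2)] r(1) by (auto simp: indicator_def)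
      next
        case 2 then show ?thesis using F(2,3)[of x] Tin[OF r(2)] r(1) by (auto simp: indicator_def)
      next
        case 3
        then have "F x = 0" using F(4)[OF r(2)] r(1) by auto
        moreover have "x \<notin> \<gamma> ` {s..t}" using Iin[OF r(2)] r(1) 3 \<delta>(1) by auto
        ultimately show ?thesis by simp
      next
        case 4
        then have "F x = 1" using F(5)[of r] r(1) by auto
        moreover have "x \<in> \<gamma> ` {s..t}" using Iin[OF r(2)] r(1) 4 \<delta>(1) by auto
        ultimately show ?thesis by simp
      qed
    qed
  qed (use iF iI iW in auto)
  also have "(\<integral>x. indicator ?S x + indicator ?T x \<partial>\<mu>) = measure \<mu> ?S + measure \<mu> ?T"
    using iW by (simp add: space_mu)
  finally have diff: "\<bar>\<Lambda> (indicator (\<gamma> ` {s..t})) p - \<Lambda> F p\<bar> \<le> Lip p * (measure \<mu> ?S + measure \<mu> ?T)"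
    by (simp add: Lip_nonneg[OF pL] mult_left_mono)
  \<comment> \<open>The summand 1 in each constant pays for replacing \<open>F\<close> by the
    indicator of the arc; the rest comes from \<open>near\<close>. The sign is turned by
    \<open>\<Lambda> F p = - \<Lambda> p F\<close>.\<close>
  show "\<bar>\<Lambda> (indicator (\<gamma> ` {s..t})) p - crossing g c s \<delta> * (p (\<gamma> t) - p (\<gamma> s))\<bar>
      \<le> Lip p * (C * Lip g / (2 * c) + 1) * measure \<mu> ?S + Lip p * (C * Lip h / (2 * b) + 1) * measure \<mu> ?T"
    using diff near[OF p] anti eq by (simp add: algebra_simps abs_le_iff)
qed

lemma crossing_limit:
  assumes s: "steep g c d s" and t: "steep h b e t" and st: "s < t"
  shows "\<forall>\<^sub>F \<delta> in at_right 0. crossing g c s \<delta> = crossing h b t \<delta>"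
    and "p \<in> LIPb \<Longrightarrow> ((\<lambda>\<delta>. crossing g c s \<delta> * (p (\<gamma> t) - p (\<gamma> s))) \<longlongrightarrow> \<Lambda> (indicator (\<gamma> ` {s..t})) p) (at_right 0)"
proof -
  have pos: "0 < d" "0 < e" and sa: "s \<in> {0..a}" "t \<in> {0..a}" using s t by (auto simp: steep_def)
  define m where "m = min (d / 3) (min (e / 3) ((t - s) / 6))"
  have m: "0 < m" using pos st by (simp add: m_def)
  have ev: "\<forall>\<^sub>F \<delta> in at_right 0. 0 < \<delta> \<and> 3 * \<delta> < d \<and> 3 * \<delta> < e \<and> 6 * \<delta> < t - s"
    unfolding eventually_at_right_field by (rule exI[of _ m]) (use m in \<open>auto simp: m_def\<close>)
  show "\<forall>\<^sub>F \<delta> in at_right 0. crossing g c s \<delta> = crossing h b t \<delta>"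
    using ev by eventually_elim (rule crossing_estimate(1)[OF s t]; simp)
  assume p: "p \<in> LIPb"
  let ?E = "\<lambda>\<delta>. Lip p * (C * Lip g / (2 * c) + 1) * measure \<mu> (window s \<delta>) + Lip p * (C * Lip h / (2 * b) + 1) * measure \<mu> (window t \<delta>)"
  have "(?E \<longlongrightarrow> Lip p * (C * Lip g / (2 * c) + 1) * 0 + Lip p * (C * Lip h / (2 * b) + 1) * 0) (at_right 0)"
    by (intro tendsto_intros window_measure_tendsto_0 sa)
  then have E0: "(?E \<longlongrightarrow> 0) (at_right 0)" by simp
  have "((\<lambda>\<delta>. crossing g c s \<delta> * (p (\<gamma> t) - p (\<gamma> s)) - \<Lambda> (indicator (\<gamma> ` {s..t})) p) \<longlongrightarrow> 0) (at_right 0)"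
  proof (rule Lim_null_comparison[OF _ E0])
    show "\<forall>\<^sub>F \<delta> in at_right 0. norm (crossing g c s \<delta> * (p (\<gamma> t) - p (\<gamma> s)) - \<Lambda> (indicator (\<gamma> ` {s..t})) p) \<le> ?E \<delta>"
      using ev
    proof eventually_elim
      case (elim \<delta>)
      then show ?case using crossing_estimate(2)[OF s t _ _ _ _ p, of \<delta>] by (simp add: abs_minus_commute)
    qed
  qed
  then show "((\<lambda>\<delta>. crossing g c s \<delta> * (p (\<gamma> t) - p (\<gamma> s))) \<longlongrightarrow> \<Lambda> (indicator (\<gamma> ` {s..t})) p) (at_right 0)"
    by (simp add: LIM_zero_iff)
qed

text \<open>Convergence of the weights is not clear in advance. For one pair of steep parameters and
  a \<open>p0\<close> that separates their points, the products with
  \<open>p0 (\<gamma> t0) - p0 (\<gamma> s0)\<close> converge, and division yields the limit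
  \<open>k\<close>.\<close>

lemma crossing_constant:
  obtains k where "\<And>g c d s h b e t p. steep g c d s \<Longrightarrow> steep h b e t \<Longrightarrow> s < t \<Longrightarrow> p \<in> LIPb \<Longrightarrow>
    \<Lambda> (indicator (\<gamma> ` {s..t})) p = k * (p (\<gamma> t) - p (\<gamma> s))"
proof -
  obtain g0 c0 d0 s0 where s0: "0 < s0" "s0 < a" "steep g0 c0 d0 s0"
    using steep_exists[of 0 a] length_pos by blast
  obtain h0 b0 e0 t0 where t0: "s0 < t0" "t0 < a" "steep h0 b0 e0 t0"
    using steep_exists[of s0 a] s0 by (meson less_imp_le order_refl)
  define p0 where "p0 = (\<lambda>x. min 1 (dist (\<gamma> s0) x))"
  have p0: "p0 \<in> LIPb" unfolding p0_def
    by (rule LIPbI[OF LIP_min[OF LIP_const LIP_dist], of _ _ 1]) auto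
  have "\<gamma> s0 \<noteq> \<gamma> t0" using curve_inj[of s0 t0] s0 t0 by auto
  then have p0t: "p0 (\<gamma> t0) - p0 (\<gamma> s0) \<noteq> 0" by (simp add: p0_def min_def)
  define k where "k = \<Lambda> (indicator (\<gamma> ` {s0..t0})) p0 / (p0 (\<gamma> t0) - p0 (\<gamma> s0))"
  have "((\<lambda>\<delta>. crossing g0 c0 s0 \<delta> * (p0 (\<gamma> t0) - p0 (\<gamma> s0)) / (p0 (\<gamma> t0) - p0 (\<gamma> s0))) \<longlongrightarrow> k) (at_right 0)"
    unfolding k_def by (intro tendsto_divide tendsto_const crossing_limit(2)[OF s0(3) t0(3,1) p0] p0t)
  then have k0: "((\<lambda>\<delta>. crossing g0 c0 s0 \<delta>) \<longlongrightarrow> k) (at_right 0)" using p0t by simp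
  have lim: "((\<lambda>\<delta>. crossing g c s \<delta>) \<longlongrightarrow> k) (at_right 0)" if st: "steep g c d s" for g c d s
  proof -
    have "s < a" using st by (auto simp: steep_def)
    \<comment> \<open>Weights are compared only for parameters in increasing order, so
      \<open>s\<close> and \<open>s0\<close> are both compared with a later steep parameter.\<close>
    then have "0 \<le> max s s0" "max s s0 < a" using s0 by auto
    then obtain h b e t where t: "max s s0 < t" "steep h b e t"
      using steep_exists[of "max s s0" a] by blast
    have "\<forall>\<^sub>F \<delta> in at_right 0. crossing g0 c0 s0 \<delta> = crossing g c s \<delta>"
      using crossing_limit(1)[OF st t(2)] crossing_limit(1)[OF s0(3) t(2)] t(1) by (auto elim: eventually_elim2)
    then show ?thesis using k0 by (rule Lim_transform_eventually[rotated])
  qed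
  show ?thesis
  proof (rule that)
    fix g h p :: "'a \<Rightarrow> real" and c d s b e t assume s: "steep g c d s" and t: "steep h b e t" and st: "s < t" and p: "p \<in> LIPb"
    have "((\<lambda>\<delta>. crossing g c s \<delta> * (p (\<gamma> t) - p (\<gamma> s))) \<longlongrightarrow> k * (p (\<gamma> t) - p (\<gamma> s))) (at_right 0)"
      by (intro tendsto_mult lim[OF s] tendsto_const)
    then show "\<Lambda> (indicator (\<gamma> ` {s..t})) p = k * (p (\<gamma> t) - p (\<gamma> s))"
      using crossing_limit(2)[OF s t st p] tendsto_unique[OF trivial_limit_at_right_real] by blast
  qed
qed

end

lemma integral_bound_spike:
  fixes f :: "real \<Rightarrow> real"
  assumes "f integrable_on {s..t}" "negligible N" "\<And>x. x \<in> {s..t} - N \<Longrightarrow> \<bar>f x\<bar> \<le> B" "0 \<le> B" "s \<le> t"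
  shows "\<bar>integral {s..t} f\<bar> \<le> B * (t - s)"
proof -
  define g where "g = (\<lambda>x. if x \<in> N then 0 else f x)"
  have g: "g integrable_on {s..t}" by (rule integrable_spike[OF assms(1,2)]) (simp add: g_def)
  have "integral {s..t} f = integral {s..t} g" by (rule integral_spike[OF assms(2)]) (simp add: g_def)
  moreover have "norm (integral {s..t} g) \<le> integral {s..t} (\<lambda>_. B)"
    by (rule Henstock_Kurzweil_Integration.integral_norm_bound_integral[OF g integrable_const_ivl])
      (use assms(3,4) in \<open>auto simp: g_def\<close>)
  ultimately show ?thesis using assms(5) by (simp add: mult.commute)
qed

context current_on_arc
begin

section \<open>From arcs with steep endpoints to the whole current\<close>

lemma arc_iff_interior:
  assumes "0 < q" "q < a" "0 \<le> u" "v \<le> a"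
  shows "\<gamma> q \<in> \<gamma> ` {u..v} \<longleftrightarrow> u \<le> q \<and> q \<le> v"
proof
  assume "\<gamma> q \<in> \<gamma> ` {u..v}"
  then obtain r where r: "u \<le> r" "r \<le> v" "\<gamma> q = \<gamma> r" by auto
  have "\<not> r < q" using curve_inj[of r q] r assms by force
  moreover have "\<not> q < r" using curve_inj[of q r] r assms by force
  ultimately have "r = q" by simp
  then show "u \<le> q \<and> q \<le> v" using r by simp
qed auto

text \<open>The two endpoints are null, so almost every point has an interior parameter, which is
  unique even on a loop.\<close>

lemma AE_interior: "finite N \<Longrightarrow> AE x in \<mu>. \<exists>q. x = \<gamma> q \<and> 0 < q \<and> q < a \<and> x \<notin> N"
proof -
  assume "finite N"
  then have "AE x in \<mu>. x \<notin> N \<union> {\<gamma> 0, \<gamma> a}" by (intro null_finite) auto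
  with concentrated show ?thesis
  proof eventually_elim
    case (elim x)
    then obtain q where q: "x = \<gamma> q" "0 \<le> q" "q \<le> a" by auto
    then have "q \<noteq> 0" "q \<noteq> a" using elim(2) by auto
    then show ?case using q elim(2) by (intro exI[of _ q]) auto
  qed
qed

lemma arc_split_AE:
  assumes "0 \<le> r" "r \<le> s" "s \<le> t" "t \<le> a"
  shows "AE x in \<mu>. indicat_real (\<gamma> ` {r..t}) x = indicator (\<gamma> ` {r..s}) x + indicator (\<gamma> ` {s..t}) x"
proof -
  have "AE x in \<mu>. \<exists>q. x = \<gamma> q \<and> 0 < q \<and> q < a \<and> x \<notin> {\<gamma> s}" by (rule AE_interior) simp
  then show ?thesis
  proof eventually_elim
    case (elim x)
    then obtain q where q: "x = \<gamma> q" "0 < q" "q < a" "q \<noteq> s" by auto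
    have "x \<in> \<gamma> ` {u..v} \<longleftrightarrow> u \<le> q \<and> q \<le> v" if "0 \<le> u" "v \<le> a" for u v
      unfolding q(1) by (rule arc_iff_interior[OF q(2,3) that])
    then show ?case using assms q(4) by (auto simp: indicator_def)
  qed
qed

lemma integrable_arc:
  fixes f :: "'a \<Rightarrow> real"
  shows "0 \<le> s \<Longrightarrow> t \<le> a \<Longrightarrow> integrable \<mu> f \<Longrightarrow> integrable \<mu> (\<lambda>x. indicator (\<gamma> ` {s..t}) x * f x)"
  by (rule integrable_indicator_mult[OF arc_borel])

lemma integrable_arc_indicator: "0 \<le> s \<Longrightarrow> t \<le> a \<Longrightarrow> integrable \<mu> (indicat_real (\<gamma> ` {s..t}))"
  by (rule integrable_indicator[OF arc_borel])

lemma arc_additive: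
  assumes p: "p \<in> LIP" and f: "integrable \<mu> f" and "0 \<le> r" "r \<le> s" "s \<le> t" "t \<le> a"
  shows "\<Lambda> (\<lambda>x. indicator (\<gamma> ` {r..t}) x * f x) p =
    \<Lambda> (\<lambda>x. indicator (\<gamma> ` {r..s}) x * f x) p + \<Lambda> (\<lambda>x. indicator (\<gamma> ` {s..t}) x * f x) p"
proof (rule left_add[OF p])
  show "AE x in \<mu>. indicator (\<gamma> ` {r..t}) x * f x = indicator (\<gamma> ` {r..s}) x * f x + indicator (\<gamma> ` {s..t}) x * f x"
    using arc_split_AE[OF assms(3-6)] by eventually_elim (simp add: distrib_right)
qed (use assms in \<open>auto intro!: integrable_arc\<close>)

lemma arc_additive_1:
  assumes p: "p \<in> LIP" and "0 \<le> r" "r \<le> s" "s \<le> t" "t \<le> a"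
  shows "\<Lambda> (indicator (\<gamma> ` {r..t})) p = \<Lambda> (indicator (\<gamma> ` {r..s})) p + \<Lambda> (indicator (\<gamma> ` {s..t})) p"
  using arc_additive[OF p integrable_LIPb[OF LIPb_const[of 1]] assms(2-5)] by simp

text \<open>The indicators converge at every point of an interior parameter other than
  \<open>t\<close>, and the points left out are null.\<close>

lemma arc_continuous:
  assumes p: "p \<in> LIP" and t: "t \<in> {0..a}" "\<And>n. s n \<in> {0..a}" "s \<longlonglongrightarrow> t"
  shows "(\<lambda>n. \<Lambda> (indicator (\<gamma> ` {0..s n})) p) \<longlonglongrightarrow> \<Lambda> (indicator (\<gamma> ` {0..t})) p"
proof (rule left_lim[OF p])
  show i: "integrable \<mu> (indicat_real (\<gamma> ` {0..s n}))" for n by (rule integrable_arc_indicator) (use t(2)[of n] in auto)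
  show i': "integrable \<mu> (indicat_real (\<gamma> ` {0..t}))" by (rule integrable_arc_indicator) (use t(1) in auto)
  show "(\<lambda>n. \<integral>x. \<bar>indicat_real (\<gamma> ` {0..s n}) x - indicat_real (\<gamma> ` {0..t}) x\<bar> \<partial>\<mu>) \<longlonglongrightarrow> 0"
  proof (rule L1_dominated_convergence[OF i i', where w="\<lambda>_. 1"])
    have "AE x in \<mu>. \<exists>q. x = \<gamma> q \<and> 0 < q \<and> q < a \<and> x \<notin> {\<gamma> t}" by (rule AE_interior) simp
    then show "AE x in \<mu>. (\<lambda>n. indicat_real (\<gamma> ` {0..s n}) x) \<longlonglongrightarrow> indicat_real (\<gamma> ` {0..t}) x"
    proof eventually_elim
      case (elim x)
      then obtain q where q: "x = \<gamma> q" "0 < q" "q < a" "q \<noteq> t" by auto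
      have iff: "x \<in> \<gamma> ` {0..v} \<longleftrightarrow> q \<le> v" if "v \<in> {0..a}" for v
        unfolding q(1) using arc_iff_interior[OF q(2,3), of 0 v] that q(2) by auto
      have "\<forall>\<^sub>F n in sequentially. (q \<le> s n) = (q \<le> t)"
      proof (cases "q < t")
        case True
        show ?thesis using order_tendstoD(1)[OF t(3) True] by eventually_elim (use True in auto)
      next
        case False
        then have "t < q" using q(4) by simp
        show ?thesis using order_tendstoD(2)[OF t(3) \<open>t < q\<close>] by eventually_elim (use \<open>t < q\<close> in auto)
      qed
      then have "\<forall>\<^sub>F n in sequentially. indicat_real (\<gamma> ` {0..s n}) x = indicat_real (\<gamma> ` {0..t}) x"
        by eventually_elim (simp add: indicator_def iff[OF t(1)] iff[OF t(2)])
      then show ?case by (rule tendsto_eventually)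
    qed
    show "AE x in \<mu>. \<bar>indicat_real (\<gamma> ` {0..s n}) x\<bar> \<le> 1" for n by (intro AE_I2 indicator_abs_le_1)
    show "integrable \<mu> (\<lambda>_. 1::real)" by (rule integrable_LIPb[OF LIPb_const])
  qed
qed

lemma steep_sequence:
  assumes t: "t \<in> {0..a}"
  obtains s where "s \<longlonglongrightarrow> t" "\<And>n. \<exists>g c d. steep g c d (s n)" "\<And>n. s n \<in> {0..a}"
proof -
  have "\<exists>s. \<bar>s - t\<bar> < inverse (real (Suc n)) \<and> s \<in> {0..a} \<and> (\<exists>g c d. steep g c d s)" for n
  proof -
    define e where "e = inverse (real (Suc n))"
    have e: "0 < e" by (simp add: e_def)
    have "0 \<le> max 0 (t - e)" "max 0 (t - e) < min a (t + e)" "min a (t + e) \<le> a"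
      using e t length_pos by auto
    then obtain g c d s where "max 0 (t - e) < s" "s < min a (t + e)" "steep g c d s"
      using steep_exists[of "max 0 (t - e)" "min a (t + e)"] by blast
    then show ?thesis unfolding e_def[symmetric] by (intro exI[of _ s]) auto
  qed
  then obtain s where s: "\<And>n. \<bar>s n - t\<bar> < inverse (real (Suc n))" "\<And>n. s n \<in> {0..a}" "\<And>n. \<exists>g c d. steep g c d (s n)"
    by metis
  have "(\<lambda>n. s n - t) \<longlonglongrightarrow> 0"
    by (rule Lim_null_comparison[OF always_eventually LIMSEQ_inverse_real_of_nat])
      (use s(1) in \<open>auto intro: less_imp_le\<close>)
  then have "s \<longlonglongrightarrow> t" by (simp add: LIM_zero_iff)
  then show ?thesis using s(2,3) that by blast
qed

lemma null_arc: "p \<in> LIP \<Longrightarrow> \<Lambda> (\<lambda>x. indicator (\<gamma> ` {0..0}) x * f x) p = 0" if f: "integrable \<mu> f"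
proof -
  assume p: "p \<in> LIP"
  have i: "integrable \<mu> (\<lambda>x. indicator (\<gamma> ` {0..0}) x * f x)" by (rule integrable_arc) (use f length_pos in auto)
  have "AE x in \<mu>. x \<notin> {\<gamma> 0}" by (rule null_finite) simp
  then have "AE x in \<mu>. indicator (\<gamma> ` {0..0}) x * f x \<noteq> 0 \<longrightarrow> p x = 0"
    by eventually_elim (simp add: indicator_def)
  then show ?thesis by (rule locality[OF p i])
qed

text \<open>By additivity over adjacent arcs, \<open>h\<close> takes the same value at all steep
  parameters. These are dense and \<open>h\<close> is continuous, so it is constant on
  \<open>{0..a}\<close>, and at \<open>0\<close> the arc has no mass.\<close>

lemma arc_value_LIPb:
  assumes k: "\<And>g c d s h b e t p. steep g c d s \<Longrightarrow> steep h b e t \<Longrightarrow> s < t \<Longrightarrow> p \<in> LIPb \<Longrightarrow>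
    \<Lambda> (indicator (\<gamma> ` {s..t})) p = k * (p (\<gamma> t) - p (\<gamma> s))"
    and p: "p \<in> LIPb" and t: "t \<in> {0..a}"
  shows "\<Lambda> (indicator (\<gamma> ` {0..t})) p = k * (p (\<gamma> t) - p (\<gamma> 0))"
proof -
  have pL: "p \<in> LIP" by (rule LIPbD[OF p])
  define h where "h = (\<lambda>t. \<Lambda> (indicator (\<gamma> ` {0..t})) p - k * p (\<gamma> t))"
  obtain g0 c0 d0 s0 where s0: "0 < s0" "s0 < a" "steep g0 c0 d0 s0"
    using steep_exists[of 0 a] length_pos by blast
  have le: "h s = h r" if "steep g c d s" "steep g' c' d' r" "s < r" for g c d s g' c' d' r
  proof -
    have "0 \<le> s" "s < r" "r \<le> a" using that by (auto simp: steep_def)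
    then have "\<Lambda> (indicator (\<gamma> ` {0..r})) p = \<Lambda> (indicator (\<gamma> ` {0..s})) p + \<Lambda> (indicator (\<gamma> ` {s..r})) p"
      by (intro arc_additive_1 pL) auto
    then show ?thesis using k[OF that p] by (simp add: h_def algebra_simps)
  qed
  have steep_const: "h s = h s0" if st: "steep g c d s" for g c d s
  proof (cases rule: linorder_cases[of s s0])
    case less then show ?thesis by (rule le[OF st s0(3)])
  next
    case greater then show ?thesis by (rule le[OF s0(3) st, symmetric])
  qed simp
  have const: "h t = h s0" if t: "t \<in> {0..a}" for t
  proof -
    obtain s where s: "s \<longlonglongrightarrow> t" "\<And>n. \<exists>g c d. steep g c d (s n)" "\<And>n. s n \<in> {0..a}"
      using steep_sequence[OF t] by blast
    have "continuous_on {0..a} (\<lambda>t. p (\<gamma> t))"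
      by (rule continuous_on_compose2[OF LIP_continuous[OF pL] lipschitz_on_continuous_on[OF curve_lipschitz]]) auto
    then have "(\<lambda>n. p (\<gamma> (s n))) \<longlonglongrightarrow> p (\<gamma> t)"
      by (rule continuous_on_tendsto_compose[OF _ s(1) t]) (use s(3) in auto)
    then have "(\<lambda>n. h (s n)) \<longlonglongrightarrow> h t"
      unfolding h_def by (intro tendsto_intros arc_continuous pL t s)
    moreover have "h (s n) = h s0" for n using s(2)[of n] steep_const by blast
    ultimately show ?thesis by (simp add: LIMSEQ_const_iff)
  qed
  have "h t = h 0" using const[OF t] const[of 0] length_pos by simp
  moreover have "\<Lambda> (indicator (\<gamma> ` {0..0})) p = 0"
    using null_arc[OF integrable_LIPb[OF LIPb_const[of 1]] pL] by simp
  ultimately show ?thesis by (simp add: h_def algebra_simps)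
qed

text \<open>A Lipschitz \<open>p\<close> is bounded on the compact curve. Truncating it there
  changes nothing almost everywhere, which removes the boundedness assumption.\<close>

lemma arc_value:
  obtains k where "\<And>s t p. 0 \<le> s \<Longrightarrow> s \<le> t \<Longrightarrow> t \<le> a \<Longrightarrow> p \<in> LIP \<Longrightarrow>
    \<Lambda> (indicator (\<gamma> ` {s..t})) p = k * (p (\<gamma> t) - p (\<gamma> s))"
proof -
  obtain k where k: "\<And>g c d s h b e t p. steep g c d s \<Longrightarrow> steep h b e t \<Longrightarrow> s < t \<Longrightarrow> p \<in> LIPb \<Longrightarrow>
    \<Lambda> (indicator (\<gamma> ` {s..t})) p = k * (p (\<gamma> t) - p (\<gamma> s))"
    using crossing_constant by blast
  show ?thesis
  proof (rule that)
    fix s t :: real and p :: "'a \<Rightarrow> real" assume st: "0 \<le> s" "s \<le> t" "t \<le> a" and p: "p \<in> LIP"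
    have "compact ((\<lambda>r. p (\<gamma> r)) ` {0..a})"
      by (intro compact_continuous_image continuous_on_compose2[OF LIP_continuous[OF p] lipschitz_on_continuous_on[OF curve_lipschitz]]) auto
    then have "bounded ((\<lambda>r. p (\<gamma> r)) ` {0..a})" by (rule compact_imp_bounded)
    then obtain B where "\<forall>y\<in>(\<lambda>r. p (\<gamma> r)) ` {0..a}. norm y \<le> B" unfolding bounded_iff by blast
    then have B: "\<And>r. r \<in> {0..a} \<Longrightarrow> \<bar>p (\<gamma> r)\<bar> \<le> B" by simp
    have B0: "0 \<le> B" using B[of 0] length_pos by auto
    define q where "q = (\<lambda>x. max (-B) (min B (p x)))"
    have q: "q \<in> LIPb" unfolding q_def
      by (rule LIPbI[of _ B]) (use B0 in \<open>auto intro!: LIP_max LIP_min LIP_const p\<close>)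
    have qp: "q (\<gamma> r) = p (\<gamma> r)" if "r \<in> {0..a}" for r using B[OF that] by (auto simp: q_def)
    have eq: "\<Lambda> (indicator (\<gamma> ` {0..r})) p = k * (p (\<gamma> r) - p (\<gamma> 0))" if r: "r \<in> {0..a}" for r
    proof -
      have i: "integrable \<mu> (indicat_real (\<gamma> ` {0..r}))" by (rule integrable_arc_indicator) (use r in auto)
      have "\<Lambda> (indicator (\<gamma> ` {0..r})) p = 1 * \<Lambda> (indicator (\<gamma> ` {0..r})) q"
        by (rule right_cong[OF p LIPbD[OF q] i, where c=0]) (use concentrated in eventually_elim, use qp in auto)
      then show ?thesis using arc_value_LIPb[OF k q r] qp r length_pos by simp
    qed
    have "\<Lambda> (indicator (\<gamma> ` {0..t})) p = \<Lambda> (indicator (\<gamma> ` {0..s})) p + \<Lambda> (indicator (\<gamma> ` {s..t})) p"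
      by (rule arc_additive_1[OF p]) (use st in auto)
    then show "\<Lambda> (indicator (\<gamma> ` {s..t})) p = k * (p (\<gamma> t) - p (\<gamma> s))"
      using eq[of t] eq[of s] st by (simp add: algebra_simps)
  qed
qed

lemma compose_curve_lipschitz:
  assumes "p \<in> LIP" shows "(Lip p * C)-lipschitz_on {0..a} (\<lambda>r. p (\<gamma> r))"
  by (rule lipschitz_on_compose2[OF curve_lipschitz lipschitz_on_subset[OF Lip_lipschitz[OF assms]]]) simp

text \<open>Both sides, restricted to the initial arc of length \<open>t\<close>, agree to first order in \<open>t\<close> because
  \<open>f\<close> is nearly constant on short arcs; hence their difference has zero derivative in \<open>t\<close>.\<close>

lemma representation:
  assumes k: "\<And>s t p. 0 \<le> s \<Longrightarrow> s \<le> t \<Longrightarrow> t \<le> a \<Longrightarrow> p \<in> LIP \<Longrightarrow>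
    \<Lambda> (indicator (\<gamma> ` {s..t})) p = k * (p (\<gamma> t) - p (\<gamma> s))"
    and f: "f \<in> LIPb" and p: "p \<in> LIP"
  shows "\<Lambda> f p = k * curve_current 0 a \<gamma> f [p]"
proof -
  define w where "w = (\<lambda>r. p (\<gamma> r))"
  define \<phi> where "\<phi> = (\<lambda>r. f (\<gamma> r))"
  define Lf where "Lf = Lip f * C"
  define Lw where "Lw = Lip p * C"
  have fL: "f \<in> LIP" by (rule LIPbD[OF f])
  have Lf: "0 \<le> Lf" "Lf-lipschitz_on {0..a} \<phi>" and Lw: "0 \<le> Lw" "Lw-lipschitz_on {0..a} w"
    using compose_curve_lipschitz[OF fL] compose_curve_lipschitz[OF p] C_nonneg Lip_nonneg[OF fL] Lip_nonneg[OF p]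
    by (auto simp: Lf_def Lw_def \<phi>_def w_def)
  have \<phi>_dist: "\<bar>\<phi> r - \<phi> t\<bar> \<le> Lf * \<bar>r - t\<bar>" if "r \<in> {0..a}" "t \<in> {0..a}" for r t
    using lipschitz_onD[OF Lf(2) that] by (simp add: dist_real_def)
  obtain N where N: "negligible N" "\<And>t. t \<in> {0..a} - N \<Longrightarrow> \<bar>deriv w t\<bar> \<le> Lw"
    "\<And>c d. 0 \<le> c \<Longrightarrow> c \<le> d \<Longrightarrow> d \<le> a \<Longrightarrow> deriv w absolutely_integrable_on {c..d}"
    "\<And>c d. 0 \<le> c \<Longrightarrow> c \<le> d \<Longrightarrow> d \<le> a \<Longrightarrow> integral {c..d} (deriv w) = w d - w c"
    using lipschitz_on_interval_deriv[OF Lw(2)] by metis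
  have \<phi>_cont: "continuous_on {0..a} \<phi>" by (rule lipschitz_on_continuous_on[OF Lf(2)])
  have prod: "(\<lambda>r. \<phi> r * deriv w r) absolutely_integrable_on {0..a}"
  proof (rule absolutely_integrable_bounded_measurable_product_real)
    show "\<phi> \<in> borel_measurable (lebesgue_on {0..a})"
      by (rule continuous_imp_measurable_on_sets_lebesgue[OF \<phi>_cont]) auto
    show "bounded (\<phi> ` {0..a})" by (rule compact_imp_bounded[OF compact_continuous_image[OF \<phi>_cont]]) auto
    show "deriv w absolutely_integrable_on {0..a}" using N(3) length_pos by auto
  qed auto
  have prod_int: "(\<lambda>r. \<phi> r * deriv w r) integrable_on {s..t}" if "0 \<le> s" "t \<le> a" for s t
    by (rule integrable_subinterval_real[of _ 0 a]) (use prod that in \<open>auto simp: absolutely_integrable_on_def\<close>)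
  have if_: "integrable \<mu> f" by (rule integrable_LIPb[OF f])
  define \<Psi> where "\<Psi> = (\<lambda>t. \<Lambda> (\<lambda>x. indicator (\<gamma> ` {0..t}) x * f x) p - k * integral {0..t} (\<lambda>r. \<phi> r * deriv w r))"
  have incr: "\<bar>\<Psi> t - \<Psi> s\<bar> \<le> (t - s) * (Lip p * Lf * measure \<mu> (\<gamma> ` {s..t}) + \<bar>k\<bar> * Lf * Lw * (t - s))"
    if st: "0 \<le> s" "s \<le> t" "t \<le> a" for s t
  proof -
    let ?I = "indicat_real (\<gamma> ` {s..t})"
    have iI: "integrable \<mu> ?I" and iIf: "integrable \<mu> (\<lambda>x. ?I x * f x)"
      using integrable_arc_indicator integrable_arc if_ st by auto
    have iIc: "integrable \<mu> (\<lambda>x. \<phi> s * ?I x)" using iI by simp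
    have pt: "\<bar>?I x * f x - \<phi> s * ?I x\<bar> \<le> (Lf * (t - s)) * ?I x" for x
    proof (cases "x \<in> \<gamma> ` {s..t}")
      case True
      then obtain r where r: "x = \<gamma> r" "s \<le> r" "r \<le> t" by auto
      have "\<bar>\<phi> r - \<phi> s\<bar> \<le> Lf * \<bar>r - s\<bar>" by (rule \<phi>_dist) (use r st in auto)
      also have "\<dots> \<le> Lf * (t - s)" using r Lf(1) by (intro mult_left_mono) auto
      finally show ?thesis using True r(1) by (simp add: \<phi>_def)
    qed simp
    have "\<bar>\<Lambda> (\<lambda>x. ?I x * f x) p - \<Lambda> (\<lambda>x. \<phi> s * ?I x) p\<bar> \<le> Lip p * (\<integral>x. \<bar>?I x * f x - \<phi> s * ?I x\<bar> \<partial>\<mu>)"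
      by (rule left_diff[OF p iIf iIc])
    also have "\<dots> \<le> Lip p * (\<integral>x. (Lf * (t - s)) * ?I x \<partial>\<mu>)"
      by (intro mult_left_mono integral_mono Lip_nonneg p) (use pt iI iIf iIc in auto)
    also have "\<dots> = Lip p * ((Lf * (t - s)) * measure \<mu> (\<gamma> ` {s..t}))" by (simp add: space_mu)
    finally have 1: "\<bar>\<Lambda> (\<lambda>x. ?I x * f x) p - \<phi> s * (k * (w t - w s))\<bar> \<le> Lip p * ((Lf * (t - s)) * measure \<mu> (\<gamma> ` {s..t}))"
      using left_scale[OF p iI, of "\<phi> s"] k[OF st p] by (simp add: w_def)
    have w1: "deriv w integrable_on {s..t}" using N(3)[OF st] by (simp add: absolutely_integrable_on_def)
    have d: "(\<lambda>r. (\<phi> r - \<phi> s) * deriv w r) integrable_on {s..t}"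
      using integrable_diff[OF prod_int[OF st(1,3)] integrable_on_cmult_left[OF w1, of "\<phi> s"]]
      by (simp add: left_diff_distrib)
    have "\<bar>integral {s..t} (\<lambda>r. (\<phi> r - \<phi> s) * deriv w r)\<bar> \<le> (Lf * (t - s) * Lw) * (t - s)"
    proof (rule integral_bound_spike[OF d N(1)])
      show "\<bar>(\<phi> r - \<phi> s) * deriv w r\<bar> \<le> Lf * (t - s) * Lw" if r: "r \<in> {s..t} - N" for r
      proof -
        have "\<bar>\<phi> r - \<phi> s\<bar> \<le> Lf * \<bar>r - s\<bar>" by (rule \<phi>_dist) (use r st in auto)
        also have "\<dots> \<le> Lf * (t - s)" using r Lf(1) by (intro mult_left_mono) auto
        finally show ?thesis unfolding abs_mult using N(2)[of r] r st Lf(1) by (intro mult_mono) auto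
      qed
    qed (use Lf Lw st in auto)
    moreover have "integral {s..t} (\<lambda>r. (\<phi> r - \<phi> s) * deriv w r)
        = integral {s..t} (\<lambda>r. \<phi> r * deriv w r) - \<phi> s * (w t - w s)"
    proof -
      have "integral {s..t} (\<lambda>r. \<phi> r * deriv w r - \<phi> s * deriv w r)
          = integral {s..t} (\<lambda>r. \<phi> r * deriv w r) - integral {s..t} (\<lambda>r. \<phi> s * deriv w r)"
        using Henstock_Kurzweil_Integration.integral_diff[OF prod_int[OF st(1,3)] integrable_on_cmult_left[OF w1, of "\<phi> s"]]
        by simp
      then show ?thesis by (simp add: left_diff_distrib N(4)[OF st])
    qed
    ultimately have 2: "\<bar>k * integral {s..t} (\<lambda>r. \<phi> r * deriv w r) - \<phi> s * (k * (w t - w s))\<bar> \<le> \<bar>k\<bar> * ((Lf * (t - s) * Lw) * (t - s))"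
    proof -
      have "k * integral {s..t} (\<lambda>r. \<phi> r * deriv w r) - \<phi> s * (k * (w t - w s))
          = k * (integral {s..t} (\<lambda>r. \<phi> r * deriv w r) - \<phi> s * (w t - w s))" by (simp add: algebra_simps)
      then show ?thesis
        using \<open>\<bar>integral {s..t} (\<lambda>r. (\<phi> r - \<phi> s) * deriv w r)\<bar> \<le> _\<close> \<open>integral {s..t} (\<lambda>r. (\<phi> r - \<phi> s) * deriv w r) = _\<close>
        by (simp add: abs_mult mult_left_mono)
    qed
    have "integral {0..t} (\<lambda>r. \<phi> r * deriv w r) = integral {0..s} (\<lambda>r. \<phi> r * deriv w r) + integral {s..t} (\<lambda>r. \<phi> r * deriv w r)"
      by (rule Henstock_Kurzweil_Integration.integral_combine[symmetric]) (use st prod_int in auto)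
    moreover have "\<Lambda> (\<lambda>x. indicator (\<gamma> ` {0..t}) x * f x) p = \<Lambda> (\<lambda>x. indicator (\<gamma> ` {0..s}) x * f x) p + \<Lambda> (\<lambda>x. ?I x * f x) p"
      by (rule arc_additive[OF p if_]) (use st in auto)
    ultimately have "\<Psi> t - \<Psi> s = \<Lambda> (\<lambda>x. ?I x * f x) p - k * integral {s..t} (\<lambda>r. \<phi> r * deriv w r)"
      by (simp add: \<Psi>_def algebra_simps)
    then have "\<bar>\<Psi> t - \<Psi> s\<bar> \<le> Lip p * ((Lf * (t - s)) * measure \<mu> (\<gamma> ` {s..t})) + \<bar>k\<bar> * ((Lf * (t - s) * Lw) * (t - s))"
      using 1 2 by linarith
    also have "\<dots> = (t - s) * (Lip p * Lf * measure \<mu> (\<gamma> ` {s..t}) + \<bar>k\<bar> * Lf * Lw * (t - s))"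
      by (simp add: algebra_simps)
    finally show ?thesis .
  qed
  have deriv0: "(\<Psi> has_field_derivative 0) (at s within {0..a})" if s: "s \<in> {0..a}" for s
  proof -
    \<comment> \<open>A modulus for the difference quotients from either side of \<open>s\<close>:
      the arc between \<open>r\<close> and \<open>s\<close> lies in the window of radius
      \<open>\<bar>r - s\<bar>\<close>.\<close>
    define M where "M = (\<lambda>\<delta>. Lip p * Lf * measure \<mu> (window s \<delta>) + \<bar>k\<bar> * Lf * Lw * \<delta>)"
    have "(M \<longlongrightarrow> Lip p * Lf * 0 + \<bar>k\<bar> * Lf * Lw * 0) (at_right 0)"
      unfolding M_def by (intro tendsto_intros window_measure_tendsto_0 s)
    then have M0: "(M \<longlongrightarrow> 0) (at_right 0)" by simp
    have "filterlim (\<lambda>r. \<bar>r - s\<bar>) (at_right 0) (at s within {0..a})"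
      unfolding filterlim_at
    proof (intro conjI)
      have "((\<lambda>r. r - s) \<longlongrightarrow> s - s) (at s within {0..a})" by (intro tendsto_intros)
      then show "((\<lambda>r. \<bar>r - s\<bar>) \<longlongrightarrow> 0) (at s within {0..a})" by (intro tendsto_rabs_zero) simp
      show "\<forall>\<^sub>F r in at s within {0..a}. \<bar>r - s\<bar> \<in> {0<..} \<and> \<bar>r - s\<bar> \<noteq> 0"
        by (auto simp: eventually_at_filter)
    qed
    from filterlim_compose[OF M0 this]
    have lim: "((\<lambda>r. M \<bar>r - s\<bar>) \<longlongrightarrow> 0) (at s within {0..a})" .
    have quot: "\<bar>\<Psi> r - \<Psi> s\<bar> \<le> \<bar>r - s\<bar> * M \<bar>r - s\<bar>" if r: "r \<in> {0..a}" for r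
    proof -
      have sub: "measure \<mu> (\<gamma> ` {min r s..max r s}) \<le> measure \<mu> (window s \<bar>r - s\<bar>)"
      proof (rule finite_measure.finite_measure_mono[OF finite_mu])
        show "\<gamma> ` {min r s..max r s} \<subseteq> window s \<bar>r - s\<bar>"
          unfolding window_def by (rule image_mono) (use r s in auto)
      qed (simp add: window_borel sets_mu)
      have "\<bar>\<Psi> r - \<Psi> s\<bar> = \<bar>\<Psi> (max r s) - \<Psi> (min r s)\<bar>" by (auto simp: max_def min_def)
      also have "\<dots> \<le> (max r s - min r s) * (Lip p * Lf * measure \<mu> (\<gamma> ` {min r s..max r s}) + \<bar>k\<bar> * Lf * Lw * (max r s - min r s))"
        by (rule incr) (use r s in auto)
      also have "max r s - min r s = \<bar>r - s\<bar>" by auto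
      also have "\<bar>r - s\<bar> * (Lip p * Lf * measure \<mu> (\<gamma> ` {min r s..max r s}) + \<bar>k\<bar> * Lf * Lw * \<bar>r - s\<bar>) \<le> \<bar>r - s\<bar> * M \<bar>r - s\<bar>"
        unfolding M_def by (intro mult_left_mono add_right_mono sub) (use Lip_nonneg[OF p] Lf(1) in auto)
      finally show ?thesis .
    qed
    have "((\<lambda>r. (\<Psi> r - \<Psi> s) / (r - s)) \<longlongrightarrow> 0) (at s within {0..a})"
    proof (rule Lim_null_comparison[OF _ lim])
      show "\<forall>\<^sub>F r in at s within {0..a}. norm ((\<Psi> r - \<Psi> s) / (r - s)) \<le> M \<bar>r - s\<bar>"
        unfolding eventually_at_filter
        by (rule always_eventually) (use quot in \<open>auto simp: abs_divide divide_le_eq mult.commute\<close>)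
    qed
    then show ?thesis by (simp add: has_field_derivative_iff)
  qed
  obtain c where c: "\<And>t. t \<in> {0..a} \<Longrightarrow> \<Psi> t = c"
    using has_field_derivative_zero_constant[of "{0..a}" \<Psi>] deriv0 by auto
  have "\<Psi> a = \<Psi> 0" using c[of 0] c[of a] length_pos by simp
  moreover have "\<Psi> 0 = 0" using null_arc[OF if_ p] by (simp add: \<Psi>_def)
  moreover have "\<Lambda> (\<lambda>x. indicator (\<gamma> ` {0..a}) x * f x) p = \<Lambda> f p"
    by (rule left_cong_AE[OF p integrable_arc[OF _ _ if_] if_]) (use concentrated in \<open>auto\<close>)
  ultimately have "\<Lambda> f p = k * integral {0..a} (\<lambda>r. \<phi> r * deriv w r)" by (simp add: \<Psi>_def)
  also have "integral {0..a} (\<lambda>r. \<phi> r * deriv w r) = curve_current 0 a \<gamma> f [p]"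
    using set_lebesgue_integral_eq_integral(2)[OF prod] by (simp add: curve_current_def \<phi>_def w_def)
  finally show ?thesis .
qed

end

section \<open>Integrality of the multiplicity\<close>

lemma continuous_antiderivative:
  fixes g :: "real \<Rightarrow> real"
  assumes g: "continuous_on UNIV g"
  obtains p where "\<And>x. (p has_field_derivative g x) (at x)"
proof
  define p where "p = (\<lambda>u. LBINT y=0..u. g y)"
  fix x :: real
  define l u where "l = min 0 x - 1" and "u = max 0 x + 1"
  have "((\<lambda>u. LBINT y=0..u. g y) has_vector_derivative g x) (at x within {l..u})"
    unfolding zero_ereal_def
    by (rule interval_integral_FTC2) (use continuous_on_subset[OF g] in \<open>auto simp: l_def u_def\<close>)
  moreover have "at x within {l..u} = at x" by (rule at_within_interior) (auto simp: l_def u_def)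
  ultimately show "(p has_field_derivative g x) (at x)"
    by (simp add: p_def has_real_derivative_iff_has_vector_derivative)
qed

text \<open>Inner regularity exhausts \<open>{x. 0 < u x}\<close> by closed sets; on each of them
  \<open>u\<close> is positive with zero integral, so it is null.\<close>

lemma integrable_AE_le_0:
  fixes u :: "real \<Rightarrow> real"
  assumes u: "integrable lebesgue u" and zero: "\<And>K. closed K \<Longrightarrow> (\<integral>x. u x * indicator K x \<partial>lebesgue) = 0"
  shows "AE x in lebesgue. u x \<le> 0"
proof -
  let ?S = "{x. 0 < u x}"
  have S: "?S \<in> sets lebesgue" using borel_measurable_integrable[OF u] by (simp add: borel_measurable_iff_greater)
  have "emeasure lebesgue ?S < ennreal e" if e: "0 < e" for e
  proof -
    obtain K where K: "closed K" "K \<subseteq> ?S" "?S - K \<in> lmeasurable" "emeasure lebesgue (?S - K) < ennreal e"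
      using sets_lebesgue_inner_closed[OF S e] by metis
    have Ks: "K \<in> sets lebesgue" using K(1) by auto
    have i: "integrable lebesgue (\<lambda>x. u x * indicator K x)"
      using integrable_mult_indicator[OF Ks u] by (simp add: mult.commute)
    have "AE x in lebesgue. 0 \<le> u x * indicator K x"
      by (intro AE_I2) (use K(2) in \<open>auto simp: indicator_def\<close>)
    then have "AE x in lebesgue. u x * indicator K x = 0"
      using integral_nonneg_eq_0_iff_AE[OF i] zero[OF K(1)] by blast
    then have "AE x in lebesgue. x \<notin> K" by eventually_elim (use K(2) in \<open>auto simp: indicator_def split: if_splits\<close>)
    then have "emeasure lebesgue K = 0" using Ks by (simp add: AE_iff_measurable[OF _ refl] )
    have "emeasure lebesgue ?S = emeasure lebesgue (K \<union> (?S - K))" using K(2) by (simp add: Un_absorb1)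
    also have "\<dots> \<le> emeasure lebesgue K + emeasure lebesgue (?S - K)"
      by (rule emeasure_subadditive) (use Ks S in auto)
    also have "\<dots> < ennreal e" using \<open>emeasure lebesgue K = 0\<close> K(4) by simp
    finally show ?thesis .
  qed
  then have le: "emeasure lebesgue ?S \<le> 0 + ennreal e" if "0 < e" for e using that by (simp add: less_imp_le)
  have "emeasure lebesgue ?S \<le> 0" by (rule ennreal_le_epsilon) (rule le)
  then have "?S \<in> null_sets lebesgue" using S by auto
  then show ?thesis by (rule AE_I') auto
qed

lemma integrable_AE_0:
  fixes u :: "real \<Rightarrow> real"
  assumes u: "integrable lebesgue u" and zero: "\<And>g. g \<in> LIPb \<Longrightarrow> (\<integral>x. u x * g x \<partial>lebesgue) = 0"
  shows "AE x in lebesgue. u x = 0"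
proof -
  have closed: "(\<integral>x. u x * indicator K x \<partial>lebesgue) = 0" if K: "closed K" for K
  proof -
    obtain g where g: "\<And>n. g n \<in> LIPb" "\<And>n x. 0 \<le> g n x \<and> g n x \<le> 1" "\<And>x. (\<lambda>n. g n x) \<longlonglongrightarrow> (indicator K x :: real)"
      using closed_indicator_LIPb_limit[OF K] by blast
    have "(\<lambda>n. \<integral>x. u x * g n x \<partial>lebesgue) \<longlonglongrightarrow> (\<integral>x. u x * indicator K x \<partial>lebesgue)"
    proof (rule integral_dominated_convergence[where w="\<lambda>x. \<bar>u x\<bar>"])
      show "AE x in lebesgue. (\<lambda>n. u x * g n x) \<longlonglongrightarrow> u x * indicator K x"
        by (intro AE_I2 tendsto_mult tendsto_const g(3))
      show "AE x in lebesgue. norm (u x * g n x) \<le> \<bar>u x\<bar>" for n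
      proof (rule AE_I2)
        fix x show "norm (u x * g n x) \<le> \<bar>u x\<bar>"
          using mult_left_mono[of "\<bar>g n x\<bar>" 1 "\<bar>u x\<bar>"] g(2)[of n x] by (simp add: abs_mult)
      qed
      have um: "u \<in> borel_measurable lebesgue" by (rule borel_measurable_integrable[OF u])
      have gm: "g n \<in> borel_measurable lebesgue" for n
        using LIP_measurable[OF LIPbD[OF g(1)[of n]]] by (intro measurable_completion) simp
      show "(\<lambda>x. u x * g n x) \<in> borel_measurable lebesgue" for n using um gm[of n] by (rule borel_measurable_times)
      show "(\<lambda>x. u x * indicator K x) \<in> borel_measurable lebesgue"
        using K by (intro borel_measurable_times um borel_measurable_indicator) auto
    qed (use u in simp)
    then show ?thesis by (simp add: zero[OF g(1)] LIMSEQ_const_iff)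
  qed
  have "AE x in lebesgue. u x \<le> 0" by (rule integrable_AE_le_0[OF u closed])
  moreover have "AE x in lebesgue. - u x \<le> 0"
    by (rule integrable_AE_le_0) (use u closed in simp_all)
  ultimately show ?thesis by eventually_elim simp
qed

text \<open>The hypothesis says that \<theta> and \<open>k\<close> times the indicator of
  \<open>{0..D}\<close> have equal integrals against derivatives of Lipschitz functions. They
  therefore agree almost everywhere, and \<open>k\<close> is a value of \<theta>.\<close>

lemma integer_multiplicity:
  fixes \<theta> :: "real \<Rightarrow> int"
  assumes \<theta>: "integrable lebesgue (\<lambda>x. real_of_int (\<theta> x))" and D: "0 < D"
    and eq: "\<And>p. p \<in> LIP \<Longrightarrow> (\<integral>x. real_of_int (\<theta> x) * deriv p x \<partial>lebesgue) = k * (p D - p 0)"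
  shows "\<exists>j::int. k = of_int j"
proof -
  define u where "u = (\<lambda>x. real_of_int (\<theta> x) - k * indicator {0..D} x)"
  have iI: "integrable lebesgue (indicat_real {0..D})" by (rule integrable_real_indicator) (use D in auto)
  have u: "integrable lebesgue u" unfolding u_def using \<theta> iI by simp
  have "(\<integral>x. u x * g x \<partial>lebesgue) = 0" if g: "g \<in> LIPb" for g
  proof -
    have gc: "continuous_on A g" for A by (rule LIP_continuous[OF LIPbD[OF g]])
    \<comment> \<open>Every bounded Lipschitz \<open>g\<close> is the derivative of its
      antiderivative at each point, and the bound on \<open>g\<close> makes that antiderivative an
      admissible test function.\<close>
    obtain p where p: "\<And>x. (p has_field_derivative g x) (at x)" using continuous_antiderivative[OF gc] by blast
    obtain B where B: "0 \<le> B" "\<And>x. \<bar>g x\<bar> \<le> B" using LIPbE[OF g] by blast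
    have pL: "p \<in> LIP"
    proof (rule LIP_I[OF B(1)])
      fix x y
      have "norm (p x - p y) \<le> B * norm (x - y)"
        by (rule field_differentiable_bound[of UNIV p g]) (use p B(2) in auto)
      then show "\<bar>p x - p y\<bar> \<le> B * dist x y" by (simp add: dist_real_def)
    qed
    have dp: "deriv p x = g x" for x by (rule DERIV_imp_deriv[OF p])
    have gm: "g \<in> borel_measurable lebesgue"
      using LIP_measurable[OF LIPbD[OF g]] by (intro measurable_completion) simp
    have mult: "integrable lebesgue (\<lambda>x. v x * g x)" if v: "integrable lebesgue v" for v
      by (rule integrable_bounded_mult[OF v gm B(2)])
    have "(g has_integral (p D - p 0)) {0..D}"
      by (rule fundamental_theorem_of_calculus)
        (use D p in \<open>auto simp: has_real_derivative_iff_has_vector_derivative[symmetric] intro: has_field_derivative_at_within\<close>)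
    then have "integral {0..D} g = p D - p 0" by (rule integral_unique)
    moreover have "(LINT x:{0..D}|lebesgue. g x) = integral {0..D} g"
      by (rule set_lebesgue_integral_eq_integral(2)[OF absolutely_integrable_continuous_real[OF gc]])
    ultimately have gD: "(\<integral>x. indicator {0..D} x * g x \<partial>lebesgue) = p D - p 0"
      by (simp add: set_lebesgue_integral_def)
    have "(\<integral>x. u x * g x \<partial>lebesgue) = (\<integral>x. real_of_int (\<theta> x) * g x - k * (indicator {0..D} x * g x) \<partial>lebesgue)"
      by (simp add: u_def left_diff_distrib mult.assoc)
    also have "\<dots> = (\<integral>x. real_of_int (\<theta> x) * g x \<partial>lebesgue) - k * (\<integral>x. indicator {0..D} x * g x \<partial>lebesgue)"
      using mult[OF \<theta>] mult[OF iI] by simp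
    also have "\<dots> = 0" using eq[OF pL] gD by (simp add: dp)
    finally show ?thesis .
  qed
  then have ae: "AE x in lebesgue. u x = 0" by (rule integrable_AE_0[OF u])
  \<comment> \<open>The interval has positive length, so an almost everywhere statement is attained
    at one of its points.\<close>
  have "\<exists>x\<in>{0..D}. u x = 0"
  proof (rule ccontr)
    assume "\<not> (\<exists>x\<in>{0..D}. u x = 0)"
    then have "AE x in lebesgue. x \<notin> {0..D}" using ae by (auto elim!: eventually_mono)
    moreover have "{x \<in> space lebesgue. \<not> x \<notin> {0..D}} = {0..D}" by auto
    ultimately have "emeasure lebesgue {0..D} = 0"
      using AE_iff_measurable[of "{0..D}" lebesgue "\<lambda>x. x \<notin> {0..D}"] by simp
    then show False using D by simp
  qed
  then show ?thesis by (auto simp: u_def)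
qed

section \<open>Integral currents carried by a curve\<close>

lemma curve_current_boundary:
  fixes \<gamma> :: "real \<Rightarrow> 'a::metric_space"
  assumes \<gamma>: "C-lipschitz_on {0..a} \<gamma>" and a: "0 \<le> a" and p: "p \<in> LIP"
  shows "curve_current 0 a \<gamma> (\<lambda>_. 1) [p] = p (\<gamma> a) - p (\<gamma> 0)"
proof -
  have "(Lip p * C)-lipschitz_on {0..a} (\<lambda>r. p (\<gamma> r))"
    by (rule lipschitz_on_compose2[OF \<gamma> lipschitz_on_subset[OF Lip_lipschitz[OF p]]]) simp
  then obtain N where "\<And>c d. 0 \<le> c \<Longrightarrow> c \<le> d \<Longrightarrow> d \<le> a \<Longrightarrow> deriv (\<lambda>r. p (\<gamma> r)) absolutely_integrable_on {c..d}"
    "\<And>c d. 0 \<le> c \<Longrightarrow> c \<le> d \<Longrightarrow> d \<le> a \<Longrightarrow> integral {c..d} (deriv (\<lambda>r. p (\<gamma> r))) = p (\<gamma> d) - p (\<gamma> c)"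
    using lipschitz_on_interval_deriv[of "Lip p * C" 0 a "\<lambda>r. p (\<gamma> r)"] by metis
  then show ?thesis
    using set_lebesgue_integral_eq_integral(2)[of "{0..a}" "deriv (\<lambda>r. p (\<gamma> r))"] a
    by (simp add: curve_current_def)
qed

text \<open>The locale gives a real factor. Integrality is read off a middle arc pushed forward to
  the line; a proper arc is needed, since for a loop the push-forward of the whole curve current is
  zero.\<close>

lemma integral_current_multiple_of_curve:
  fixes \<gamma> :: "real \<Rightarrow> 'a::metric_space" and T :: "'a functional"
  assumes a: "0 < a" and \<gamma>: "C-lipschitz_on {0..a} \<gamma>"
    and inj: "\<And>r t. 0 \<le> r \<Longrightarrow> r < t \<Longrightarrow> t \<le> a \<Longrightarrow> \<gamma> r = \<gamma> t \<Longrightarrow> r = 0 \<and> t = a"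
    and T: "integer_rectifiable_1current T" and spt: "spt 1 T \<subseteq> \<gamma> ` {0..a}"
    and boundary: "\<And>\<phi>. \<phi> \<in> LIPb \<Longrightarrow> \<phi> (\<gamma> 0) = 0 \<Longrightarrow> \<phi> (\<gamma> a) = 0 \<Longrightarrow> T (\<lambda>_. 1) [\<phi>] = 0"
  obtains k :: int where "\<And>f p. f \<in> LIPb \<Longrightarrow> p \<in> LIP \<Longrightarrow> T f [p] = of_int k * curve_current 0 a \<gamma> f [p]"
proof -
  have rect: "rectifiable_1current T" using T by (simp add: integer_rectifiable_1current_def)
  have m: "metric_current 1 T" using rect by (simp add: rectifiable_1current_def)
  have "compact (\<gamma> ` {0..a})"
    by (rule compact_continuous_image[OF lipschitz_on_continuous_on[OF \<gamma>]]) simp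
  then have closed: "closed (\<gamma> ` {0..a})" by (rule compact_imp_closed)
  interpret arc: current_on_arc "mass1 T" "extend1 T" \<gamma> a C
  proof
    show "extend1 T f p + extend1 T p f = extend1 T (\<lambda>_. 1) (\<lambda>x. f x * p x)" if "f \<in> LIPb" "p \<in> LIPb" for f p
      using integer_rectifiable_Leibniz[OF T that] that
      by (simp add: extend1_eq[OF m] LIPbD LIPb_const LIPb_mult)
    show "extend1 T (\<lambda>_. 1) \<phi> = 0" if "\<phi> \<in> LIPb" "\<phi> (\<gamma> 0) = 0" "\<phi> (\<gamma> a) = 0" for \<phi>
      using boundary[OF that] that by (simp add: extend1_eq[OF m] LIPbD LIPb_const)
  qed (fact mass1_finite_borel[OF m] extend1_linear[OF m] extend1_bound[OF m] a \<gamma> inj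
      rectifiable_mass_outside_support[OF rect closed spt] | rule extend1_linear(2)[OF m] extend1_local[OF m]; assumption)+
  obtain k where k: "\<And>s t p. 0 \<le> s \<Longrightarrow> s \<le> t \<Longrightarrow> t \<le> a \<Longrightarrow> p \<in> LIP \<Longrightarrow>
      extend1 T (indicator (\<gamma> ` {s..t})) p = k * (p (\<gamma> t) - p (\<gamma> s))"
    using arc.arc_value by blast
  have rep: "T f [p] = k * curve_current 0 a \<gamma> f [p]" if "f \<in> LIPb" "p \<in> LIP" for f p
    using arc.representation[OF k that] extend1_eq[OF m that] by simp
  \<comment> \<open>Any two interior parameters would do. Interior points of the curve are simple
    even for a loop, so the distance from \<open>\<gamma> s\<close> separates the ends of the
    arc.\<close>
  define s t where "s = a / 3" and "t = 2 * a / 3"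
  have st: "0 < s" "s < t" "t < a" using a by (auto simp: s_def t_def)
  define \<phi> where "\<phi> = (\<lambda>x. dist (\<gamma> s) x)"
  \<comment> \<open>Multiplicities are given only for restrictions to open sets. This one meets the
    curve in the arc from \<open>s\<close> to \<open>t\<close> without its two ends, which are
    null.\<close>
  define \<Omega> where "\<Omega> = - \<gamma> ` ({0..s} \<union> {t..a})"
  have "open \<Omega>" unfolding \<Omega>_def
    by (intro open_Compl compact_imp_closed arc.compact_arc compact_Un) (use st in auto)
  have \<phi>: "\<phi> \<in> LIP" unfolding \<phi>_def by (rule LIP_dist)
  obtain \<theta> :: "real \<Rightarrow> int" where \<theta>: "integrable lebesgue (\<lambda>x. real_of_int (\<theta> x))"
    "\<And>f p. f \<in> LIPb \<Longrightarrow> p \<in> LIP \<Longrightarrow> extend1 T (\<lambda>x. indicator \<Omega> x * f (\<phi> x)) (p \<circ> \<phi>) =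
       (\<integral>x. real_of_int (\<theta> x) * f x * deriv p x \<partial>lebesgue)"
    using integer_rectifiable_multiplicity[OF T \<phi> \<open>open \<Omega>\<close>] by blast
  have "\<exists>j::int. k = of_int j"
  proof (rule integer_multiplicity[OF \<theta>(1)])
    show "0 < dist (\<gamma> s) (\<gamma> t)" using inj[of s t] st by auto
    fix p :: "real \<Rightarrow> real" assume p: "p \<in> LIP"
    have p\<phi>: "p \<circ> \<phi> \<in> LIP" by (rule LIP_compose[OF p \<phi>])
    have iI: "integrable (mass1 T) (indicat_real (\<gamma> ` {s..t}))" by (rule arc.integrable_arc_indicator) (use st in auto)
    have iO: "integrable (mass1 T) (indicat_real \<Omega>)" by (rule arc.integrable_indicator) (use \<open>open \<Omega>\<close> in auto)
    have "AE x in mass1 T. \<exists>q. x = \<gamma> q \<and> 0 < q \<and> q < a \<and> x \<notin> {\<gamma> s, \<gamma> t}" by (rule arc.AE_interior) simp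
    then have ae: "AE x in mass1 T. indicat_real \<Omega> x = indicator (\<gamma> ` {s..t}) x"
    proof eventually_elim
      case (elim x)
      then obtain q where q: "x = \<gamma> q" "0 < q" "q < a" "q \<noteq> s" "q \<noteq> t" by auto
      have iff: "x \<in> \<gamma> ` {u..v} \<longleftrightarrow> u \<le> q \<and> q \<le> v" if "0 \<le> u" "v \<le> a" for u v
        unfolding q(1) by (rule arc.arc_iff_interior[OF q(2,3) that])
      have "x \<in> \<Omega> \<longleftrightarrow> \<not> (q \<le> s) \<and> \<not> (t \<le> q)"
        unfolding \<Omega>_def using iff[of 0 s] iff[of t a] st q by (auto simp: image_Un)
      then show ?case using iff[of s t] st q by (auto simp: indicator_def)
    qed
    have "(\<integral>x. real_of_int (\<theta> x) * deriv p x \<partial>lebesgue) = extend1 T (\<lambda>x. indicator \<Omega> x) (p \<circ> \<phi>)"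
      using \<theta>(2)[OF LIPb_const[of 1] p] by simp
    also have "\<dots> = extend1 T (indicator (\<gamma> ` {s..t})) (p \<circ> \<phi>)"
      by (rule arc.left_cong_AE[OF p\<phi> iO iI ae])
    also have "\<dots> = k * (p (dist (\<gamma> s) (\<gamma> t)) - p 0)"
      using k[OF _ _ _ p\<phi>, of s t] st by (simp add: \<phi>_def)
    finally show "(\<integral>x. real_of_int (\<theta> x) * deriv p x \<partial>lebesgue) = k * (p (dist (\<gamma> s) (\<gamma> t)) - p 0)" .
  qed
  then show ?thesis using rep that by blast
qed

text \<open>Either boundary condition makes \<open>T (\<lambda>_. 1) [\<phi>]\<close> vanish when
  \<phi> is zero at both endpoints, so in both cases the current is an integer multiple of the curve
  current. A function that separates the endpoints of an injective curve then determines the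
  factor.\<close>

theorem proposition6p1:
  fixes \<gamma> :: "real \<Rightarrow> 'a::complete_space"
    and a :: real
    and T :: "'a functional"
  assumes ulam: "\<And>A :: 'a set. has_ulam_cardinality A"
    and a: "0 \<le> a"
    and curve: "lipschitz_curve 0 a \<gamma>" "arc_length_parametrised 0 a \<gamma>"
    and inj: "inj_on \<gamma> {0..a} \<or> injective_loop 0 a \<gamma>"
    and T: "integral_1current T" "\<not> functional_eq 1 T (\<lambda>f ps. 0)"
    and spt: "spt 1 T \<subseteq> \<gamma> ` {0..a}"
  shows "(functional_eq 0 (current_boundary T) (\<lambda>f ps. 0) \<longrightarrow>
            lipschitz_curve 0 a \<gamma> \<and> injective_loop 0 a \<gamma> \<and>
            (\<exists>k::int. functional_eq 1 T (\<lambda>f ps. of_int k * curve_current 0 a \<gamma> f ps))) \<and>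
         (inj_on \<gamma> {0..a} \<longrightarrow>
            functional_eq 0 (current_boundary (curve_current 0 a \<gamma>))
              (\<lambda>f ps. dirac_current (\<gamma> a) f ps - dirac_current (\<gamma> 0) f ps) \<and>
            (functional_eq 0 (current_boundary T) (current_boundary (curve_current 0 a \<gamma>)) \<longrightarrow>
               functional_eq 1 T (curve_current 0 a \<gamma>)))"
proof -
  obtain C where C: "C-lipschitz_on {0..a} \<gamma>" using curve(1) unfolding lipschitz_curve_def by blast
  have rect: "integer_rectifiable_1current T" "rectifiable_1current T"
    using T(1) by (auto simp: integral_1current_def integer_rectifiable_1current_def)
  have m: "metric_current 1 T" using rect(2) by (simp add: rectifiable_1current_def)
  have LIPs0: "LIPs 0 = {[] :: ('a \<Rightarrow> real) list}" by (auto simp: LIPs_def)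
  have eq1: "functional_eq (Suc 0) S R \<longleftrightarrow> (\<forall>f\<in>LIPb. \<forall>p\<in>LIP. S f [p] = R f [p])" for S R :: "'a functional"
  proof -
    have "(\<forall>ps\<in>LIPs (Suc 0). Q ps) \<longleftrightarrow> (\<forall>p\<in>LIP. Q [p])" for Q :: "('a \<Rightarrow> real) list \<Rightarrow> bool"
      by (auto simp: LIPs_1)
    then show ?thesis by (simp add: functional_eq_def)
  qed
  have eq0: "functional_eq 0 (current_boundary S) R \<longleftrightarrow> (\<forall>f\<in>LIPb. S (\<lambda>_. 1) [f] = R f [])" for S R :: "'a functional"
    by (simp add: functional_eq_def LIPs0 current_boundary_def)
  have bd: "curve_current 0 a \<gamma> (\<lambda>_. 1) [p] = p (\<gamma> a) - p (\<gamma> 0)" if "p \<in> LIPb" for p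
    by (rule curve_current_boundary[OF C a LIPbD[OF that]])
  \<comment> \<open>For \<open>a = 0\<close> the current would live on one point, which has no mass,
    and so would be zero.\<close>
  have a_pos: "0 < a"
  proof (rule ccontr)
    assume "\<not> 0 < a"
    then have a0: "a = 0" using a by simp
    note out = rectifiable_mass_outside_support[OF rect(2), of "{\<gamma> 0}"]
    have ae: "AE x in mass1 T. x \<in> {\<gamma> 0}" by (rule out(1)) (use spt a0 in auto)
    have "emeasure (mass1 T) {\<gamma> 0} = 0" by (rule out(2)) (use spt a0 in auto)
    then have "AE x in mass1 T. x \<notin> {\<gamma> 0}"
      by (intro AE_not_in) (use mass1_finite_borel[OF m] in \<open>auto simp: finite_borel_measure_def null_sets_def\<close>)
    with ae have none: "AE x in mass1 T. False" by eventually_elim auto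
    have "T f [p] = 0" if f: "f \<in> LIPb" and p: "p \<in> LIP" for f p
    proof -
      have "\<bar>T f [p]\<bar> \<le> Lip p * (\<integral>x. \<bar>f x\<bar> \<partial>mass1 T)"
        using mass1_bound[OF m] f p by (simp add: mass_bound_1)
      moreover have "(\<integral>x. \<bar>f x\<bar> \<partial>mass1 T) = 0"
        by (rule integral_eq_zero_AE) (use none in eventually_elim, simp)
      ultimately show ?thesis by simp
    qed
    then show False using T(2) by (simp add: eq1)
  qed
  have inj': "r = 0 \<and> t = a" if "0 \<le> r" "r < t" "t \<le> a" "\<gamma> r = \<gamma> t" for r t
    using inj
  proof
    assume "inj_on \<gamma> {0..a}"
    then show ?thesis using that by (auto dest: inj_onD)
  next
    assume l: "injective_loop 0 a \<gamma>"
    then have i: "inj_on \<gamma> {0..<a}" and e: "\<gamma> 0 = \<gamma> a" by (auto simp: injective_loop_def)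
    have "t = a" using inj_onD[OF i that(4)] that by fastforce
    moreover have "r = 0" using inj_onD[OF i, of r 0] that e \<open>t = a\<close> by auto
    ultimately show ?thesis by simp
  qed
  \<comment> \<open>Truncated to be bounded, as the boundary is tested on \<open>LIPb\<close> only;
    it still separates the endpoints when these are distinct.\<close>
  define \<phi> where "\<phi> = (\<lambda>x. min 1 (dist (\<gamma> 0) x))"
  have \<phi>: "\<phi> \<in> LIPb" unfolding \<phi>_def by (rule LIPbI[OF LIP_min[OF LIP_const LIP_dist], of _ _ 1]) auto
  have \<phi>_sep: "\<phi> (\<gamma> a) - \<phi> (\<gamma> 0) \<noteq> 0" if "inj_on \<gamma> {0..a}"
  proof -
    have "\<gamma> 0 \<noteq> \<gamma> a" using inj_onD[OF that, of 0 a] a_pos by auto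
    then show ?thesis by (simp add: \<phi>_def min_def)
  qed
  note multiple = integral_current_multiple_of_curve[OF a_pos C inj' rect(1) spt]
  show ?thesis
  proof (intro conjI impI)
    assume "functional_eq 0 (current_boundary T) (\<lambda>f ps. 0)"
    then have cycle: "\<And>f. f \<in> LIPb \<Longrightarrow> T (\<lambda>_. 1) [f] = 0" by (simp add: eq0)
    obtain k :: int where k: "\<And>f p. f \<in> LIPb \<Longrightarrow> p \<in> LIP \<Longrightarrow> T f [p] = of_int k * curve_current 0 a \<gamma> f [p]"
      using multiple cycle by blast
    show "lipschitz_curve 0 a \<gamma>" by (rule curve(1))
    show "\<exists>k::int. functional_eq 1 T (\<lambda>f ps. of_int k * curve_current 0 a \<gamma> f ps)"
      using k by (auto simp: eq1)
    show "injective_loop 0 a \<gamma>"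
    proof (rule ccontr)
      assume "\<not> injective_loop 0 a \<gamma>"
      then have "inj_on \<gamma> {0..a}" using inj by blast
      \<comment> \<open>Testing the boundary with \<phi> gives \<open>k\<close> times a nonzero
        number, which vanishes for a cycle; then the current itself would be zero.\<close>
      then have "k = 0" using cycle[OF \<phi>] k[OF LIPb_const LIPbD[OF \<phi>]] bd[OF \<phi>] \<phi>_sep by simp
      then have "functional_eq 1 T (\<lambda>f ps. 0)" using k by (simp add: eq1)
      then show False using T(2) by contradiction
    qed
  next
    assume "inj_on \<gamma> {0..a}"
    show "functional_eq 0 (current_boundary (curve_current 0 a \<gamma>))
              (\<lambda>f ps. dirac_current (\<gamma> a) f ps - dirac_current (\<gamma> 0) f ps)"
      using bd by (simp add: eq0 dirac_current_def)
  next
    assume i: "inj_on \<gamma> {0..a}"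
    assume "functional_eq 0 (current_boundary T) (current_boundary (curve_current 0 a \<gamma>))"
    then have "\<forall>f\<in>LIPb. T (\<lambda>_. 1) [f] = current_boundary (curve_current 0 a \<gamma>) f []" by (simp only: eq0)
    then have same: "\<And>f. f \<in> LIPb \<Longrightarrow> T (\<lambda>_. 1) [f] = f (\<gamma> a) - f (\<gamma> 0)"
      using bd by (simp add: current_boundary_def)
    then have "\<And>f. f \<in> LIPb \<Longrightarrow> f (\<gamma> 0) = 0 \<Longrightarrow> f (\<gamma> a) = 0 \<Longrightarrow> T (\<lambda>_. 1) [f] = 0" by simp
    then obtain k :: int where k: "\<And>f p. f \<in> LIPb \<Longrightarrow> p \<in> LIP \<Longrightarrow> T f [p] = of_int k * curve_current 0 a \<gamma> f [p]"
      using multiple by blast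
    have "k = 1" using same[OF \<phi>] k[OF LIPb_const LIPbD[OF \<phi>]] bd[OF \<phi>] \<phi>_sep[OF i] by simp
    then show "functional_eq 1 T (curve_current 0 a \<gamma>)" using k by (simp add: eq1)
  qed
qed

end
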